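(* Let $\mathcal{K}$ be a finite nonempty set of nonnegative $N\times N$ matrices that satisfies the product property and all of whose members have positive spectral radius, and let $f_{\mathcal{K}}(v)=\min_{A\in\mathcal{K}}Av$. Let $\lambda$ be the spectral radius and $\nu$ the degree of a $\preceq$-minimal matrix for $\mathcal{K}$, and let $\{S_0,S_1,\ldots,S_\nu\}$ be the principal $\preceq$-minimal partition of $S=\{1,\ldots,N\}$ with respect to $\mathcal{K}$. Then for any strictly positive vector $v$, any $k\ge 1$ and any $i\in S_k$, \[ (f_{\mathcal{K}}^n(v))_i\sim n^{k-1}\lambda^n . \] Moreover, for any $\preceq$-minimal matrix $B\in\mathcal{K}$, \[ (f_{\mathcal{K}}^n(v))_i\sim (B^nv)_i \] for any strictly positive vector $v$ and any $i\in S$.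
   Context: All vector inequalities and minima of vectors are component-wise; a vector $v$ is strictly positive ($v>0$) if all its components are positive. $f_{\mathcal{K}}^n$ denotes the $n$-fold iterate of $f_{\mathcal{K}}$. $S=\{1,\ldots,N\}$ is the state space; for $S_1,S_2\subset S$, $A|_{(S_1,S_2)}$ is the restriction of $A$ to $S_1\times S_2$; $spr(A)$ is the spectral radius. Product property: $\mathcal{K}$ satisfies the product property if for every $V\subseteq S$ and all $A,B\in\mathcal{K}$, the matrix whose $i$th row is the $i$th row of $A$ for $i\in V$ and the $i$th row of $B$ for $i\in S\setminus V$ belongs to $\mathcal{K}$. Growth: for sequences $a_n,b_n$ of nonnegative numbers (or nonnegative vectors of the same dimension), $a_n\preceq b_n$ means that there is a constant $q>0$ with $a_n\le q\,b_n$ for all $n$ large enough; $a_n\sim b_n$ means $a_n\preceq b_n$ and $b_n\preceq a_n$. $\preceq$-minimal: $B\in\mathcal{K}$ is $\preceq$-minimal for $\mathcal{K}$ if $B^nv\preceq A^nv$ for all $A\in\mathcal{K}$ and all $v>0$. Such matrices exist, and all of them have the same spectral radius, degree and principal partition (defined below), so $\lambda$, $\nu$ and the partition below are well defined. Principal partition of a nonnegative matrix $A$: state $i$ has access to state $j$ if $(A^n)_{ij}>0$ for some integer $n\ge 0$; a matrix is irreducible if any two states have access to each other. A class of $A$ is a maximal subset $C\subset S$ such that $A|_{(C,C)}$ is irreducible; the classes partition $S$. A class $C$ is basic if $spr(A|_{(C,C)})=spr(A)$. A class $C$ has access to a class $C'$ if some (equivalently any) state of $C$ has access to some (equivalently any)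 state of $C'$. A chain of classes is an ordered collection of (pairwise distinct) classes $C_1,\ldots,C_n$ such that $C_i$ has access to $C_{i+1}$ for $i=1,\ldots,n-1$; its length is the number of basic classes it contains. The depth of a class $C$ is the length of the longest chain starting with $C$; the degree $\nu(A)$ is the length of the longest chain of $A$. $S_i$ is the union of all classes of depth $i$, and $\{S_0,S_1,\ldots,S_{\nu(A)}\}$ is the principal partition of $S$ with respect to $A$ ($S_0$ may be empty). The principal $\preceq$-minimal partition of $S$ with respect to $\mathcal{K}$ is the principal partition of a $\preceq$-minimal matrix for $\mathcal{K}$. *)

theory Defs
  imports
    Jordan_Normal_Form.Spectral_Radius
    Jordan_Normal_Form.DL_Submatrix
begin

text \<open>The state space is \<open>{0..<N}\<close>, following the zero-based indexing of \<open>'a mat\<close> and \<open>'a vec\<close>.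
  The restriction of \<open>A\<close> to \<open>C \<times> C\<close> is \<open>submatrix A C C\<close>, which re-indexes \<open>C\<close> increasingly by
  \<open>{0..<card C}\<close>. The order \<open>\<le>\<close> on vectors and matrices is component-wise (with equal dimensions).\<close>

definition nonneg_mat :: "real mat \<Rightarrow> bool" where
  "nonneg_mat A \<longleftrightarrow> 0\<^sub>m (dim_row A) (dim_col A) \<le> A"

text \<open>The library order \<open><\<close> on vectors only means \<open>\<le>\<close> and not \<open>\<ge>\<close>, hence a separate notion.\<close>

definition pos_vec :: "real vec \<Rightarrow> bool" where
  "pos_vec v \<longleftrightarrow> (\<forall>i<dim_vec v. 0 < v $ i)"

definition spr :: "real mat \<Rightarrow> real" where
  "spr A = spectral_radius (map_mat complex_of_real A)"

definition product_property :: "nat \<Rightarrow> real mat set \<Rightarrow> bool" where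
  "product_property N K \<longleftrightarrow>
     (\<forall>V \<subseteq> {0..<N}. \<forall>A\<in>K. \<forall>B\<in>K.
        mat N N (\<lambda>(i, j). if i \<in> V then A $$ (i, j) else B $$ (i, j)) \<in> K)"

definition min_map :: "real mat set \<Rightarrow> real vec \<Rightarrow> real vec" where
  "min_map K v = vec (dim_vec v) (\<lambda>i. MIN A\<in>K. (A *\<^sub>v v) $ i)"

definition growth_le :: "(nat \<Rightarrow> real) \<Rightarrow> (nat \<Rightarrow> real) \<Rightarrow> bool" where
  "growth_le a b \<longleftrightarrow> (\<exists>q>0. \<forall>\<^sub>F n in sequentially. a n \<le> q * b n)"

definition growth_eq :: "(nat \<Rightarrow> real) \<Rightarrow> (nat \<Rightarrow> real) \<Rightarrow> bool" where
  "growth_eq a b \<longleftrightarrow> growth_le a b \<and> growth_le b a"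

definition vec_growth_le :: "(nat \<Rightarrow> real vec) \<Rightarrow> (nat \<Rightarrow> real vec) \<Rightarrow> bool" where
  "vec_growth_le a b \<longleftrightarrow> (\<exists>q>0. \<forall>\<^sub>F n in sequentially. a n \<le> q \<cdot>\<^sub>v b n)"

definition growth_minimal :: "nat \<Rightarrow> real mat set \<Rightarrow> real mat \<Rightarrow> bool" where
  "growth_minimal N K B \<longleftrightarrow> B \<in> K \<and>
     (\<forall>A\<in>K. \<forall>v\<in>carrier_vec N. pos_vec v \<longrightarrow>
        vec_growth_le (\<lambda>n. (B ^\<^sub>m n) *\<^sub>v v) (\<lambda>n. (A ^\<^sub>m n) *\<^sub>v v))"

definition has_access :: "real mat \<Rightarrow> nat \<Rightarrow> nat \<Rightarrow> bool" where
  "has_access A i j \<longleftrightarrow> (\<exists>n. 0 < (A ^\<^sub>m n) $$ (i, j))"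

definition irreducible_nonneg :: "real mat \<Rightarrow> bool" where
  "irreducible_nonneg A \<longleftrightarrow> (\<forall>i<dim_row A. \<forall>j<dim_row A. has_access A i j)"

definition is_class :: "real mat \<Rightarrow> nat set \<Rightarrow> bool" where
  "is_class A C \<longleftrightarrow> C \<noteq> {} \<and> C \<subseteq> {0..<dim_row A} \<and> irreducible_nonneg (submatrix A C C) \<and>
     (\<forall>D \<subseteq> {0..<dim_row A}. C \<subset> D \<longrightarrow> \<not> irreducible_nonneg (submatrix A D D))"

definition basic_class :: "real mat \<Rightarrow> nat set \<Rightarrow> bool" where
  "basic_class A C \<longleftrightarrow> is_class A C \<and> spr (submatrix A C C) = spr A"

definition class_access :: "real mat \<Rightarrow> nat set \<Rightarrow> nat set \<Rightarrow> bool" where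
  "class_access A C D \<longleftrightarrow> (\<exists>i\<in>C. \<exists>j\<in>D. has_access A i j)"

definition class_chain :: "real mat \<Rightarrow> nat set list \<Rightarrow> bool" where
  "class_chain A Cs \<longleftrightarrow> Cs \<noteq> [] \<and> distinct Cs \<and> (\<forall>C\<in>set Cs. is_class A C) \<and>
     (\<forall>i. Suc i < length Cs \<longrightarrow> class_access A (Cs ! i) (Cs ! Suc i))"

definition chain_length :: "real mat \<Rightarrow> nat set list \<Rightarrow> nat" where
  "chain_length A Cs = length (filter (basic_class A) Cs)"

definition class_depth :: "real mat \<Rightarrow> nat set \<Rightarrow> nat" where
  "class_depth A C = Max {chain_length A Cs | Cs. class_chain A Cs \<and> hd Cs = C}"

definition mat_degree :: "real mat \<Rightarrow> nat" where
  "mat_degree A = Max {chain_length A Cs | Cs. class_chain A Cs}"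

definition principal_part :: "real mat \<Rightarrow> nat \<Rightarrow> nat set" where
  "principal_part A k = \<Union>{C. is_class A C \<and> class_depth A C = k}"

end

theory Submission
  imports Defs
begin

text \<open>
  Let \<open>f\<close> be the minimum map. The bound \<open>f\<^sup>n(v) \<le> B\<^sup>n v\<close> is immediate. By recursion over the classes, using
  Perron vectors, each component of \<open>B\<^sup>n v\<close> has an exact growth \<open>n\<^sup>l r\<^sup>n\<close>, and \<open>(r, l) = (spr B, k - 1)\<close> for the
  states of depth \<open>k \<ge> 1\<close>.

  For the lower bound one looks for vectors \<open>u\<^sub>n\<close> of the same growth with \<open>u\<^sub>n\<^sub>+\<^sub>1 \<le> f(u\<^sub>n)\<close> for large \<open>n\<close>, separately for
  each rate \<open>r\<close>, which may be taken to be 1. Rows with an entry at a state of larger rate satisfy this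
  inequality eventually, and states of smaller rate can be dropped. On the states with \<open>l = 0\<close> take
  \<open>u\<^sub>n = w\<close> with \<open>w \<le> f(w)\<close>. On the others let \<open>x(s) = z + f(x(s)) / s\<close> be the optimal value of the problem
  discounted by \<open>1 / s\<close>, which is attained by a single matrix of the product set, and let
  \<open>u\<^sub>n = (s\<^sub>n - 1) / s\<^sub>n x(s\<^sub>n)\<close> with \<open>s\<^sub>n = 1 + q / n\<close>. Then \<open>f(u\<^sub>n) = (s\<^sub>n - 1) (x(s\<^sub>n) - z)\<close>, and for large \<open>q\<close>
  this is at least \<open>u\<^sub>n\<^sub>+\<^sub>1\<close>, because \<open>x(s\<^sub>n\<^sub>+\<^sub>1) \<le> (1 + O(1 / n)) x(s\<^sub>n)\<close> with a constant that does not depend on \<open>q\<close>.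
\<close>

subsection \<open>Nonnegative matrices as functions on a finite index set\<close>

text \<open>Minimality of \<open>B\<close> speaks about powers of single matrices, whereas the
  iterates of \<open>f\<close> multiply \<open>n\<close> possibly different ones. Discounting
  bridges this gap: the optimal discounted value belongs to one fixed policy, so minimality applies
  to it, and yet it satisfies an inequality that is valid for all rows at once. The parameter
  \<open>q\<close> makes the losses cancel to first order. The coefficient of \<open>x\<close> is
  \<open>q / n\<close> in \<open>f (u n)\<close> and \<open>q / (n + 1 + q)\<close> in
  \<open>u (n + 1)\<close>, a drop by the factor \<open>1 - (1 + q) / n\<close> up to higher order.
  If \<open>q\<close> is also the variation constant of \<open>x\<close>, then \<open>x\<close>
  itself grows at most by about \<open>1 + q / n\<close>, and a surplus of relative size
  \<open>1 / n\<close> is left to pay for \<open>z\<close>. Relative to \<open>x\<close>, the vector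
  \<open>z\<close> has size \<open>n^(-l-1)\<close>. For \<open>l \<ge> 1\<close> the surplus wins;
  for \<open>l = 0\<close> both have order \<open>1 / n\<close> with uncontrolled constants.
  Therefore the states with \<open>l = 0\<close> get a constant vector \<open>w\<close> and are
  frozen by identity rows before the discounted problem for the others is set up.\<close>

definition ap :: "'a set \<Rightarrow> ('a \<Rightarrow> 'a \<Rightarrow> real) \<Rightarrow> ('a \<Rightarrow> real) \<Rightarrow> 'a \<Rightarrow> real" where
  "ap S A x i = (\<Sum>j\<in>S. A i j * x j)"

abbreviation it :: "'a set \<Rightarrow> ('a \<Rightarrow> 'a \<Rightarrow> real) \<Rightarrow> nat \<Rightarrow> ('a \<Rightarrow> real) \<Rightarrow> 'a \<Rightarrow> real" where
  "it S A n \<equiv> ap S A ^^ n"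

definition nonneg_on :: "'a set \<Rightarrow> ('a \<Rightarrow> 'a \<Rightarrow> real) \<Rightarrow> bool" where
  "nonneg_on S A \<longleftrightarrow> (\<forall>i\<in>S. \<forall>j\<in>S. 0 \<le> A i j)"

lemma nonneg_onD: "nonneg_on S A \<Longrightarrow> i \<in> S \<Longrightarrow> j \<in> S \<Longrightarrow> 0 \<le> A i j"
  by (simp add: nonneg_on_def)

lemma nonneg_on_subset: "nonneg_on S A \<Longrightarrow> T \<subseteq> S \<Longrightarrow> nonneg_on T A"
  by (auto simp: nonneg_on_def)

lemma it_Suc: "it S A (Suc n) x i = (\<Sum>j\<in>S. A i j * it S A n x j)"
  by (simp add: ap_def)

lemma it_Suc_inner: "it S A (Suc n) x = it S A n (ap S A x)"
  by (simp add: funpow_swap1)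

lemma it_add: "it S A (m + n) x = it S A m (it S A n x)"
  by (simp add: funpow_add)

lemma it_cong:
  assumes "\<And>i j. i \<in> S \<Longrightarrow> j \<in> S \<Longrightarrow> A i j = A' i j" "\<And>i. i \<in> S \<Longrightarrow> x i = x' i" "i \<in> S"
  shows "it S A n x i = it S A' n x' i"
  using assms(3)
proof (induction n arbitrary: i)
  case 0
  then show ?case using assms by simp
next
  case (Suc n)
  show ?case unfolding it_Suc by (rule sum.cong) (use assms(1) Suc in auto)
qed

lemma ap_mono:
  assumes "nonneg_on S A" "\<And>j. j \<in> S \<Longrightarrow> x j \<le> y j" "i \<in> S"
  shows "ap S A x i \<le> ap S A y i"
  unfolding ap_def by (rule sum_mono) (use assms in \<open>auto intro: mult_left_mono nonneg_onD\<close>)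

lemma it_mono:
  assumes "nonneg_on S A" "\<And>j. j \<in> S \<Longrightarrow> x j \<le> y j" "i \<in> S"
  shows "it S A n x i \<le> it S A n y i"
  using assms(3)
proof (induction n arbitrary: i)
  case 0
  then show ?case using assms by simp
next
  case (Suc n)
  show ?case using ap_mono[OF assms(1) Suc.IH Suc.prems] by simp
qed

lemma it_cmult: "it S A n (\<lambda>i. c * x i) i = c * it S A n x i"
proof (induction n arbitrary: i)
  case (Suc n)
  show ?case unfolding it_Suc by (simp add: Suc sum_distrib_left algebra_simps)
qed simp

lemma it_plus: "it S A n (\<lambda>i. x i + y i) i = it S A n x i + it S A n y i"
proof (induction n arbitrary: i)
  case (Suc n)
  show ?case unfolding it_Suc by (simp add: Suc sum.distrib algebra_simps)
qed simp

lemma it_scale: "it S (\<lambda>i j. c * A i j) n x i = c ^ n * it S A n x i"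
proof (induction n arbitrary: i)
  case (Suc n)
  show ?case unfolding it_Suc by (simp add: Suc sum_distrib_left algebra_simps)
qed simp

lemma it_nonneg:
  assumes "nonneg_on S A" "\<And>j. j \<in> S \<Longrightarrow> 0 \<le> x j" "i \<in> S"
  shows "0 \<le> it S A n x i"
  using assms(3)
proof (induction n arbitrary: i)
  case 0
  then show ?case using assms by simp
next
  case (Suc n)
  show ?case unfolding it_Suc
    by (rule sum_nonneg) (use assms(1) Suc in \<open>auto intro: mult_nonneg_nonneg nonneg_onD\<close>)
qed

lemma it_closed:
  assumes "finite S" "T \<subseteq> S" "\<And>i j. i \<in> T \<Longrightarrow> j \<in> S - T \<Longrightarrow> A i j = 0" "i \<in> T"
  shows "it S A n x i = it T A n x i"
  using assms(4)
proof (induction n arbitrary: i)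
  case (Suc n)
  have "it S A (Suc n) x i = (\<Sum>j\<in>T. A i j * it S A n x j)" unfolding it_Suc
    by (rule sum.mono_neutral_right) (use assms Suc.prems in auto)
  also have "\<dots> = it T A (Suc n) x i" unfolding it_Suc by (rule sum.cong) (auto simp: Suc.IH)
  finally show ?case .
qed simp

lemma member_le_ap:
  assumes "finite S" "nonneg_on S A" "\<And>j. j \<in> S \<Longrightarrow> 0 \<le> x j" "i \<in> S" "j \<in> S"
  shows "A i j * x j \<le> ap S A x i"
  unfolding ap_def using assms by (intro member_le_sum) (auto intro: mult_nonneg_nonneg nonneg_onD)

text \<open>\<open>P i\<close> is closed upwards in its parameter, so the largest of finitely many
  constants serves every index. The index set will be the states or the finitely many
  policies.\<close>

lemma finite_uniform:
  fixes P :: "'a \<Rightarrow> real \<Rightarrow> bool"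
  assumes "finite S" "\<And>i. i \<in> S \<Longrightarrow> \<exists>q>0. P i q" "\<And>i q q'. i \<in> S \<Longrightarrow> P i q \<Longrightarrow> q \<le> q' \<Longrightarrow> P i q'"
  shows "\<exists>q>0. \<forall>i\<in>S. P i q"
  using assms
proof (induction S)
  case empty
  show ?case by (rule exI[of _ 1]) auto
next
  case (insert i S)
  have "\<exists>q>0. \<forall>i\<in>S. P i q"
    by (rule insert.IH) (use insert.prems in blast)+
  then obtain q where q: "q > 0" "\<forall>i\<in>S. P i q" by blast
  obtain q' where q': "q' > 0" "P i q'" using insert by blast
  have "P i (max q q')" using insert.prems(2)[of i q' "max q q'"] q' by auto
  moreover have "\<forall>i\<in>S. P i (max q q')" using insert.prems(2)[of _ q "max q q'"] q by auto
  ultimately show ?case using q by (intro exI[of _ "max q q'"]) auto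
qed

lemma finite_uniform_small:
  fixes P :: "'a \<Rightarrow> real \<Rightarrow> bool"
  assumes "finite S" "\<And>i. i \<in> S \<Longrightarrow> \<exists>q>0. P i q" "\<And>i q q'. i \<in> S \<Longrightarrow> P i q \<Longrightarrow> 0 < q' \<Longrightarrow> q' \<le> q \<Longrightarrow> P i q'"
  shows "\<exists>q>0. \<forall>i\<in>S. P i q"
  using assms
proof (induction S)
  case empty
  show ?case by (rule exI[of _ 1]) auto
next
  case (insert i S)
  have "\<exists>q>0. \<forall>i\<in>S. P i q"
    by (rule insert.IH) (use insert.prems in blast)+
  then obtain q where q: "q > 0" "\<forall>i\<in>S. P i q" by blast
  obtain q' where q': "q' > 0" "P i q'" using insert by blast
  have "P i (min q q')" using insert.prems(2)[of i q' "min q q'"] q' q by auto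
  moreover have "\<forall>i\<in>S. P i (min q q')" using insert.prems(2)[of _ q "min q q'"] q q' by auto
  ultimately show ?case using q q' by (intro exI[of _ "min q q'"]) auto
qed

lemma finite_upper:
  fixes x :: "'a \<Rightarrow> real"
  assumes "finite S"
  shows "\<exists>c>0. \<forall>i\<in>S. x i \<le> c"
proof (rule finite_uniform[OF assms])
  fix i show "\<exists>q>0. x i \<le> q" by (intro exI[of _ "max 1 (x i)"]) auto
qed auto

lemma finite_lower:
  fixes x :: "'a \<Rightarrow> real"
  assumes "finite S" "\<And>i. i \<in> S \<Longrightarrow> 0 < x i"
  shows "\<exists>c>0. \<forall>i\<in>S. c \<le> x i"
  by (rule finite_uniform_small[OF assms(1)]) (use assms(2) in auto)

text \<open>A positive vector satisfies \<open>A x \<le> (C / c) x\<close> for suitable constants,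
  so by monotonicity the iterate at \<open>n + 1\<close> is at most \<open>C / c\<close> times the
  iterate at \<open>n\<close>. A component that vanishes once never recovers.\<close>

lemma it_zero_persist:
  assumes "finite S" "nonneg_on S A" "\<And>j. j \<in> S \<Longrightarrow> 0 < x j" "i \<in> S" "it S A n x i = 0" "n \<le> m"
  shows "it S A m x i = 0"
proof -
  have *: "it S A (Suc n) x i = 0" if "it S A n x i = 0" for n
  proof -
    obtain c where c: "c > 0" "\<forall>j\<in>S. c \<le> x j" using finite_lower[of S x] assms by auto
    obtain C where C: "C > 0" "\<forall>j\<in>S. ap S A x j \<le> C" using finite_upper[of S "ap S A x"] assms by auto
    have "ap S A x j \<le> C / c * x j" if "j \<in> S" for j
    proof -
      have "C / c * c \<le> C / c * x j" by (rule mult_left_mono) (use c C that in auto)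
      then show ?thesis using C that c by force
    qed
    then have "it S A n (ap S A x) i \<le> it S A n (\<lambda>j. C / c * x j) i"
      by (rule it_mono[OF assms(2) _ assms(4)])
    then have "it S A (Suc n) x i \<le> 0" using that unfolding it_Suc_inner it_cmult by simp
    moreover have "0 \<le> it S A (Suc n) x i"
      by (rule it_nonneg) (use assms in \<open>auto intro: less_imp_le\<close>)
    ultimately show ?thesis by linarith
  qed
  show ?thesis using assms(6,5) by (induction rule: dec_induct) (blast intro: *)+
qed

subsection \<open>Growth\<close>

text \<open>The shape \<open>n ^ l * r ^ n\<close>, with \<open>n + 1\<close> in place of \<open>n\<close> so that it is positive at \<open>n = 0\<close>; the rate
  \<open>r = 0\<close> describes the sequences that are eventually zero.\<close>

definition pe :: "real \<Rightarrow> nat \<Rightarrow> nat \<Rightarrow> real" where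
  "pe r l n = real (Suc n) ^ l * r ^ n"

lemma pe_nonneg: "0 \<le> r \<Longrightarrow> 0 \<le> pe r l n"
  by (simp add: pe_def)

lemma pe_pos: "0 < r \<Longrightarrow> 0 < pe r l n"
  by (simp add: pe_def)

lemma growth_leI: "0 < q \<Longrightarrow> (\<And>n. n \<ge> n0 \<Longrightarrow> a n \<le> q * b n) \<Longrightarrow> growth_le a b"
  unfolding growth_le_def eventually_sequentially by blast

lemma growth_leE:
  assumes "growth_le a b"
  obtains q n0 where "0 < q" "\<And>n. n \<ge> n0 \<Longrightarrow> a n \<le> q * b n"
  using assms unfolding growth_le_def eventually_sequentially by blast

lemma growth_le_trans [trans]:
  assumes "growth_le a b" "growth_le b c" shows "growth_le a c"
proof -
  obtain q n0 where 1: "0 < q" "\<And>n. n \<ge> n0 \<Longrightarrow> a n \<le> q * b n" using growth_leE[OF assms(1)] by blast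
  obtain q' n1 where 2: "0 < q'" "\<And>n. n \<ge> n1 \<Longrightarrow> b n \<le> q' * c n" using growth_leE[OF assms(2)] by blast
  show ?thesis
  proof (rule growth_leI[of "q * q'" "max n0 n1"])
    fix n assume n: "n \<ge> max n0 n1"
    have "q * b n \<le> q * (q' * c n)" using 1 2(2)[of n] n by (intro mult_left_mono) auto
    then show "a n \<le> q * q' * c n" using 1(2)[of n] n by simp
  qed (use 1 2 in auto)
qed

lemma growth_eq_trans: "growth_eq a b \<Longrightarrow> growth_eq b c \<Longrightarrow> growth_eq a c"
  unfolding growth_eq_def using growth_le_trans by blast

text \<open>The finitely many exceptional indices are absorbed into the constant, which needs
  \<open>b\<close> to vanish nowhere; this is where the shift by one in \<open>pe\<close> pays
  off.\<close>

lemma growth_le_all: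
  assumes "growth_le a b" "\<And>n. 0 < b n"
  shows "\<exists>q>0. \<forall>n. a n \<le> q * b n"
proof -
  obtain q n0 where 1: "0 < q" "\<And>n. n \<ge> n0 \<Longrightarrow> a n \<le> q * b n" using growth_leE[OF assms(1)] by blast
  obtain c where c: "c > 0" "\<forall>n\<in>{..<n0}. a n / b n \<le> c"
    using finite_upper[of "{..<n0}" "\<lambda>n. a n / b n"] by auto
  show ?thesis
  proof (intro exI[of _ "max q c"] conjI allI)
    fix n
    show "a n \<le> max q c * b n"
    proof (cases "n \<ge> n0")
      case True
      then have "a n \<le> q * b n" using 1 by auto
      also have "\<dots> \<le> max q c * b n" using assms(2)[of n] by (intro mult_right_mono) auto
      finally show ?thesis .
    next
      case False
      then have "a n / b n \<le> c" using c by auto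
      then have "a n \<le> c * b n" using assms(2)[of n] by (simp add: field_simps)
      also have "\<dots> \<le> max q c * b n" using assms(2)[of n] by (intro mult_right_mono) auto
      finally show ?thesis .
    qed
  qed (use 1 in auto)
qed

lemma growth_le_sum:
  assumes "finite Q" "\<And>j. j \<in> Q \<Longrightarrow> growth_le (\<lambda>n. a n j) b" "\<And>n. 0 \<le> b n"
  shows "growth_le (\<lambda>n. \<Sum>j\<in>Q. a n j) b"
  using assms
proof (induction Q)
  case empty
  show ?case by (rule growth_leI[of 1]) (use assms(3) in auto)
next
  case (insert i Q)
  obtain q n0 where 1: "0 < q" "\<And>n. n \<ge> n0 \<Longrightarrow> a n i \<le> q * b n"
    using growth_leE[OF insert.prems(1)[of i]] by blast
  obtain q' n1 where 2: "0 < q'" "\<And>n. n \<ge> n1 \<Longrightarrow> (\<Sum>j\<in>Q. a n j) \<le> q' * b n"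
    using growth_leE[OF insert.IH] insert.prems by (metis insertCI)
  show ?case
  proof (rule growth_leI[of "q + q'" "max n0 n1"])
    fix n assume "n \<ge> max n0 n1"
    then show "(\<Sum>j\<in>insert i Q. a n j) \<le> (q + q') * b n"
      using 1(2)[of n] 2(2)[of n] insert.hyps by (simp add: distrib_right)
  qed (use 1 2 in auto)
qed

lemma growth_le_cmult: "0 < c \<Longrightarrow> growth_le (\<lambda>n. c * a n) a"
  by (rule growth_leI[of c]) auto

lemma growth_le_cmult': "0 < c \<Longrightarrow> growth_le a (\<lambda>n. c * a n)"
  by (rule growth_leI[of "1/c"]) auto

lemma growth_le_mono: "(\<And>n. a n \<le> b n) \<Longrightarrow> growth_le a b"
  by (rule growth_leI[of 1]) auto

text \<open>An exponential gap beats any polynomial factor, hence the lexicographic order with the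
  rate first. The rate 0 is split off because \<open>poly_exp_bound\<close> needs a positive
  base.\<close>

lemma pe_dom:
  assumes "0 \<le> r" "r < r' \<or> r = r' \<and> l \<le> l'"
  shows "growth_le (pe r l) (pe r' l')"
proof (cases "r = r'")
  case True
  show ?thesis
  proof (rule growth_le_mono)
    fix n
    have "real (Suc n) ^ l \<le> real (Suc n) ^ l'"
      using assms True by (intro power_increasing) auto
    then show "pe r l n \<le> pe r' l' n" using True assms(1) by (simp add: pe_def mult_right_mono)
  qed
next
  case False
  then have r: "r < r'" using assms by auto
  show ?thesis
  proof (cases "r = 0")
    case True
    show ?thesis
      by (rule growth_leI[of 1 1]) (use True r in \<open>auto simp: pe_def power_0_left\<close>)
  next
    case False
    define b where "b = r / r'"
    have b: "0 < b" "b < 1" using False r assms(1) by (auto simp: b_def)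
    obtain p where p: "\<And>x. b ^ x * real x ^ l \<le> p" using poly_exp_bound[OF b, of l] by auto
    have p0: "0 < p" using p[of 1] b by simp
    show ?thesis
    proof (rule growth_leI[of "p / b" 0])
      fix n
      have "pe r l n = b ^ Suc n * real (Suc n) ^ l * (r' ^ n / b)"
        using b r assms(1) False by (simp add: pe_def b_def power_divide field_simps)
      also have "\<dots> \<le> p * (r' ^ n / b)" using b r assms(1) by (intro mult_right_mono p) auto
      also have "\<dots> = p / b * (1 * r' ^ n)" by simp
      also have "\<dots> \<le> p / b * pe r' l' n" unfolding pe_def
        using p0 b r assms(1) by (intro mult_left_mono mult_right_mono one_le_power) auto
      finally show "pe r l n \<le> p / b * pe r' l' n" .
    qed (use p0 b in auto)
  qed
qed

text \<open>Together with \<open>pe_dom\<close> this identifies growth with the lexicographic order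
  of the pairs. A zero rate on the left has to be excluded: \<open>pe 0 l\<close> is eventually zero
  and lies below every other shape.\<close>

lemma pe_dom_strict:
  assumes "growth_le (pe r l) (pe r' l')" "0 < r" "0 \<le> r'"
  shows "r < r' \<or> r = r' \<and> l \<le> l'"
proof (rule ccontr)
  assume "\<not> ?thesis"
  then consider "r' < r" | "r = r'" "l' < l" by linarith
  then show False
  proof cases
    case 1
    \<comment> \<open>A rate strictly between the two absorbs the polynomial factor of the
      right-hand side, so that only pure powers remain to be compared.\<close>
    define s where "s = (r + r') / 2"
    have s: "r' < s" "s < r" "0 < s" using 1 assms by (auto simp: s_def field_simps)
    have "growth_le (pe r l) (pe s 0)" using growth_le_trans[OF assms(1) pe_dom] assms s by auto
    then obtain q where q: "0 < q" "\<And>n. pe r l n \<le> q * pe s 0 n"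
      using growth_le_all pe_pos s by blast
    have "(r / s) ^ n \<le> q" for n
    proof -
      have "1 * r ^ n \<le> pe r l n" unfolding pe_def using assms by (intro mult_right_mono one_le_power) auto
      also have "\<dots> \<le> q * s ^ n" using q(2)[of n] by (simp add: pe_def)
      finally show ?thesis using s by (simp add: power_divide field_simps)
    qed
    moreover obtain n where "q < (r / s) ^ n" using real_arch_pow[of "r / s" q] s by auto
    ultimately show False by (meson not_le)
  next
    case 2
    obtain q where q: "0 < q" "\<And>n. pe r l n \<le> q * pe r' l' n"
      using growth_le_all[OF assms(1)] pe_pos assms 2 by blast
    have "real (Suc n) \<le> q" for n
    proof -
      have "real (Suc n) ^ l \<le> q * real (Suc n) ^ l'" using q(2)[of n] assms 2 by (simp add: pe_def)
      moreover have "real (Suc n) ^ Suc l' \<le> real (Suc n) ^ l" using 2 by (intro power_increasing) auto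
      ultimately have "real (Suc n) * real (Suc n) ^ l' \<le> q * real (Suc n) ^ l'"
        unfolding power_Suc by (rule order_trans[rotated])
      then show ?thesis by (rule mult_right_le_imp_le) simp
    qed
    moreover obtain n where "q < real n" using reals_Archimedean2 by blast
    ultimately have "real (Suc n) < real n" by (rule le_less_trans)
    then show False by simp
  qed
qed

lemma growth_eq_pe_power:
  assumes "0 \<le> r"
  shows "growth_eq (pe r l) (\<lambda>n. real n ^ l * r ^ n)"
  unfolding growth_eq_def
proof
  show "growth_le (pe r l) (\<lambda>n. real n ^ l * r ^ n)"
  proof (rule growth_leI[of "2 ^ l" 1])
    fix n :: nat assume "1 \<le> n"
    then have "real (Suc n) ^ l \<le> (2 * real n) ^ l" by (intro power_mono) auto
    then have "real (Suc n) ^ l * r ^ n \<le> (2 * real n) ^ l * r ^ n" using assms by (intro mult_right_mono) auto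
    then show "pe r l n \<le> 2 ^ l * (real n ^ l * r ^ n)" by (simp add: pe_def power_mult_distrib)
  qed simp
  show "growth_le (\<lambda>n. real n ^ l * r ^ n) (pe r l)"
    by (rule growth_le_mono) (use assms in \<open>auto simp: pe_def intro!: mult_right_mono power_mono\<close>)
qed

lemma pe_shift:
  assumes "0 \<le> r"
  shows "growth_eq (\<lambda>n. pe r l (n + p)) (pe r l)"
proof (cases "r = 0")
  case True
  show ?thesis unfolding growth_eq_def
    by (intro conjI; rule growth_leI[of 1 1]) (use True in \<open>auto simp: pe_def power_0_left\<close>)
next
  case False
  then have r: "0 < r" using assms by simp
  show ?thesis unfolding growth_eq_def
  proof
    show "growth_le (\<lambda>n. pe r l (n + p)) (pe r l)"
    proof (rule growth_leI[of "real (Suc p) ^ l * r ^ p" 0])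
      fix n :: nat
      have "real (Suc (n + p)) \<le> real (Suc p) * real (Suc n)" by (simp add: algebra_simps)
      then have "real (Suc (n + p)) ^ l \<le> (real (Suc p) * real (Suc n)) ^ l" by (intro power_mono) auto
      then have "real (Suc (n + p)) ^ l * r ^ (n + p) \<le> (real (Suc p) * real (Suc n)) ^ l * r ^ (n + p)"
        using r by (intro mult_right_mono) auto
      then show "pe r l (n + p) \<le> real (Suc p) ^ l * r ^ p * pe r l n"
        by (simp add: pe_def power_mult_distrib power_add mult_ac)
    qed (use r in auto)
    show "growth_le (pe r l) (\<lambda>n. pe r l (n + p))"
    proof (rule growth_leI[of "1 / r ^ p" 0])
      fix n :: nat
      have "real (Suc n) ^ l * r ^ n \<le> real (Suc (n + p)) ^ l * r ^ n"
        using r by (intro mult_right_mono power_mono) auto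
      then show "pe r l n \<le> 1 / r ^ p * pe r l (n + p)" using r by (simp add: pe_def power_add)
    qed (use r in auto)
  qed
qed

lemma growth_le_shift: "growth_le a b \<Longrightarrow> growth_le (\<lambda>n. a (n + p)) (\<lambda>n. b (n + p))"
proof (elim growth_leE)
  fix q :: real and n0
  assume *: "0 < q" "\<And>n. n0 \<le> n \<Longrightarrow> a n \<le> q * b n"
  show ?thesis by (rule growth_leI[of q n0]) (use * in auto)
qed

lemma growth_le_unshift: "growth_le (\<lambda>n. a (n + p)) (\<lambda>n. b (n + p)) \<Longrightarrow> growth_le a b"
proof (elim growth_leE)
  fix q :: real and n0
  assume *: "0 < q" "\<And>n. n0 \<le> n \<Longrightarrow> a (n + p) \<le> q * b (n + p)"
  show ?thesis
  proof (rule growth_leI[of q "n0 + p"])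
    fix n assume "n0 + p \<le> n"
    then show "a n \<le> q * b n" using *(2)[of "n - p"] by simp
  qed (use * in auto)
qed

lemma it_pos_of_growth:
  assumes "finite S" "nonneg_on S A" and x: "\<And>k. k \<in> S \<Longrightarrow> 0 < x k" and i: "i \<in> S"
    and g: "growth_le (pe r l) (\<lambda>n. it S A n x i)" and r: "0 < r"
  shows "0 < it S A n x i"
proof (rule ccontr)
  assume neg: "\<not> ?thesis"
  have "0 \<le> it S A n x i" by (rule it_nonneg[OF assms(2) _ i]) (use x in \<open>auto intro: less_imp_le\<close>)
  then have zero: "it S A n x i = 0" using neg by linarith
  have z: "it S A m x i = 0" if "n \<le> m" for m by (rule it_zero_persist[OF assms(1,2) x i zero that])
  obtain q n0 where q: "\<And>n. n \<ge> n0 \<Longrightarrow> pe r l n \<le> q * it S A n x i" using growth_leE[OF g] by blast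
  have "pe r l (max n n0) \<le> 0" using q[of "max n n0"] z[of "max n n0"] by simp
  then show False using pe_pos[OF r, of l "max n n0"] by simp
qed

text \<open>Discounted series will be compared term by term from \<open>n = 0\<close> on, so an
  eventual bound is not enough; positivity of all iterates extends it to every index.\<close>

lemma it_lower_of_growth:
  assumes "finite S" "nonneg_on S A" "\<And>k. k \<in> S \<Longrightarrow> 0 < x k" "i \<in> S"
    and "growth_le (pe r l) (\<lambda>n. it S A n x i)" "0 < r"
  shows "\<exists>c>0. \<forall>n. c * pe r l n \<le> it S A n x i"
proof -
  obtain q where q: "q > 0" "\<forall>n. pe r l n \<le> q * it S A n x i"
    using growth_le_all[OF assms(5) it_pos_of_growth[OF assms]] by blast
  show ?thesis by (rule exI[of _ "1 / q"]) (use q in \<open>simp add: pos_divide_le_eq mult.commute\<close>)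
qed

text \<open>Bolzano-Weierstrass, one coordinate at a time: each refinement passes to a monotone
  subsequence of a bounded sequence.\<close>

lemma finite_convergent_subsequence:
  fixes X :: "nat \<Rightarrow> 'a \<Rightarrow> real"
  assumes "finite S" "\<And>i. i \<in> S \<Longrightarrow> \<exists>C. \<forall>n. \<bar>X n i\<bar> \<le> C"
  shows "\<exists>r L. strict_mono r \<and> (\<forall>i\<in>S. (\<lambda>n. X (r n) i) \<longlonglongrightarrow> L i)"
  using assms
proof (induction S)
  case empty
  show ?case by (rule exI[of _ id]) (auto simp: strict_mono_def)
next
  case (insert i S)
  have "\<exists>r L. strict_mono r \<and> (\<forall>i\<in>S. (\<lambda>n. X (r n) i) \<longlonglongrightarrow> L i)"
    by (rule insert.IH) (use insert.prems in blast)
  then obtain r L where r: "strict_mono r" "\<forall>i\<in>S. (\<lambda>n. X (r n) i) \<longlonglongrightarrow> L i" by blast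
  obtain f where f: "strict_mono f" "monoseq (\<lambda>n. X (r (f n)) i)"
    using seq_monosub[of "\<lambda>n. X (r n) i"] by blast
  obtain C where C: "\<forall>n. \<bar>X n i\<bar> \<le> C" using insert.prems by blast
  have "Bseq (\<lambda>n. X (r (f n)) i)" by (rule BseqI'[of _ C]) (use C in auto)
  then obtain l where l: "(\<lambda>n. X (r (f n)) i) \<longlonglongrightarrow> l"
    using Bseq_monoseq_convergent[OF _ f(2)] unfolding convergent_def by blast
  show ?case
  proof (intro exI[of _ "r \<circ> f"] exI[of _ "L(i := l)"] conjI ballI)
    show "strict_mono (r \<circ> f)" using r(1) f(1) by (rule strict_mono_o)
    fix k assume k: "k \<in> insert i S"
    show "(\<lambda>n. X ((r \<circ> f) n) k) \<longlonglongrightarrow> (L(i := l)) k"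
    proof (cases "k = i")
      case True
      then show ?thesis using l by simp
    next
      case False
      then have "(\<lambda>n. X (r n) k) \<longlonglongrightarrow> L k" using r k by auto
      then show ?thesis using LIMSEQ_subseq_LIMSEQ[OF _ f(1)] False by (fastforce simp: o_def)
    qed
  qed
qed

subsection \<open>Perron vectors of irreducible matrices\<close>

definition edges :: "'a set \<Rightarrow> ('a \<Rightarrow> 'a \<Rightarrow> real) \<Rightarrow> ('a \<times> 'a) set" where
  "edges S A = {(i, j). i \<in> S \<and> j \<in> S \<and> 0 < A i j}"

lemma path_it_pos:
  assumes "finite S" "nonneg_on S A" "\<And>k. k \<in> S \<Longrightarrow> 0 \<le> z k" "0 < z j" "(i, j) \<in> (edges S A)\<^sup>*"
  shows "\<exists>n. 0 < it S A n z i"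
  using assms(5)
proof (induction rule: converse_rtrancl_induct)
  case base
  show ?case by (rule exI[of _ 0]) (use assms in simp)
next
  case (step i k)
  then obtain n where n: "0 < it S A n z k" by blast
  have ik: "i \<in> S" "k \<in> S" "0 < A i k" using step(1) by (auto simp: edges_def)
  have "0 < A i k * it S A n z k" using n ik by simp
  also have "\<dots> \<le> ap S A (it S A n z) i"
    by (rule member_le_ap[OF assms(1,2) _ ik(1,2)]) (rule it_nonneg[OF assms(2,3)])
  finally show ?case by (intro exI[of _ "Suc n"]) simp
qed

text \<open>Collatz-Wielandt: \<open>\<rho>\<close> is the infimum of all \<open>s\<close> with
  \<open>A x \<le> s x\<close> for some positive \<open>x\<close>. Compactness yields a minimizing
  vector and irreducibility makes it positive. If one inequality were strict, summing over powers of
  \<open>A\<close> would make all of them strict and lower the infimum. The value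
  \<open>\<rho> = 0\<close> occurs for a single state without a loop.\<close>

lemma perron_vector:
  assumes fin: "finite C" and ne: "C \<noteq> {}" and nn: "nonneg_on C A"
    and irr: "\<And>i j. i \<in> C \<Longrightarrow> j \<in> C \<Longrightarrow> (i, j) \<in> (edges C A)\<^sup>*"
  shows "\<exists>\<rho> w. 0 \<le> \<rho> \<and> (\<forall>i\<in>C. 0 < w i) \<and> (\<forall>i\<in>C. ap C A w i = \<rho> * w i)"
proof -
  define P where "P = {s. 0 \<le> s \<and> (\<exists>x. (\<forall>i\<in>C. 0 < x i) \<and> (\<forall>i\<in>C. ap C A x i \<le> s * x i))}"
  define \<rho> where "\<rho> = Inf P"
  obtain c where c: "c > 0" "\<forall>i\<in>C. ap C A (\<lambda>_. 1) i \<le> c" using finite_upper[OF fin, of "ap C A (\<lambda>_. 1)"] by blast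
  have "c \<in> P" unfolding P_def using c by (auto intro!: exI[of _ "\<lambda>_. 1"])
  then have Pne: "P \<noteq> {}" by blast
  have bdd: "bdd_below P" unfolding P_def by (rule bdd_belowI[of _ 0]) auto
  have \<rho>0: "0 \<le> \<rho>" unfolding \<rho>_def by (rule cInf_greatest[OF Pne]) (auto simp: P_def)
  \<comment> \<open>Almost optimal vectors, normalized to sum 1 so that no limit point is
    zero.\<close>
  have ex: "\<exists>s x. s < \<rho> + 1 / real (Suc n) \<and> (\<forall>i\<in>C. 0 < x i) \<and> sum x C = 1 \<and> (\<forall>i\<in>C. ap C A x i \<le> s * x i)" for n
  proof -
    have "\<exists>s\<in>P. s < \<rho> + 1 / real (Suc n)"
      using cInf_less_iff[OF Pne bdd, of "\<rho> + 1 / real (Suc n)"] unfolding \<rho>_def by simp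
    then obtain s x where s: "s < \<rho> + 1 / real (Suc n)" and x: "\<forall>i\<in>C. 0 < x i" "\<forall>i\<in>C. ap C A x i \<le> s * x i"
      unfolding P_def by blast
    have sp: "0 < sum x C" using x ne fin by (intro sum_pos) auto
    show ?thesis
    proof (intro exI[of _ s] exI[of _ "\<lambda>i. x i / sum x C"] conjI ballI)
      fix i assume i: "i \<in> C"
      have "ap C A (\<lambda>i. x i / sum x C) i = ap C A x i / sum x C"
        unfolding ap_def by (simp add: sum_divide_distrib)
      then show "ap C A (\<lambda>i. x i / sum x C) i \<le> s * (x i / sum x C)"
        using x i sp by (simp add: divide_right_mono)
      show "0 < x i / sum x C" using x i sp by simp
    next
      show "(\<Sum>i\<in>C. x i / sum x C) = 1" using sp by (simp add: sum_divide_distrib[symmetric])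
    qed (use s in auto)
  qed
  then obtain s X where sX: "\<And>n. s n < \<rho> + 1 / real (Suc n)" "\<And>n i. i \<in> C \<Longrightarrow> 0 < X n i" "\<And>n. sum (X n) C = 1"
      "\<And>n i. i \<in> C \<Longrightarrow> ap C A (X n) i \<le> s n * X n i" by metis
  have X1: "X n i \<le> 1" if "i \<in> C" for n i
    using member_le_sum[of i C "X n"] sX(2,3) that fin by (metis less_imp_le DiffD1)
  obtain r x where r: "strict_mono r" and lim: "\<And>i. i \<in> C \<Longrightarrow> (\<lambda>n. X (r n) i) \<longlonglongrightarrow> x i"
    using finite_convergent_subsequence[OF fin, of X] X1 sX(2) by (metis abs_of_pos)
  have x0: "0 \<le> x i" if "i \<in> C" for i
    by (rule LIMSEQ_le_const[OF lim[OF that]]) (use sX(2) that in \<open>auto intro: less_imp_le\<close>)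
  have "(\<lambda>n. sum (X (r n)) C) \<longlonglongrightarrow> sum x C" by (rule tendsto_sum[OF lim])
  then have sx: "sum x C = 1" using sX(3) LIMSEQ_unique[OF tendsto_const] by (metis (no_types, lifting) ext)
  have Ax: "ap C A x i \<le> \<rho> * x i" if i: "i \<in> C" for i
  proof (rule LIMSEQ_le)
    show "(\<lambda>n. ap C A (X (r n)) i) \<longlonglongrightarrow> ap C A x i" unfolding ap_def
      by (intro tendsto_sum tendsto_mult lim tendsto_const)
    have "(\<lambda>n. 1 / real (Suc n)) \<longlonglongrightarrow> 0" by (rule LIMSEQ_inverse_real_of_nat[unfolded inverse_eq_divide])
    from LIMSEQ_subseq_LIMSEQ[OF this r] have "(\<lambda>n. 1 / real (Suc (r n))) \<longlonglongrightarrow> 0" by (simp add: o_def)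
    then have "(\<lambda>n. (\<rho> + 1 / real (Suc (r n))) * X (r n) i) \<longlonglongrightarrow> (\<rho> + 0) * x i"
      by (intro tendsto_intros lim i)
    then show "(\<lambda>n. (\<rho> + 1 / real (Suc (r n))) * X (r n) i) \<longlonglongrightarrow> \<rho> * x i" by simp
    show "\<exists>N. \<forall>n\<ge>N. ap C A (X (r n)) i \<le> (\<rho> + 1 / real (Suc (r n))) * X (r n) i"
    proof (intro exI allI impI)
      fix n
      have "ap C A (X (r n)) i \<le> s (r n) * X (r n) i" by (rule sX(4)[OF i])
      also have "\<dots> \<le> (\<rho> + 1 / real (Suc (r n))) * X (r n) i"
        by (rule mult_right_mono) (use sX(1,2) i in \<open>auto intro: less_imp_le\<close>)
      finally show "ap C A (X (r n)) i \<le> (\<rho> + 1 / real (Suc (r n))) * X (r n) i" .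
    qed
  qed
  obtain j where j: "j \<in> C" "0 < x j"
  proof (rule ccontr)
    assume "\<not> thesis"
    then have "\<forall>j\<in>C. x j = 0" using that x0 by force
    then show False using sx by simp
  qed
  \<comment> \<open>The limit might vanish somewhere. Positivity at \<open>j\<close> travels
    backwards along paths, since \<open>A x \<le> \<rho> x\<close> forces \<open>x i\<close> to be
    positive as soon as \<open>A i k * x k\<close> is.\<close>
  have xpos: "0 < x i" if i: "i \<in> C" for i
    using irr[OF i j(1)]
  proof (induction rule: converse_rtrancl_induct)
    case base
    show ?case by (rule j)
  next
    case (step i k)
    have ik: "i \<in> C" "k \<in> C" "0 < A i k" using step(1) by (auto simp: edges_def)
    have "0 < A i k * x k" using ik step by simp
    also have "\<dots> \<le> ap C A x i" by (rule member_le_ap[OF fin nn x0 ik(1,2)])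
    also have "\<dots> \<le> \<rho> * x i" by (rule Ax[OF ik(1)])
    finally show ?case using x0[OF ik(1)] by (metis mult_zero_right less_le)
  qed
  have "ap C A x i = \<rho> * x i" if i: "i \<in> C" for i
  proof (rule ccontr)
    assume neq: "ap C A x i \<noteq> \<rho> * x i"
    define z where "z = (\<lambda>j. \<rho> * x j - ap C A x j)"
    have z0: "\<And>j. j \<in> C \<Longrightarrow> 0 \<le> z j" using Ax by (simp add: z_def)
    have zi: "0 < z i" using neq Ax[OF i] by (simp add: z_def)
    have "\<exists>n. 0 < it C A n z k" if "k \<in> C" for k
      by (rule path_it_pos[where j = i]) (use fin nn z0 zi irr[OF that i] in auto)
    then obtain p where p: "\<And>k. k \<in> C \<Longrightarrow> 0 < it C A (p k) z k" by metis
    define N where "N = Max (p ` C)"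
    \<comment> \<open>Every state feels the gap \<open>z i\<close> after at most \<open>N\<close>
      steps, so summing the powers up to \<open>N\<close> spreads it to all components without any
      aperiodicity.\<close>
    define y where "y = (\<lambda>k. \<Sum>n\<le>N. it C A n x k)"
    have pN: "p k \<le> N" if "k \<in> C" for k unfolding N_def using fin that by auto
    have itx: "0 \<le> it C A n x k" if "k \<in> C" for n k by (rule it_nonneg[OF nn x0 that])
    have ypos: "0 < y k" if "k \<in> C" for k
    proof -
      have "it C A 0 x k \<le> y k" unfolding y_def by (rule member_le_sum) (use itx that in auto)
      then show ?thesis using xpos[OF that] by simp
    qed
    have Ay: "ap C A y k = (\<Sum>n\<le>N. it C A (Suc n) x k)" for k
    proof -
      have "ap C A y k = (\<Sum>j\<in>C. A k j * y j)" by (simp add: ap_def)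
      also have "\<dots> = (\<Sum>j\<in>C. \<Sum>n\<le>N. A k j * it C A n x j)"
        by (simp only: y_def sum_distrib_left)
      also have "\<dots> = (\<Sum>n\<le>N. \<Sum>j\<in>C. A k j * it C A n x j)" by (rule sum.swap)
      finally show ?thesis unfolding it_Suc .
    qed
    have itz: "it C A n z k = \<rho> * it C A n x k - it C A (Suc n) x k" for n k
    proof -
      have "it C A n (\<lambda>j. \<rho> * x j + (-1) * ap C A x j) k = \<rho> * it C A n x k + (-1) * it C A n (ap C A x) k"
        by (simp only: it_plus it_cmult)
      then show ?thesis unfolding z_def it_Suc_inner by simp
    qed
    have gap: "0 < \<rho> * y k - ap C A y k" if "k \<in> C" for k
    proof -
      have "\<rho> * y k - ap C A y k = (\<Sum>n\<le>N. it C A n z k)"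
        unfolding Ay itz unfolding y_def by (simp add: sum_distrib_left sum_subtractf)
      moreover have "it C A (p k) z k \<le> (\<Sum>n\<le>N. it C A n z k)"
        by (rule member_le_sum) (use pN it_nonneg[OF nn z0] that in auto)
      ultimately show ?thesis using p[OF that] by simp
    qed
    obtain e where e: "e > 0" "\<forall>k\<in>C. e \<le> (\<rho> * y k - ap C A y k) / y k"
      using finite_lower[OF fin, of "\<lambda>k. (\<rho> * y k - ap C A y k) / y k"] gap ypos by auto
    have le: "ap C A y k \<le> (\<rho> - e) * y k" if "k \<in> C" for k
    proof -
      have "e * y k \<le> \<rho> * y k - ap C A y k" using e(2) that ypos[OF that] by (metis pos_le_divide_eq)
      then show ?thesis by (simp add: left_diff_distrib)
    qed
    have "0 \<le> ap C A y i" using it_nonneg[OF nn, of y i 1] ypos i by (auto intro: less_imp_le)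
    then have "0 \<le> (\<rho> - e) * y i" using le[OF i] by linarith
    then have "0 \<le> \<rho> - e" using ypos[OF i] by (simp add: zero_le_mult_iff)
    then have "\<rho> - e \<in> P" unfolding P_def using le ypos by blast
    then have "\<rho> \<le> \<rho> - e" unfolding \<rho>_def by (rule cInf_lower[OF _ bdd])
    then show False using e by simp
  qed
  then show ?thesis using \<rho>0 xpos by blast
qed

subsection \<open>Growth types of a nonnegative matrix\<close>

text \<open>The growth type of a class with Perron root \<open>\<rho>\<close> if \<open>(\<sigma>, l)\<close> is the largest type among the other states
  that it has access to.\<close>

definition new_type :: "real \<Rightarrow> real \<Rightarrow> nat \<Rightarrow> real \<times> nat" where
  "new_type \<rho> \<sigma> l = (if \<sigma> < \<rho> then (\<rho>, 0) else if \<sigma> = \<rho> then (\<rho>, Suc l) else (\<sigma>, l))"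

abbreviation pt :: "real \<times> nat \<Rightarrow> nat \<Rightarrow> real" where
  "pt t \<equiv> pe (fst t) (snd t)"

text \<open>Variation of constants for \<open>c (n + 1) = \<rho> c n + q pe \<sigma> l n\<close>:
  the larger of the two rates wins, and the resonance \<open>\<sigma> = \<rho>\<close> costs one
  extra power of \<open>n\<close>. Only an upper solution is built; \<open>n0\<close> and
  \<open>K\<close> place it above given initial data.\<close>

lemma scalar_supersolution:
  assumes "0 \<le> \<rho>" "0 \<le> \<sigma>" "0 < q"
  shows "\<exists>c. (\<forall>n\<ge>n0. \<rho> * c n + q * pe \<sigma> l n \<le> c (Suc n)) \<and> K \<le> c n0 \<and> growth_le c (pt (new_type \<rho> \<sigma> l))"
proof -
  consider "\<rho> < \<sigma>" | "\<sigma> = \<rho>" "0 < \<rho>" | "\<sigma> = 0" "\<rho> = 0" | "\<sigma> < \<rho>" using assms by linarith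
  then show ?thesis
  proof cases
    case 1
    define K' where "K' = max (q / (\<sigma> - \<rho>)) (K / pe \<sigma> l n0)"
    have s: "0 < \<sigma>" using 1 assms by simp
    have K': "0 < K'" "q \<le> K' * (\<sigma> - \<rho>)" "K \<le> K' * pe \<sigma> l n0"
    proof -
      have "q / (\<sigma> - \<rho>) \<le> K'" "K / pe \<sigma> l n0 \<le> K'" by (auto simp: K'_def)
      then show "q \<le> K' * (\<sigma> - \<rho>)" "K \<le> K' * pe \<sigma> l n0"
        using 1 s pe_pos[OF s, of l n0] by (simp_all add: pos_divide_le_eq)
      show "0 < K'" using 1 s assms by (simp add: K'_def less_max_iff_disj)
    qed
    show ?thesis
    proof (intro exI[of _ "\<lambda>n. K' * pe \<sigma> l n"] conjI allI impI K')
      fix n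
      have "\<rho> * (K' * pe \<sigma> l n) + q * pe \<sigma> l n \<le> \<rho> * (K' * pe \<sigma> l n) + K' * (\<sigma> - \<rho>) * pe \<sigma> l n"
        using K' pe_pos[OF s, of l n] by (intro add_left_mono mult_right_mono) auto
      also have "\<dots> = K' * (real (Suc n) ^ l * \<sigma> ^ Suc n)" by (simp add: pe_def algebra_simps)
      also have "\<dots> \<le> K' * pe \<sigma> l (Suc n)" unfolding pe_def
        using K' s by (intro mult_left_mono mult_right_mono power_mono) auto
      finally show "\<rho> * (K' * pe \<sigma> l n) + q * pe \<sigma> l n \<le> K' * pe \<sigma> l (Suc n)" .
      show "growth_le (\<lambda>n. K' * pe \<sigma> l n) (pt (new_type \<rho> \<sigma> l))"
        using 1 growth_le_cmult[OF K'(1)] by (simp add: new_type_def)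
    qed
  next
    case 2
    define K' where "K' = max (q / \<sigma>) (K / pe \<sigma> (Suc l) n0)"
    have s: "0 < \<sigma>" using 2 by simp
    have K': "0 < K'" "q \<le> K' * \<sigma>" "K \<le> K' * pe \<sigma> (Suc l) n0"
    proof -
      have "q / \<sigma> \<le> K'" "K / pe \<sigma> (Suc l) n0 \<le> K'" by (auto simp: K'_def)
      then show "q \<le> K' * \<sigma>" "K \<le> K' * pe \<sigma> (Suc l) n0"
        using 2 s pe_pos[OF s, of "Suc l" n0] by (simp_all add: pos_divide_le_eq)
      show "0 < K'" using 2 s assms by (simp add: K'_def less_max_iff_disj)
    qed
    show ?thesis
    proof (intro exI[of _ "\<lambda>n. K' * pe \<sigma> (Suc l) n"] conjI allI impI K')
      fix n
      have "\<rho> * (K' * pe \<sigma> (Suc l) n) + q * pe \<sigma> l n \<le> \<sigma> * (K' * pe \<sigma> (Suc l) n) + K' * \<sigma> * pe \<sigma> l n"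
        using K' pe_pos[OF s, of l n] pe_pos[OF s, of "Suc l" n] 2 by (intro add_mono mult_right_mono) auto
      also have "\<dots> = K' * (real (Suc (Suc n)) * real (Suc n) ^ l * \<sigma> ^ Suc n)"
        by (simp add: pe_def algebra_simps)
      also have "\<dots> \<le> K' * (real (Suc (Suc n)) * real (Suc (Suc n)) ^ l * \<sigma> ^ Suc n)"
        using K' s by (intro mult_left_mono mult_right_mono power_mono) auto
      also have "\<dots> = K' * pe \<sigma> (Suc l) (Suc n)" by (simp add: pe_def)
      finally show "\<rho> * (K' * pe \<sigma> (Suc l) n) + q * pe \<sigma> l n \<le> K' * pe \<sigma> (Suc l) (Suc n)" .
      show "growth_le (\<lambda>n. K' * pe \<sigma> (Suc l) n) (pt (new_type \<rho> \<sigma> l))"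
        using 2 growth_le_cmult[OF K'(1)] by (simp add: new_type_def)
    qed
  next
    case 3
    \<comment> \<open>For rate 0 the forcing is nonzero only at \<open>n = 0\<close>, so a sequence
      that stops after \<open>Suc n0\<close> suffices.\<close>
    define K' where "K' = max q K"
    show ?thesis
    proof (intro exI[of _ "\<lambda>n. if n \<le> Suc n0 then K' else 0"] conjI allI impI)
      fix n assume n: "n0 \<le> n"
      show "\<rho> * (if n \<le> Suc n0 then K' else 0) + q * pe \<sigma> l n \<le> (if Suc n \<le> Suc n0 then K' else 0)"
        using 3 n assms(3) by (cases n) (auto simp: pe_def K'_def)
    next
      show "growth_le (\<lambda>n. if n \<le> Suc n0 then K' else 0) (pt (new_type \<rho> \<sigma> l))"
        by (rule growth_leI[of 1 "Suc (Suc n0)"]) (use 3 in \<open>auto simp: new_type_def pe_nonneg\<close>)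
    qed (auto simp: K'_def)
  next
    case 4
    define s where "s = (\<sigma> + \<rho>) / 2"
    have s: "\<sigma> < s" "s < \<rho>" "0 < s" using 4 assms by (auto simp: s_def)
    obtain p where p: "p > 0" "\<forall>n. pe \<sigma> l n \<le> p * pe s 0 n"
      using growth_le_all[OF pe_dom[of \<sigma> s l 0]] assms s pe_pos by blast
    \<comment> \<open>Subtracting \<open>D s^n\<close> with \<open>\<sigma> < s < \<rho>\<close>
      creates the surplus \<open>D (\<rho> - s) s^n\<close>, which dominates the forcing.\<close>
    define D where "D = q * p / (\<rho> - s)"
    define K' where "K' = max 1 ((K + D * s ^ n0) / \<rho> ^ n0)"
    have D: "D * (\<rho> - s) = q * p" "0 \<le> D" using s p assms by (auto simp: D_def)
    have r: "0 < \<rho>" using s by simp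
    show ?thesis
    proof (intro exI[of _ "\<lambda>n. K' * \<rho> ^ n - D * s ^ n"] conjI allI impI)
      fix n
      have "q * pe \<sigma> l n \<le> q * (p * s ^ n)" using p assms by (intro mult_left_mono) (auto simp: pe_def)
      also have "\<dots> = D * (\<rho> - s) * s ^ n" by (simp add: D)
      finally show "\<rho> * (K' * \<rho> ^ n - D * s ^ n) + q * pe \<sigma> l n \<le> K' * \<rho> ^ Suc n - D * s ^ Suc n"
        by (simp add: algebra_simps)
    next
      have "(K + D * s ^ n0) / \<rho> ^ n0 * \<rho> ^ n0 \<le> K' * \<rho> ^ n0"
        unfolding K'_def using r by (intro mult_right_mono) auto
      then show "K \<le> K' * \<rho> ^ n0 - D * s ^ n0" using r by simp
      show "growth_le (\<lambda>n. K' * \<rho> ^ n - D * s ^ n) (pt (new_type \<rho> \<sigma> l))"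
        by (rule growth_leI[of K' 0]) (use 4 D s in \<open>auto simp: new_type_def pe_def K'_def\<close>)
    qed
  qed
qed

text \<open>Comparison with \<open>c n * w i\<close> for the Perron vector \<open>w\<close>
  collapses the recursion on the block \<open>C\<close> to the scalar one of
  \<open>scalar_supersolution\<close>; the states of \<open>Q\<close> provide the forcing.\<close>

lemma step_upper:
  assumes fin: "finite S" and nn: "nonneg_on S A" and C: "C \<subseteq> S" and Q: "Q \<subseteq> S" "C \<inter> Q = {}"
    and closed: "\<And>i j. i \<in> C \<Longrightarrow> j \<in> S - (C \<union> Q) \<Longrightarrow> A i j = 0"
    and w: "\<And>i. i \<in> C \<Longrightarrow> 0 < w i" and \<rho>: "0 \<le> \<rho>" and Aw: "\<And>i. i \<in> C \<Longrightarrow> ap C A w i = \<rho> * w i"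
    and \<sigma>: "0 \<le> \<sigma>" and U: "\<And>j. j \<in> Q \<Longrightarrow> growth_le (\<lambda>n. it S A n x j) (pe \<sigma> l)"
    and i: "i \<in> C"
  shows "growth_le (\<lambda>n. it S A n x i) (pt (new_type \<rho> \<sigma> l))"
proof -
  have finC: "finite C" and finQ: "finite Q" using C Q fin by (auto intro: finite_subset)
  let ?b = "\<lambda>n i. \<Sum>j\<in>Q. A i j * it S A n x j"
  have "growth_le (\<lambda>n. ?b n i) (pe \<sigma> l)" if i: "i \<in> C" for i
  proof (rule growth_le_sum[OF finQ])
    fix j assume j: "j \<in> Q"
    obtain q n0 where q: "0 < q" "\<And>n. n0 \<le> n \<Longrightarrow> it S A n x j \<le> q * pe \<sigma> l n"
      using growth_leE[OF U[OF j]] by blast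
    have Aij: "0 \<le> A i j" by (rule nonneg_onD[OF nn]) (use i j C Q in auto)
    show "growth_le (\<lambda>n. A i j * it S A n x j) (pe \<sigma> l)"
    proof (rule growth_leI[of "(A i j + 1) * q" n0])
      fix n assume n: "n0 \<le> n"
      have "A i j * it S A n x j \<le> A i j * (q * pe \<sigma> l n)" using q(2)[OF n] Aij by (rule mult_left_mono)
      also have "\<dots> \<le> (A i j + 1) * (q * pe \<sigma> l n)"
        using q(1) pe_nonneg[OF \<sigma>, of l n] by (intro mult_right_mono) auto
      finally show "A i j * it S A n x j \<le> (A i j + 1) * q * pe \<sigma> l n" by simp
    qed (use q Aij in auto)
  qed (rule pe_nonneg[OF \<sigma>])
  then have "\<forall>i. \<exists>q n0. i \<in> C \<longrightarrow> 0 < q \<and> (\<forall>n\<ge>n0. ?b n i \<le> q * pe \<sigma> l n)"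
    unfolding growth_le_def eventually_sequentially by blast
  then obtain q n0 where "\<forall>i. i \<in> C \<longrightarrow> 0 < q i \<and> (\<forall>n\<ge>n0 i. ?b n i \<le> q i * pe \<sigma> l n)"
    by (auto simp only: choice_iff)
  then have q: "\<And>i. i \<in> C \<Longrightarrow> 0 < q i" "\<And>i n. i \<in> C \<Longrightarrow> n0 i \<le> n \<Longrightarrow> ?b n i \<le> q i * pe \<sigma> l n"
    by blast+
  obtain N :: nat where N: "\<And>i. i \<in> C \<Longrightarrow> n0 i \<le> N"
    using finC by (meson finite_imageI finite_nat_set_iff_bounded_le imageI)
  obtain q' where q': "0 < q'" "\<forall>i\<in>C. q i / w i \<le> q'" using finite_upper[OF finC, of "\<lambda>i. q i / w i"] by blast
  obtain K where K: "0 < K" "\<forall>i\<in>C. it S A N x i / w i \<le> K" using finite_upper[OF finC, of "\<lambda>i. it S A N x i / w i"] by blast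
  obtain c where c: "\<And>n. n \<ge> N \<Longrightarrow> \<rho> * c n + q' * pe \<sigma> l n \<le> c (Suc n)" "K \<le> c N"
      "growth_le c (pt (new_type \<rho> \<sigma> l))"
    using scalar_supersolution[OF \<rho> \<sigma> q'(1), of N l K] by blast
  have bound: "it S A (N + m) x i \<le> c (N + m) * w i" if "i \<in> C" for m i
    using that
  proof (induction m arbitrary: i)
    case 0
    have "it S A N x i \<le> K * w i" using K(2) w[OF 0] 0 by (auto simp: pos_divide_le_eq)
    also have "\<dots> \<le> c N * w i" using c(2) w[OF 0] by (intro mult_right_mono) auto
    finally show ?case by simp
  next
    case (Suc m)
    let ?n = "N + m"
    have "it S A (Suc ?n) x i = (\<Sum>j\<in>C \<union> Q. A i j * it S A ?n x j)" unfolding it_Suc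
      by (rule sum.mono_neutral_right) (use fin C Q closed Suc.prems in auto)
    also have "\<dots> = (\<Sum>j\<in>C. A i j * it S A ?n x j) + ?b ?n i"
      by (rule sum.union_disjoint) (use finC finQ Q in auto)
    also have "\<dots> \<le> (\<Sum>j\<in>C. A i j * (c ?n * w j)) + q i * pe \<sigma> l ?n"
    proof (rule add_mono)
      show "(\<Sum>j\<in>C. A i j * it S A ?n x j) \<le> (\<Sum>j\<in>C. A i j * (c ?n * w j))"
        by (intro sum_mono mult_left_mono Suc.IH nonneg_onD[OF nn]) (use C Suc.prems in auto)
      show "?b ?n i \<le> q i * pe \<sigma> l ?n" by (rule q(2)) (use Suc.prems N[OF Suc.prems] in auto)
    qed
    also have "(\<Sum>j\<in>C. A i j * (c ?n * w j)) = c ?n * ap C A w i"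
      unfolding ap_def sum_distrib_left by (rule sum.cong) auto
    also have "\<dots> = \<rho> * c ?n * w i" using Aw[OF Suc.prems] by simp
    also have "\<rho> * c ?n * w i + q i * pe \<sigma> l ?n \<le> \<rho> * c ?n * w i + q' * w i * pe \<sigma> l ?n"
    proof -
      have "q i \<le> q' * w i" using q'(2) Suc.prems w[OF Suc.prems] by (auto simp: pos_divide_le_eq)
      then show ?thesis using pe_nonneg[OF \<sigma>] by (intro add_left_mono mult_right_mono) auto
    qed
    also have "\<dots> = (\<rho> * c ?n + q' * pe \<sigma> l ?n) * w i" by (simp add: algebra_simps)
    also have "\<dots> \<le> c (Suc ?n) * w i" using c(1)[of ?n] w[OF Suc.prems] by (intro mult_right_mono) auto
    finally show ?case by simp
  qed
  have "growth_le (\<lambda>n. it S A n x i) (\<lambda>n. w i * c n)"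
  proof (rule growth_leI[of 1 N])
    fix n assume "N \<le> n"
    then show "it S A n x i \<le> 1 * (w i * c n)" using bound[OF i, of "n - N"] by (simp add: mult.commute)
  qed simp
  also have "growth_le (\<lambda>n. w i * c n) c" by (rule growth_le_cmult[OF w[OF i]])
  finally (growth_le_trans) show ?thesis using c(3) growth_le_trans by blast
qed

text \<open>A single accessible state \<open>j\<close> of type \<open>(\<sigma>, l)\<close> is
  enough. If \<open>\<rho>\<close> is larger, the class alone gives \<open>\<rho>^n\<close>; if
  \<open>\<sigma>\<close> is larger, \<open>j\<close> is felt along a path with a bounded delay. In
  the resonant case every time window adds a contribution of order \<open>n^l\<close>, and
  accumulation gives \<open>n^(l + 1)\<close>. The alternative \<open>\<sigma> = 0\<close> stands
  for having nothing to inherit.\<close>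

lemma step_lower:
  assumes fin: "finite S" and nn: "nonneg_on S A" and C: "C \<subseteq> S"
    and w: "\<And>i. i \<in> C \<Longrightarrow> 0 < w i" and \<rho>: "0 \<le> \<rho>" and Aw: "\<And>i. i \<in> C \<Longrightarrow> ap C A w i = \<rho> * w i"
    and \<sigma>: "0 \<le> \<sigma>"
    and x: "\<And>i. i \<in> S \<Longrightarrow> 0 < x i"
    and j: "\<sigma> = 0 \<or> j \<in> S - C \<and> growth_le (pe \<sigma> l) (\<lambda>n. it S A n x j) \<and> (\<forall>i\<in>C. (i, j) \<in> (edges S A)\<^sup>*)"
    and i: "i \<in> C"
  shows "growth_le (pt (new_type \<rho> \<sigma> l)) (\<lambda>n. it S A n x i)"
proof -
  have finC: "finite C" using C fin finite_subset by auto
  have pos: "0 \<le> it S A n x k" if "k \<in> S" for k n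
    by (rule it_nonneg[OF nn _ that]) (use x in \<open>auto intro: less_imp_le\<close>)
  have lowC: "\<rho> ^ n * t * w k \<le> it S A n y k"
    if "\<And>k. k \<in> C \<Longrightarrow> t * w k \<le> y k" "\<And>k. k \<in> S \<Longrightarrow> 0 \<le> y k" "k \<in> C" for t n y k
    using that(3)
  proof (induction n arbitrary: k)
    case 0
    then show ?case using that by simp
  next
    case (Suc n)
    have "\<rho> ^ Suc n * t * w k = \<rho> ^ n * t * ap C A w k" using Aw[OF Suc.prems] by simp
    also have "\<dots> = (\<Sum>j\<in>C. A k j * (\<rho> ^ n * t * w j))"
      unfolding ap_def sum_distrib_left by (rule sum.cong) auto
    also have "\<dots> \<le> (\<Sum>j\<in>C. A k j * it S A n y j)"
      by (intro sum_mono mult_left_mono Suc.IH nonneg_onD[OF nn]) (use C Suc.prems in auto)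
    also have "\<dots> \<le> (\<Sum>j\<in>S. A k j * it S A n y j)"
      by (rule sum_mono2[OF fin C])
        (use C Suc.prems it_nonneg[OF nn that(2)] nonneg_onD[OF nn] in \<open>auto intro: mult_nonneg_nonneg\<close>)
    finally show ?case unfolding it_Suc .
  qed
  obtain t0 where t0: "t0 > 0" "\<forall>k\<in>C. t0 \<le> x k / w k"
    using finite_lower[OF finC, of "\<lambda>k. x k / w k"] x w C by (metis divide_pos_pos subsetD)
  have init: "t0 * w k \<le> x k" if "k \<in> C" for k using t0(2) that w[OF that] by (auto simp: pos_le_divide_eq)
  have \<sigma>j: "j \<in> S - C" "growth_le (pe \<sigma> l) (\<lambda>n. it S A n x j)" "\<And>i. i \<in> C \<Longrightarrow> (i, j) \<in> (edges S A)\<^sup>*"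
    if "0 < \<sigma>" using j that by auto
  let ?e = "\<lambda>k. if k = j then 1 else 0 :: real"
  consider "\<sigma> < \<rho>" | "\<rho> = 0" "\<sigma> = 0" | "\<sigma> = \<rho>" "0 < \<rho>" | "\<rho> < \<sigma>" using \<rho> \<sigma> by linarith
  then show ?thesis
  proof cases
    case 1
    show ?thesis
    proof (rule growth_leI[of "1 / (t0 * w i)" 0])
      fix n
      have "\<rho> ^ n * t0 * w i \<le> it S A n x i" using lowC[OF init _ i] x by (auto intro: less_imp_le)
      then show "pt (new_type \<rho> \<sigma> l) n \<le> 1 / (t0 * w i) * it S A n x i"
        using 1 t0 w[OF i] by (simp add: new_type_def pe_def field_simps)
    qed (use t0 w[OF i] in auto)
  next
    case 2
    show ?thesis
    proof (rule growth_leI[of 1 1])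
      fix n :: nat assume "1 \<le> n"
      then show "pt (new_type \<rho> \<sigma> l) n \<le> 1 * it S A n x i"
        using 2 pos[of i n] C i by (auto simp: new_type_def pe_def power_0_left)
    qed simp
  next
    case 4
    have s: "0 < \<sigma>" using 4 \<rho> by simp
    have "\<exists>p. 0 < it S A p ?e i" by (rule path_it_pos[OF fin nn _ _ \<sigma>j(3)[OF s i]]) auto
    then obtain p where p: "0 < it S A p ?e i" by blast
    have "growth_le (\<lambda>n. pe \<sigma> l (n + p)) (pe \<sigma> l)" using pe_shift[OF \<sigma>] unfolding growth_eq_def by blast
    also have "growth_le (pe \<sigma> l) (\<lambda>n. it S A n x j)" by (rule \<sigma>j[OF s])
    also have "growth_le (\<lambda>n. it S A n x j) (\<lambda>n. it S A (n + p) x i)"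
    proof (rule growth_leI[of "1 / it S A p ?e i" 0])
      fix n
      have "it S A p (\<lambda>k. it S A n x j * ?e k) i \<le> it S A p (it S A n x) i"
        by (rule it_mono[OF nn]) (use pos C i in auto)
      then have "it S A n x j * it S A p ?e i \<le> it S A (n + p) x i"
        unfolding it_cmult add.commute[of n p] it_add .
      then show "it S A n x j \<le> 1 / it S A p ?e i * it S A (n + p) x i"
        using p by (simp add: pos_le_divide_eq)
    qed (use p in auto)
    finally (growth_le_trans) have "growth_le (pe \<sigma> l) (\<lambda>n. it S A n x i)" by (rule growth_le_unshift)
    then show ?thesis using 4 by (simp add: new_type_def)
  next
    case 3
    have s: "0 < \<sigma>" using 3 by simp
    have jS: "j \<in> S" "j \<notin> C" using \<sigma>j(1)[OF s] by auto
    have "0 < it S A n x j" for n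
      by (rule it_pos_of_growth[OF fin nn x jS(1) \<sigma>j(2)[OF s] s])
    then obtain q where q: "q > 0" "\<And>n. pe \<sigma> l n \<le> q * it S A n x j"
      using growth_le_all[OF \<sigma>j(2)[OF s]] by blast
    have "\<exists>p. 0 < it S A p ?e k" if "k \<in> C" for k
      by (rule path_it_pos[OF fin nn _ _ \<sigma>j(3)[OF s that]]) auto
    then obtain p where p: "\<And>k. k \<in> C \<Longrightarrow> 0 < it S A (p k) ?e k" by metis
    obtain N0 :: nat where N0: "\<And>k. k \<in> C \<Longrightarrow> p k \<le> N0"
      using finC by (meson finite_imageI finite_nat_set_iff_bounded_le imageI)
    define N where "N = Suc N0"
    have N: "\<And>k. k \<in> C \<Longrightarrow> p k \<le> N" "0 < N" using N0 by (auto simp: N_def le_SucI)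
    obtain \<delta> where \<delta>: "\<delta> > 0" "\<forall>k\<in>C. \<delta> \<le> it S A (p k) ?e k / (q * \<sigma> ^ p k * w k)"
      using finite_lower[OF finC, of "\<lambda>k. it S A (p k) ?e k / (q * \<sigma> ^ p k * w k)"] p q s w by auto
    \<comment> \<open>\<open>G n t\<close> says that on \<open>C\<close> the iterate at time
      \<open>n\<close> is at least \<open>t \<sigma>^n w\<close>; the aim is to let \<open>t\<close>
      grow like \<open>n^(l + 1)\<close>.\<close>
    define G where "G n t \<longleftrightarrow> (\<forall>k\<in>C. t * \<sigma> ^ n * w k \<le> it S A n x k)" for n t
    have G0: "G 0 0" unfolding G_def using x C by (auto intro: less_imp_le)
    have GS: "G (n + m) t" if "G n t" for n m t
      unfolding G_def
    proof
      fix k assume k: "k \<in> C"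
      have "\<rho> ^ m * (t * \<sigma> ^ n) * w k \<le> it S A m (it S A n x) k"
        by (rule lowC[OF _ _ k]) (use that pos in \<open>auto simp: G_def\<close>)
      then show "t * \<sigma> ^ (n + m) * w k \<le> it S A (n + m) x k"
        using 3 by (subst (2) add.commute) (simp add: it_add power_add mult_ac)
    qed
    have GN: "G (n + N) (t + \<delta> * real (Suc n) ^ l)" if g: "G n t" for n t
      unfolding G_def
    proof
      fix k assume k: "k \<in> C"
      \<comment> \<open>Waiting \<open>N - p k\<close> steps inside \<open>C\<close> pads the
        different path lengths \<open>p k\<close> to the common window length
        \<open>N\<close>.\<close>
      define m where "m = n + (N - p k)"
      have mN: "n + N = p k + m" using N(1)[OF k] by (simp add: m_def)
      let ?d = "real (Suc n) ^ l * \<sigma> ^ m / q"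
      have gm: "t * \<sigma> ^ m * w k' \<le> it S A m x k'" if "k' \<in> C" for k'
        using GS[OF g, of "N - p k"] that unfolding m_def G_def by blast
      have dj: "?d \<le> it S A m x j"
      proof -
        have "real (Suc n) ^ l * \<sigma> ^ m \<le> pe \<sigma> l m" unfolding pe_def
          using s by (intro mult_right_mono power_mono) (auto simp: m_def)
        also have "\<dots> \<le> q * it S A m x j" by (rule q)
        finally show ?thesis using q(1) by (simp add: pos_divide_le_eq mult.commute)
      qed
      \<comment> \<open>Cutting the iterate down to \<open>C\<close> keeps it disjoint from
        \<open>j\<close>, so the flow through \<open>C\<close> and the contribution of
        \<open>j\<close> can be added.\<close>
      define y where "y = (\<lambda>k'. if k' \<in> C then it S A m x k' else 0)"
      have "it S A (p k) (\<lambda>k'. y k' + ?d * ?e k') k \<le> it S A (p k) (it S A m x) k"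
        by (rule it_mono[OF nn]) (use pos C k jS dj in \<open>auto simp: y_def\<close>)
      then have le: "it S A (p k) y k + ?d * it S A (p k) ?e k \<le> it S A (p k + m) x k"
        unfolding it_plus it_cmult it_add .
      have "\<rho> ^ p k * (t * \<sigma> ^ m) * w k \<le> it S A (p k) y k"
        by (rule lowC[OF _ _ k]) (use gm C pos in \<open>auto simp: y_def\<close>)
      moreover have "\<delta> * real (Suc n) ^ l * \<sigma> ^ (p k + m) * w k \<le> ?d * it S A (p k) ?e k"
      proof -
        have "\<delta> * (q * \<sigma> ^ p k * w k) \<le> it S A (p k) ?e k"
          using \<delta>(2) k q s w[OF k] by (auto simp: pos_le_divide_eq)
        then have "?d * (\<delta> * (q * \<sigma> ^ p k * w k)) \<le> ?d * it S A (p k) ?e k"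
          using s q by (intro mult_left_mono) auto
        then show ?thesis using q by (simp add: power_add mult_ac)
      qed
      ultimately have "t * \<sigma> ^ (p k + m) * w k + \<delta> * real (Suc n) ^ l * \<sigma> ^ (p k + m) * w k \<le> it S A (p k + m) x k"
        using le 3 by (simp add: power_add mult_ac)
      then show "(t + \<delta> * real (Suc n) ^ l) * \<sigma> ^ (n + N) * w k \<le> it S A (n + N) x k"
        unfolding mN by (simp add: distrib_right)
    qed
    have GkN: "G (n + k * N) (real k * (\<delta> * real (Suc n) ^ l))" for n k
    proof (induction k)
      case 0
      show ?case using GS[OF G0, of n] by simp
    next
      case (Suc k)
      have g: "G (n + k * N + N) (real k * (\<delta> * real (Suc n) ^ l) + \<delta> * real (Suc (n + k * N)) ^ l)"
        by (rule GN[OF Suc])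
      have le: "real (Suc k) * (\<delta> * real (Suc n) ^ l) \<le> real k * (\<delta> * real (Suc n) ^ l) + \<delta> * real (Suc (n + k * N)) ^ l"
      proof -
        have "\<delta> * real (Suc n) ^ l \<le> \<delta> * real (Suc (n + k * N)) ^ l"
          using \<delta> by (intro mult_left_mono power_mono) auto
        then show ?thesis by (simp add: distrib_right)
      qed
      show ?case unfolding G_def
      proof
        fix k' assume k': "k' \<in> C"
        have "real (Suc k) * (\<delta> * real (Suc n) ^ l) * \<sigma> ^ (n + k * N + N) * w k'
          \<le> (real k * (\<delta> * real (Suc n) ^ l) + \<delta> * real (Suc (n + k * N)) ^ l) * \<sigma> ^ (n + k * N + N) * w k'"
          using le s w[OF k'] by (intro mult_right_mono) auto
        also have "\<dots> \<le> it S A (n + k * N + N) x k'" using g k' unfolding G_def by blast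
        finally show "real (Suc k) * (\<delta> * real (Suc n) ^ l) * \<sigma> ^ (n + Suc k * N) * w k' \<le> it S A (n + Suc k * N) x k'"
          by (simp add: add_ac)
      qed
    qed
    \<comment> \<open>The constant comes from starting at half time \<open>n = m div 2\<close>:
      every later window sees at least \<open>(n + 1)^l \<ge> ((m + 1) / 2)^l\<close>, and
      \<open>k \<ge> (m + 1) / (8 N)\<close> windows fit into the remaining time.\<close>
    let ?c = "\<delta> * w i / (real (8 * N) * 2 ^ l)"
    have "pe \<sigma> (Suc l) m \<le> 1 / ?c * it S A m x i" if m: "4 * N \<le> m" for m
    proof -
      define n where "n = m div 2"
      define k where "k = (m - n) div N"
      have kN: "k * N \<le> m - n" unfolding k_def by simp
      have "m - n < Suc k * N" unfolding k_def using N(2)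
        by (metis add.commute dividend_less_times_div mult.commute mult_Suc_right)
      then have "m < 2 * (Suc k * N)" unfolding n_def by simp
      then have "real m < 2 * real N * real (Suc k)" by (metis mult.commute mult.assoc of_nat_less_iff of_nat_mult of_nat_numeral)
      moreover have "4 * real N \<le> real m" using m by (metis of_nat_le_iff of_nat_mult of_nat_numeral)
      ultimately have "real m \<le> 4 * real N * real k" by (simp add: algebra_simps)
      moreover have "1 \<le> real m" using m N(2) by simp
      ultimately have "real (Suc m) \<le> 8 * real N * real k" by simp
      then have k: "real (Suc m) / (8 * real N) \<le> real k" using N(2) by (simp add: pos_divide_le_eq mult.commute)
      have n: "real (Suc m) / 2 \<le> real (Suc n)"
      proof -
        have "Suc m \<le> 2 * Suc n" unfolding n_def by simp
        then have "real (Suc m) \<le> real (2 * Suc n)" by (simp only: of_nat_le_iff)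
        then show ?thesis by simp
      qed
      have "G m (real k * (\<delta> * real (Suc n) ^ l))"
        using GS[OF GkN[of n k], of "m - (n + k * N)"] kN by (simp add: n_def)
      then have "real k * (\<delta> * real (Suc n) ^ l) * \<sigma> ^ m * w i \<le> it S A m x i" using i unfolding G_def by blast
      moreover have "real (Suc m) / (8 * real N) * (\<delta> * (real (Suc m) / 2) ^ l) * \<sigma> ^ m * w i
          \<le> real k * (\<delta> * real (Suc n) ^ l) * \<sigma> ^ m * w i"
        using k n \<delta> s w[OF i] N by (intro mult_right_mono mult_mono power_mono) auto
      ultimately have "real (Suc m) / (8 * real N) * (\<delta> * (real (Suc m) / 2) ^ l) * \<sigma> ^ m * w i \<le> it S A m x i"
        by linarith
      moreover have "real (Suc m) / (8 * real N) * (\<delta> * (real (Suc m) / 2) ^ l) * \<sigma> ^ m * w i = ?c * pe \<sigma> (Suc l) m"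
        by (simp add: pe_def power_divide)
      ultimately have "?c * pe \<sigma> (Suc l) m \<le> it S A m x i" by simp
      moreover have c: "0 < ?c" using \<delta> w[OF i] N by simp
      moreover have "x \<le> 1 / c * y" if "c * x \<le> y" "0 < c" for c x y :: real
        using that by (simp add: pos_le_divide_eq mult.commute)
      ultimately show ?thesis by blast
    qed
    moreover have "0 < 1 / ?c" using \<delta> w[OF i] N by simp
    ultimately have "growth_le (pe \<sigma> (Suc l)) (\<lambda>n. it S A n x i)" by (intro growth_leI[of "1 / ?c" "4 * N"])
    then show ?thesis using 3 by (simp add: new_type_def)
  qed
qed

section \<open>Strongly connected components and recursion along accessibility\<close>

definition scc :: "'a set \<Rightarrow> ('a \<Rightarrow> 'a \<Rightarrow> real) \<Rightarrow> 'a \<Rightarrow> 'a set" where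
  "scc S A i = {j \<in> S. (i, j) \<in> (edges S A)\<^sup>* \<and> (j, i) \<in> (edges S A)\<^sup>*}"

definition below :: "'a set \<Rightarrow> ('a \<Rightarrow> 'a \<Rightarrow> real) \<Rightarrow> 'a \<Rightarrow> 'a set" where
  "below S A i = {j \<in> S. (i, j) \<in> (edges S A)\<^sup>*} - scc S A i"

lemma scc_subset: "scc S A i \<subseteq> S"
  by (auto simp: scc_def)

lemma below_subset: "below S A i \<subseteq> S"
  by (auto simp: below_def)

lemma self_in_scc: "i \<in> S \<Longrightarrow> i \<in> scc S A i"
  by (auto simp: scc_def)

text \<open>Every intermediate state of a path between two members is accessible from
  \<open>i\<close> and has access to \<open>i\<close>, so the path never leaves the
  component.\<close>

lemma scc_irreducible:
  assumes "j \<in> scc S A i" "k \<in> scc S A i"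
  shows "(j, k) \<in> (edges (scc S A i) A)\<^sup>*"
proof -
  have "(j, i) \<in> (edges S A)\<^sup>*" "(i, k) \<in> (edges S A)\<^sup>*" using assms by (simp_all add: scc_def)
  then have "(j, k) \<in> (edges S A)\<^sup>*" by (rule rtrancl_trans)
  then have "(i, j) \<in> (edges S A)\<^sup>* \<longrightarrow> (j, k) \<in> (edges (scc S A i) A)\<^sup>*"
  proof (induction rule: converse_rtrancl_induct)
    case base
    then show ?case by simp
  next
    case (step j m)
    show ?case
    proof
      assume ij: "(i, j) \<in> (edges S A)\<^sup>*"
      then have im: "(i, m) \<in> (edges S A)\<^sup>*" using step(1) by simp
      have "(k, i) \<in> (edges S A)\<^sup>*" using assms(2) by (simp add: scc_def)
      with step(2) have mi: "(m, i) \<in> (edges S A)\<^sup>*" by (rule rtrancl_trans)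
      with step(1) have ji: "(j, i) \<in> (edges S A)\<^sup>*" by (rule converse_rtrancl_into_rtrancl)
      have "(j, m) \<in> edges (scc S A i) A" using step(1) ij im mi ji by (auto simp: edges_def scc_def)
      then show "(j, k) \<in> (edges (scc S A i) A)\<^sup>*" using step(3) im by simp
    qed
  qed
  then show ?thesis using assms by (auto simp: scc_def)
qed

text \<open>The set of accessible states shrinks strictly from \<open>i\<close> to any
  \<open>j\<close> in \<open>below S A i\<close>, since \<open>i\<close> itself is lost.\<close>

lemma scc_induct:
  assumes "finite S" "i \<in> S" and step: "\<And>i. i \<in> S \<Longrightarrow> (\<And>j. j \<in> below S A i \<Longrightarrow> P j) \<Longrightarrow> P i"
  shows "P i"
  using assms(2)
proof (induction "card {j \<in> S. (i, j) \<in> (edges S A)\<^sup>*}" arbitrary: i rule: less_induct)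
  case less
  show ?case
  proof (rule step[OF less.prems])
    fix j assume j: "j \<in> below S A i"
    have "{k \<in> S. (j, k) \<in> (edges S A)\<^sup>*} \<subseteq> {k \<in> S. (i, k) \<in> (edges S A)\<^sup>*}"
    proof
      fix k assume k: "k \<in> {k \<in> S. (j, k) \<in> (edges S A)\<^sup>*}"
      have "(i, j) \<in> (edges S A)\<^sup>*" using j by (simp add: below_def)
      with k show "k \<in> {k \<in> S. (i, k) \<in> (edges S A)\<^sup>*}" by (simp add: rtrancl_trans)
    qed
    moreover have "i \<notin> {k \<in> S. (j, k) \<in> (edges S A)\<^sup>*}" using j by (simp add: below_def scc_def)
    moreover have "i \<in> {k \<in> S. (i, k) \<in> (edges S A)\<^sup>*}" using less.prems by simp
    ultimately have "{k \<in> S. (j, k) \<in> (edges S A)\<^sup>*} \<subset> {k \<in> S. (i, k) \<in> (edges S A)\<^sup>*}" by blast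
    then have "card {k \<in> S. (j, k) \<in> (edges S A)\<^sup>*} < card {k \<in> S. (i, k) \<in> (edges S A)\<^sup>*}"
      using assms(1) by (intro psubset_card_mono) auto
    then show "P j" by (rule less.hyps) (use j in \<open>simp add: below_def\<close>)
  qed
qed

text \<open>The growth order of \<open>pe_dom\<close>. It is total, so a nonempty finite set of
  states has one of largest type.\<close>

definition type_le :: "real \<times> nat \<Rightarrow> real \<times> nat \<Rightarrow> bool" where
  "type_le s t \<longleftrightarrow> fst s < fst t \<or> fst s = fst t \<and> snd s \<le> snd t"

lemma type_le_refl: "type_le t t"
  by (simp add: type_le_def)

lemma type_le_trans: "type_le s t \<Longrightarrow> type_le t u \<Longrightarrow> type_le s u"
  by (auto simp: type_le_def)

lemma type_le_linear: "type_le s t \<or> type_le t s"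
  by (auto simp: type_le_def)

lemma type_le_max:
  assumes "finite Q" "Q \<noteq> {}"
  shows "\<exists>j\<in>Q. \<forall>k\<in>Q. type_le (ty k) (ty j)"
  using assms
proof (induction rule: finite_ne_induct)
  case (singleton i)
  then show ?case by (simp add: type_le_refl)
next
  case (insert i Q)
  then obtain j where j: "j \<in> Q" "\<forall>k\<in>Q. type_le (ty k) (ty j)" by blast
  show ?case
  proof (cases "type_le (ty i) (ty j)")
    case True
    then show ?thesis using j by blast
  next
    case False
    then have "type_le (ty j) (ty i)" using type_le_linear by blast
    then show ?thesis using j type_le_trans type_le_refl by blast
  qed
qed

text \<open>The rows of the class of \<open>i\<close> have entries only in the class and in
  \<open>below S A i\<close>, and the largest type below decides what is inherited. With nothing
  below, the pair \<open>(0, 0)\<close> is neutral: for \<open>\<rho> = 0\<close> it produces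
  \<open>(0, 1)\<close>, which again describes an eventually zero sequence.\<close>

lemma scc_growth:
  assumes fin: "finite S" and nn: "nonneg_on S A" and i: "i \<in> S"
    and x: "\<And>k. k \<in> S \<Longrightarrow> 0 < x k"
    and ty: "\<And>j. j \<in> below S A i \<Longrightarrow> 0 \<le> fst (ty j) \<and> growth_eq (\<lambda>n. it S A n x j) (pt (ty j))"
    and w: "\<And>k. k \<in> scc S A i \<Longrightarrow> 0 < w k" and \<rho>: "0 \<le> \<rho>"
    and Aw: "\<And>k. k \<in> scc S A i \<Longrightarrow> ap (scc S A i) A w k = \<rho> * w k"
  shows "(below S A i = {} \<and> growth_eq (\<lambda>n. it S A n x i) (pt (new_type \<rho> 0 0))) \<or>
    (\<exists>j\<in>below S A i. (\<forall>k\<in>below S A i. type_le (ty k) (ty j)) \<and>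
      growth_eq (\<lambda>n. it S A n x i) (pt (new_type \<rho> (fst (ty j)) (snd (ty j)))))"
proof -
  let ?C = "scc S A i" and ?Q = "below S A i"
  have disj: "?C \<inter> ?Q = {}" by (auto simp: below_def)
  have closed: "A k j = 0" if "k \<in> ?C" "j \<in> S - (?C \<union> ?Q)" for k j
  proof (rule ccontr)
    assume "A k j \<noteq> 0"
    then have "(k, j) \<in> edges S A" using that nonneg_onD[OF nn, of k j] scc_subset
      by (force simp: edges_def scc_def)
    then have "(i, j) \<in> (edges S A)\<^sup>*" using that(1) by (auto simp: scc_def)
    then show False using that(2) by (auto simp: below_def)
  qed
  note upper = step_upper[OF fin nn scc_subset below_subset disj closed w \<rho> Aw _ _ self_in_scc[OF i]]
  note lower = step_lower[OF fin nn scc_subset w \<rho> Aw _ x _ self_in_scc[OF i]]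
  show ?thesis
  proof (cases "?Q = {}")
    case True
    have "growth_le (\<lambda>n. it S A n x i) (pt (new_type \<rho> 0 0))" by (rule upper) (use True in auto)
    moreover have "growth_le (pt (new_type \<rho> 0 0)) (\<lambda>n. it S A n x i)" by (rule lower) auto
    ultimately show ?thesis using True unfolding growth_eq_def by blast
  next
    case False
    obtain j where j: "j \<in> ?Q" "\<forall>k\<in>?Q. type_le (ty k) (ty j)"
      using type_le_max[OF _ False, of ty] fin below_subset finite_subset by metis
    have "growth_le (\<lambda>n. it S A n x i) (pt (new_type \<rho> (fst (ty j)) (snd (ty j))))"
    proof (rule upper)
      fix k assume k: "k \<in> ?Q"
      have "growth_le (\<lambda>n. it S A n x k) (pt (ty k))" using ty[OF k] unfolding growth_eq_def by blast
      also have "growth_le (pt (ty k)) (pt (ty j))"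
        by (rule pe_dom) (use ty[OF k] j k in \<open>auto simp: type_le_def\<close>)
      finally (growth_le_trans) show "growth_le (\<lambda>n. it S A n x k) (pt (ty j))" .
    qed (use ty[OF j(1)] in auto)
    moreover have "growth_le (pt (new_type \<rho> (fst (ty j)) (snd (ty j)))) (\<lambda>n. it S A n x i)"
    proof (rule lower)
      have "(k, j) \<in> (edges S A)\<^sup>*" if "k \<in> ?C" for k
      proof -
        have "(k, i) \<in> (edges S A)\<^sup>*" "(i, j) \<in> (edges S A)\<^sup>*" using that j(1) by (simp_all add: below_def scc_def)
        then show ?thesis by (rule rtrancl_trans)
      qed
      then show "fst (ty j) = 0 \<or> j \<in> S - ?C \<and> growth_le (pt (ty j)) (\<lambda>n. it S A n x j) \<and> (\<forall>i\<in>?C. (i, j) \<in> (edges S A)\<^sup>*)"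
        using ty[OF j(1)] j(1) by (auto simp: below_def growth_eq_def)
    qed (use ty[OF j(1)] in auto)
    ultimately show ?thesis using j unfolding growth_eq_def by blast
  qed
qed

lemma scc_perron:
  assumes "finite S" "nonneg_on S A" "i \<in> S"
  shows "\<exists>\<rho> w. 0 \<le> \<rho> \<and> (\<forall>k\<in>scc S A i. 0 < w k) \<and> (\<forall>k\<in>scc S A i. ap (scc S A i) A w k = \<rho> * w k)"
proof (rule perron_vector)
  show "finite (scc S A i)" using assms(1) scc_subset finite_subset by metis
  show "scc S A i \<noteq> {}" using self_in_scc[OF assms(3)] by blast
  show "nonneg_on (scc S A i) A" using nonneg_on_subset[OF assms(2) scc_subset] .
qed (rule scc_irreducible)

lemma fst_new_type: "0 \<le> \<rho> \<Longrightarrow> 0 \<le> \<sigma> \<Longrightarrow> 0 \<le> fst (new_type \<rho> \<sigma> l)"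
  by (simp add: new_type_def)

text \<open>Comparison up to constants hides periodicity, so \<open>scc_growth\<close> assigns an
  exact type to each state, recursively along \<open>scc_induct\<close>.\<close>

lemma growth_type_exists:
  assumes fin: "finite S" and nn: "nonneg_on S A" and x: "\<And>k. k \<in> S \<Longrightarrow> 0 < x k" and i: "i \<in> S"
  shows "\<exists>t. 0 \<le> fst t \<and> growth_eq (\<lambda>n. it S A n x i) (pt t)"
proof (rule scc_induct[OF fin i, where A = A])
  fix i assume i: "i \<in> S" and IH: "\<And>j. j \<in> below S A i \<Longrightarrow> \<exists>t. 0 \<le> fst t \<and> growth_eq (\<lambda>n. it S A n x j) (pt t)"
  obtain ty where ty: "\<And>j. j \<in> below S A i \<Longrightarrow> 0 \<le> fst (ty j) \<and> growth_eq (\<lambda>n. it S A n x j) (pt (ty j))"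
    using IH by metis
  obtain \<rho> w where r: "0 \<le> \<rho>" "\<forall>k\<in>scc S A i. 0 < w k" "\<forall>k\<in>scc S A i. ap (scc S A i) A w k = \<rho> * w k"
    using scc_perron[OF fin nn i] by blast
  have *: "(below S A i = {} \<and> growth_eq (\<lambda>n. it S A n x i) (pt (new_type \<rho> 0 0))) \<or>
    (\<exists>j\<in>below S A i. (\<forall>k\<in>below S A i. type_le (ty k) (ty j)) \<and>
      growth_eq (\<lambda>n. it S A n x i) (pt (new_type \<rho> (fst (ty j)) (snd (ty j)))))"
    by (rule scc_growth[OF fin nn i x ty, of w \<rho>]) (use r in auto)
  then show "\<exists>t. 0 \<le> fst t \<and> growth_eq (\<lambda>n. it S A n x i) (pt t)"
  proof
    assume "below S A i = {} \<and> growth_eq (\<lambda>n. it S A n x i) (pt (new_type \<rho> 0 0))"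
    then show ?thesis using fst_new_type[OF r(1), of 0] by blast
  next
    assume "\<exists>j\<in>below S A i. (\<forall>k\<in>below S A i. type_le (ty k) (ty j)) \<and>
      growth_eq (\<lambda>n. it S A n x i) (pt (new_type \<rho> (fst (ty j)) (snd (ty j))))"
    then obtain j where "j \<in> below S A i"
      "growth_eq (\<lambda>n. it S A n x i) (pt (new_type \<rho> (fst (ty j)) (snd (ty j))))" by blast
    then show ?thesis using fst_new_type[OF r(1), of "fst (ty j)"] ty by blast
  qed
qed

subsection \<open>Optimal policies for a discounted problem\<close>

definition policy :: "'a set \<Rightarrow> ('a \<Rightarrow> ('a \<Rightarrow> real) set) \<Rightarrow> ('a \<Rightarrow> 'a \<Rightarrow> real) \<Rightarrow> bool" where
  "policy T R D \<longleftrightarrow> (\<forall>i\<in>T. D i \<in> R i)"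

text \<open>The form in which the product property is used: each state has a finite set of rows,
  chosen independently of the other states. Rows are functions on the whole type of which only the
  entries on \<open>T\<close> count.\<close>

definition row_system :: "'a set \<Rightarrow> ('a \<Rightarrow> ('a \<Rightarrow> real) set) \<Rightarrow> bool" where
  "row_system T R \<longleftrightarrow> finite T \<and>
     (\<forall>i\<in>T. finite (R i) \<and> R i \<noteq> {} \<and> (\<forall>a\<in>R i. \<forall>j\<in>T. 0 \<le> a j))"

lemma policy_nonneg_on: "row_system T R \<Longrightarrow> policy T R D \<Longrightarrow> nonneg_on T D"
  by (auto simp: row_system_def policy_def nonneg_on_def)

text \<open>Policies are unconstrained outside \<open>T\<close>; restricted to \<open>T\<close> they
  form the finite set \<open>PiE T R\<close>, over which constants can be made uniform.\<close>

lemma policy_restrict: "policy T R D \<longleftrightarrow> restrict D T \<in> PiE T R"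
  by (auto simp: policy_def)

lemma it_restrict: "i \<in> T \<Longrightarrow> it T (restrict D T) n x i = it T D n x i"
  by (rule it_cong) auto

lemma finite_policies: "row_system T R \<Longrightarrow> finite (PiE T R)"
  by (rule finite_PiE) (auto simp: row_system_def)

lemma policy_PiE: "D \<in> PiE T R \<Longrightarrow> policy T R D"
  by (auto simp: policy_def)

text \<open>The Neumann series of \<open>(1 - D / s)^(-1) z\<close>, that is, the total cost at
  discount factor \<open>1 / s\<close>. A divergent \<open>suminf\<close> has no useful value, hence
  the separate predicate \<open>dsummable\<close>.\<close>

definition dsum :: "'a set \<Rightarrow> ('a \<Rightarrow> 'a \<Rightarrow> real) \<Rightarrow> ('a \<Rightarrow> real) \<Rightarrow> real \<Rightarrow> 'a \<Rightarrow> real" where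
  "dsum T D z s i = (\<Sum>m. it T D m z i / s ^ m)"

definition dsummable :: "'a set \<Rightarrow> ('a \<Rightarrow> 'a \<Rightarrow> real) \<Rightarrow> ('a \<Rightarrow> real) \<Rightarrow> real \<Rightarrow> bool" where
  "dsummable T D z s \<longleftrightarrow> (\<forall>i\<in>T. summable (\<lambda>m. it T D m z i / s ^ m))"

lemma dsum_restrict: "i \<in> T \<Longrightarrow> dsum T (restrict D T) z s i = dsum T D z s i"
  by (simp add: dsum_def it_restrict)

lemma dsummable_restrict: "dsummable T (restrict D T) z s \<longleftrightarrow> dsummable T D z s"
  by (simp add: dsummable_def it_restrict)

lemma dsum_fixed_point:
  assumes "finite T" "0 < s" "dsummable T D z s" "i \<in> T"
  shows "dsum T D z s i = z i + ap T D (dsum T D z s) i / s"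
proof -
  have sm: "summable (\<lambda>m. it T D m z j / s ^ m)" if "j \<in> T" for j using assms(3) that by (simp add: dsummable_def)
  have "dsum T D z s i = z i + (\<Sum>m. it T D (Suc m) z i / s ^ Suc m)"
    unfolding dsum_def using suminf_split_head[OF sm[OF assms(4)]] by simp
  also have "(\<lambda>m. it T D (Suc m) z i / s ^ Suc m) = (\<lambda>m. (\<Sum>j\<in>T. D i j * (it T D m z j / s ^ m)) / s)"
    unfolding it_Suc by (rule ext) (simp add: sum_divide_distrib mult.commute)
  also have "(\<Sum>m. (\<Sum>j\<in>T. D i j * (it T D m z j / s ^ m)) / s) = (\<Sum>m. \<Sum>j\<in>T. D i j * (it T D m z j / s ^ m)) / s"
    by (rule suminf_divide) (intro summable_sum summable_mult sm)
  also have "(\<Sum>m. \<Sum>j\<in>T. D i j * (it T D m z j / s ^ m)) = (\<Sum>j\<in>T. \<Sum>m. D i j * (it T D m z j / s ^ m))"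
    by (rule suminf_sum) (intro summable_mult sm)
  also have "\<dots> = ap T D (dsum T D z s) i"
    unfolding ap_def[of T D "dsum T D z s"] dsum_def
    by (rule sum.cong[OF refl], rule suminf_mult, rule sm)
  finally show ?thesis .
qed

text \<open>Partial sums stay below \<open>x\<close> by induction: the one of length
  \<open>M + 1\<close> is \<open>z\<close> plus \<open>D / s\<close> applied to the one of length
  \<open>M\<close>. Their boundedness yields summability as well.\<close>

lemma dsum_le_super:
  assumes fin: "finite T" and nn: "nonneg_on T D" and s: "0 < s"
    and z: "\<And>j. j \<in> T \<Longrightarrow> 0 \<le> z j" and x: "\<And>j. j \<in> T \<Longrightarrow> 0 \<le> x j"
    and super: "\<And>j. j \<in> T \<Longrightarrow> z j + ap T D x j / s \<le> x j"
  shows "dsummable T D z s \<and> (\<forall>i\<in>T. dsum T D z s i \<le> x i)"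
proof -
  have partial: "(\<Sum>m<M. it T D m z i / s ^ m) \<le> x i" if "i \<in> T" for M i
    using that
  proof (induction M arbitrary: i)
    case 0
    then show ?case using x by simp
  next
    case (Suc M)
    have "(\<Sum>m<Suc M. it T D m z i / s ^ m) = z i + (\<Sum>m<M. it T D (Suc m) z i / s ^ Suc m)"
      by (simp add: sum.lessThan_Suc_shift del: sum.lessThan_Suc)
    also have "(\<Sum>m<M. it T D (Suc m) z i / s ^ Suc m) = (\<Sum>m<M. \<Sum>j\<in>T. D i j * (it T D m z j / s ^ m) / s)"
      unfolding it_Suc by (simp add: sum_divide_distrib mult.commute)
    also have "\<dots> = (\<Sum>j\<in>T. \<Sum>m<M. D i j * (it T D m z j / s ^ m) / s)" by (rule sum.swap)
    also have "\<dots> = ap T D (\<lambda>j. \<Sum>m<M. it T D m z j / s ^ m) i / s"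
      by (simp add: ap_def[of T D "\<lambda>j. \<Sum>m<M. it T D m z j / s ^ m"] sum_divide_distrib sum_distrib_left)
    also have "\<dots> \<le> ap T D x i / s"
      by (intro divide_right_mono ap_mono[OF nn Suc.IH Suc.prems]) (use s in auto)
    finally show ?case using super[OF Suc.prems] by linarith
  qed
  have nonneg: "0 \<le> it T D m z i / s ^ m" if "i \<in> T" for m i
    using it_nonneg[OF nn z that] s by simp
  have sm: "summable (\<lambda>m. it T D m z i / s ^ m)" if "i \<in> T" for i
    by (rule summableI_nonneg_bounded[OF nonneg[OF that] partial[OF that]])
  show ?thesis unfolding dsummable_def dsum_def using sm
    by (auto intro!: suminf_le_const partial)
qed

text \<open>Unfolding the inequality \<open>M\<close> times leaves a remainder. As \<open>z\<close>
  is positive, the remainder is at most \<open>K\<close> times the general term of the convergent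
  series and vanishes in the limit.\<close>

lemma dsum_ge_sub:
  assumes fin: "finite T" and nn: "nonneg_on T D" and s: "0 < s"
    and z: "\<And>j. j \<in> T \<Longrightarrow> 0 < z j" and sm: "dsummable T D z s"
    and sub: "\<And>j. j \<in> T \<Longrightarrow> x j \<le> z j + ap T D x j / s" and i: "i \<in> T"
  shows "x i \<le> dsum T D z s i"
proof -
  have sm: "summable (\<lambda>m. it T D m z i / s ^ m)" if "i \<in> T" for i using sm that by (simp add: dsummable_def)
  obtain K where K: "K > 0" "\<forall>j\<in>T. x j / z j \<le> K" using finite_upper[OF fin, of "\<lambda>j. x j / z j"] by blast
  have xK: "x j \<le> K * z j" if "j \<in> T" for j using K that z[OF that] by (auto simp: pos_divide_le_eq)
  have partial: "x i \<le> (\<Sum>m<M. it T D m z i / s ^ m) + K * (it T D M z i / s ^ M)" if "i \<in> T" for M i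
    using that
  proof (induction M arbitrary: i)
    case 0
    then show ?case using xK by simp
  next
    case (Suc M)
    have "x i \<le> z i + ap T D x i / s" by (rule sub[OF Suc.prems])
    also have "\<dots> \<le> z i + ap T D (\<lambda>j. (\<Sum>m<M. it T D m z j / s ^ m) + K * (it T D M z j / s ^ M)) i / s"
      by (intro add_left_mono divide_right_mono ap_mono[OF nn Suc.IH Suc.prems]) (use s in auto)
    also have "ap T D (\<lambda>j. (\<Sum>m<M. it T D m z j / s ^ m) + K * (it T D M z j / s ^ M)) i / s
       = (\<Sum>j\<in>T. \<Sum>m<M. D i j * (it T D m z j / s ^ m) / s) + (\<Sum>j\<in>T. K * (D i j * it T D M z j / s ^ Suc M))"
      unfolding ap_def[of T D "\<lambda>j. (\<Sum>m<M. it T D m z j / s ^ m) + K * (it T D M z j / s ^ M)"]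
        sum_divide_distrib sum.distrib[symmetric]
      by (rule sum.cong) (simp_all add: distrib_left add_divide_distrib sum_divide_distrib sum_distrib_left mult_ac)
    also have "(\<Sum>j\<in>T. \<Sum>m<M. D i j * (it T D m z j / s ^ m) / s) = (\<Sum>m<M. \<Sum>j\<in>T. D i j * (it T D m z j / s ^ m) / s)"
      by (rule sum.swap)
    also have "\<dots> = (\<Sum>m<M. it T D (Suc m) z i / s ^ Suc m)"
      unfolding it_Suc by (simp add: sum_divide_distrib mult.commute)
    also have "(\<Sum>j\<in>T. K * (D i j * it T D M z j / s ^ Suc M)) = K * (it T D (Suc M) z i / s ^ Suc M)"
      unfolding it_Suc sum_distrib_left sum_divide_distrib ..
    also have "z i + ((\<Sum>m<M. it T D (Suc m) z i / s ^ Suc m) + K * (it T D (Suc M) z i / s ^ Suc M))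
        = (\<Sum>m<Suc M. it T D m z i / s ^ m) + K * (it T D (Suc M) z i / s ^ Suc M)"
      by (simp add: sum.lessThan_Suc_shift del: sum.lessThan_Suc)
    finally show ?case .
  qed
  show ?thesis
  proof (rule LIMSEQ_le_const)
    have "(\<lambda>M. (\<Sum>m<M. it T D m z i / s ^ m) + K * (it T D M z i / s ^ M)) \<longlonglongrightarrow> dsum T D z s i + K * 0"
      unfolding dsum_def by (intro tendsto_intros summable_LIMSEQ summable_LIMSEQ_zero sm i)
    then show "(\<lambda>M. (\<Sum>m<M. it T D m z i / s ^ m) + K * (it T D M z i / s ^ M)) \<longlonglongrightarrow> dsum T D z s i" by simp
  qed (use partial[OF i] in blast)
qed

text \<open>The third condition is the half of Bellman's equation that bounds the minimum over rows
  from below; along \<open>A\<close> itself equality holds by \<open>dsum_fixed_point\<close>.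
  Competitors with a divergent series count as infinitely expensive.\<close>

definition optimal ::
  "'a set \<Rightarrow> ('a \<Rightarrow> ('a \<Rightarrow> real) set) \<Rightarrow> ('a \<Rightarrow> real) \<Rightarrow> real \<Rightarrow> ('a \<Rightarrow> 'a \<Rightarrow> real) \<Rightarrow> bool" where
  "optimal T R z s A \<longleftrightarrow> policy T R A \<and> dsummable T A z s \<and>
     (\<forall>i\<in>T. \<forall>a\<in>R i. dsum T A z s i \<le> z i + (\<Sum>j\<in>T. a j * dsum T A z s j) / s) \<and>
     (\<forall>D. policy T R D \<longrightarrow> dsummable T D z s \<longrightarrow> (\<forall>i\<in>T. dsum T A z s i \<le> dsum T D z s i))"

text \<open>Policy improvement: take a policy that minimizes the sum of the values over all states; a row that
  improves one state would lower this sum.\<close>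

lemma optimal_policy:
  assumes rs: "row_system T R" and s: "0 < s" and z: "\<And>j. j \<in> T \<Longrightarrow> 0 < z j"
    and B: "policy T R B" "dsummable T B z s"
  shows "\<exists>A. optimal T R z s A"
proof -
  have fin: "finite T" using rs by (simp add: row_system_def)
  let ?V = "{D \<in> PiE T R. dsummable T D z s}"
  have finV: "finite ?V" using finite_policies[OF rs] by simp
  have "restrict B T \<in> ?V" using B policy_restrict[of T R B] dsummable_restrict[of T B z s] by blast
  then have neV: "?V \<noteq> {}" by blast
  define A where "A = arg_min_on (\<lambda>D. sum (dsum T D z s) T) ?V"
  have AV: "A \<in> ?V" unfolding A_def by (rule arg_min_if_finite(1)[OF finV neV])
  have Amin: "sum (dsum T A z s) T \<le> sum (dsum T D z s) T" if "D \<in> ?V" for D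
    using arg_min_least[OF finV neV that] unfolding A_def .
  have pA: "policy T R A" using AV policy_PiE by blast
  have smA: "dsummable T A z s" using AV by blast
  have nnA: "nonneg_on T A" by (rule policy_nonneg_on[OF rs pA])
  let ?x = "dsum T A z s"
  have x0: "0 \<le> ?x j" if "j \<in> T" for j unfolding dsum_def
    by (rule suminf_nonneg)
      (use smA that it_nonneg[OF nnA, of z] z s in \<open>auto simp: dsummable_def less_imp_le\<close>)
  have opt: "?x i \<le> z i + (\<Sum>j\<in>T. a j * ?x j) / s" if i: "i \<in> T" and a: "a \<in> R i" for i a
  proof (rule ccontr)
    assume "\<not> ?thesis"
    then have less: "z i + (\<Sum>j\<in>T. a j * ?x j) / s < ?x i" by simp
    \<comment> \<open>With the improving row in place, the value of \<open>A\<close> is a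
      supersolution for \<open>D\<close>, so \<open>D\<close> costs no more anywhere and strictly
      less at \<open>i\<close>.\<close>
    define D where "D = A(i := a)"
    have DP: "D \<in> PiE T R" using AV i a by (auto simp: D_def PiE_iff extensional_def)
    have pD: "policy T R D" by (rule policy_PiE[OF DP])
    have nnD: "nonneg_on T D" by (rule policy_nonneg_on[OF rs pD])
    have super: "z j + ap T D ?x j / s \<le> ?x j" if "j \<in> T" for j
    proof (cases "j = i")
      case True
      then show ?thesis using less by (simp add: D_def ap_def)
    next
      case False
      then have "ap T D ?x j = ap T A ?x j" by (simp add: D_def ap_def)
      then show ?thesis using dsum_fixed_point[OF fin s smA that] by simp
    qed
    have D: "dsummable T D z s" "\<forall>j\<in>T. dsum T D z s j \<le> ?x j"
      using dsum_le_super[OF fin nnD s less_imp_le[OF z] x0 super] by auto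
    have "dsum T D z s i = z i + ap T D (dsum T D z s) i / s" by (rule dsum_fixed_point[OF fin s D(1) i])
    also have "\<dots> \<le> z i + ap T D ?x i / s"
      by (intro add_left_mono divide_right_mono ap_mono[OF nnD _ i]) (use D(2) s in auto)
    also have "\<dots> < ?x i" using less by (simp add: D_def ap_def)
    finally have "sum (dsum T D z s) T < sum ?x T"
      using D(2) i fin by (intro sum_strict_mono_ex1) auto
    then show False using Amin[of D] DP D(1) by force
  qed
  \<comment> \<open>The inequalities in \<open>opt\<close> make the value of \<open>A\<close> a
    subsolution for every policy at once.\<close>
  have "?x i \<le> dsum T D z s i" if "policy T R D" "dsummable T D z s" "i \<in> T" for D i
    by (rule dsum_ge_sub[OF fin policy_nonneg_on[OF rs that(1)] s z that(2) _ that(3)])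
      (use opt that(1) in \<open>auto simp: policy_def ap_def\<close>)
  then show ?thesis unfolding optimal_def using pA smA opt by blast
qed

section \<open>Power series with coefficients of polynomial growth\<close>

lemma summable_pe:
  assumes "0 \<le> r" "r < 1"
  shows "summable (pe r l)"
proof -
  define s where "s = (r + 1) / 2"
  have s: "r < s" "s < 1" "0 < s" using assms by (auto simp: s_def)
  obtain q where q: "q > 0" "\<forall>n. pe r l n \<le> q * pe s 0 n"
    using growth_le_all[OF pe_dom[of r s l 0]] assms s pe_pos by blast
  show ?thesis
  proof (rule summable_comparison_test')
    show "summable (\<lambda>n. q * s ^ n)" by (rule summable_mult) (use s in simp)
    show "norm (pe r l n) \<le> q * s ^ n" for n using q(2) pe_nonneg[OF assms(1), of l n] by (simp add: pe_def)
  qed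
qed

text \<open>Summation by parts: multiplication by \<open>1 - r\<close> replaces the coefficients
  \<open>(n + 1)^(l + 1)\<close> by their differences, which lie between \<open>(n + 1)^l\<close>
  and \<open>(l + 1) (n + 1)^l\<close>.\<close>

lemma suminf_pe_Suc:
  assumes "0 \<le> r" "r < 1"
  shows "(\<Sum>n. pe r l n) \<le> (1 - r) * (\<Sum>n. pe r (Suc l) n)"
    and "(1 - r) * (\<Sum>n. pe r (Suc l) n) \<le> real (Suc l) * (\<Sum>n. pe r l n)"
proof -
  let ?d = "\<lambda>n. pe r (Suc l) (Suc n) - r * pe r (Suc l) n"
  have pe0: "pe r k 0 = 1" for k by (simp add: pe_def)
  have sS: "summable (\<lambda>n. pe r k (Suc n))" for k
    using summable_pe[OF assms, of k] summable_Suc_iff by blast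
  have sd: "summable ?d" by (intro summable_diff sS summable_mult summable_pe assms)
  have "(\<Sum>n. pe r (Suc l) n) = 1 + (\<Sum>n. pe r (Suc l) (Suc n))"
    using suminf_split_head[OF summable_pe[OF assms, of "Suc l"]] by (simp add: pe0)
  moreover have "(\<Sum>n. ?d n) = (\<Sum>n. pe r (Suc l) (Suc n)) - r * (\<Sum>n. pe r (Suc l) n)"
    by (simp add: suminf_diff[symmetric] suminf_mult[symmetric] sS summable_pe[OF assms] summable_mult)
  ultimately have 1: "(1 - r) * (\<Sum>n. pe r (Suc l) n) = 1 + (\<Sum>n. ?d n)" by (simp add: algebra_simps)
  have 2: "(\<Sum>n. pe r l n) = 1 + (\<Sum>n. pe r l (Suc n))"
    using suminf_split_head[OF summable_pe[OF assms, of l]] by (simp add: pe0)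
  have d: "?d n = (real (Suc (Suc n)) ^ Suc l - real (Suc n) ^ Suc l) * r ^ Suc n" for n
    by (simp add: pe_def algebra_simps)
  have lo: "pe r l (Suc n) \<le> ?d n" for n
    unfolding d unfolding pe_def
  proof (intro mult_right_mono)
    have "real (Suc n) * real (Suc n) ^ l \<le> real (Suc n) * real (Suc (Suc n)) ^ l"
      by (intro mult_left_mono power_mono) auto
    then show "real (Suc (Suc n)) ^ l \<le> real (Suc (Suc n)) ^ Suc l - real (Suc n) ^ Suc l"
      by (simp add: algebra_simps)
  qed (use assms in auto)
  have diff: "x ^ Suc k - y ^ Suc k \<le> real (Suc k) * x ^ k" if "0 \<le> y" "x = y + 1" for x y :: real and k
  proof (induction k)
    case 0
    then show ?case using that by simp
  next
    case (Suc k)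
    have "x ^ Suc (Suc k) - y ^ Suc (Suc k) = x * (x ^ Suc k - y ^ Suc k) + y ^ Suc k"
      using that by (simp add: algebra_simps)
    also have "\<dots> \<le> x * (real (Suc k) * x ^ k) + x ^ Suc k"
      using Suc that by (intro add_mono mult_left_mono power_mono) auto
    finally show ?case by (simp add: algebra_simps)
  qed
  have hi: "?d n \<le> real (Suc l) * pe r l (Suc n)" for n
    unfolding d unfolding pe_def mult.assoc[symmetric]
    by (intro mult_right_mono diff) (use assms in auto)
  have "(\<Sum>n. pe r l (Suc n)) \<le> (\<Sum>n. ?d n)" by (rule suminf_le[OF lo sS sd])
  then show "(\<Sum>n. pe r l n) \<le> (1 - r) * (\<Sum>n. pe r (Suc l) n)" using 1 2 by simp
  have "(\<Sum>n. ?d n) \<le> real (Suc l) * (\<Sum>n. pe r l (Suc n))"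
    unfolding suminf_mult[OF sS, symmetric] by (rule suminf_le[OF hi sd summable_mult[OF sS]])
  then show "(1 - r) * (\<Sum>n. pe r (Suc l) n) \<le> real (Suc l) * (\<Sum>n. pe r l n)" using 1 2 by (simp add: distrib_left)
qed

text \<open>Starting from the geometric series, each step in \<open>l\<close> divides by
  \<open>1 - r\<close>, and the factors \<open>l + 1\<close> of \<open>suminf_pe_Suc\<close>
  multiply up to \<open>fact l\<close>.\<close>

lemma suminf_pe_bounds:
  assumes "0 \<le> r" "r < 1"
  shows "(1 / (1 - r)) ^ Suc l \<le> (\<Sum>n. pe r l n)" and "(\<Sum>n. pe r l n) \<le> fact l * (1 / (1 - r)) ^ Suc l"
proof (induction l)
  case 0
  have "(\<Sum>n. pe r 0 n) = 1 / (1 - r)" using suminf_geometric[of r] assms by (simp add: pe_def)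
  then show "(1 / (1 - r)) ^ Suc 0 \<le> (\<Sum>n. pe r 0 n)" "(\<Sum>n. pe r 0 n) \<le> fact 0 * (1 / (1 - r)) ^ Suc 0" by auto
next
  case (Suc l)
  have r: "0 < 1 - r" using assms by simp
  have "(1 / (1 - r)) ^ Suc (Suc l) * (1 - r) = (1 / (1 - r)) ^ Suc l" using r by simp
  then have "(1 / (1 - r)) ^ Suc (Suc l) * (1 - r) \<le> (\<Sum>n. pe r (Suc l) n) * (1 - r)"
    using Suc(1) suminf_pe_Suc(1)[OF assms, of l] by (simp add: mult.commute)
  then show "(1 / (1 - r)) ^ Suc (Suc l) \<le> (\<Sum>n. pe r (Suc l) n)" using r by (rule mult_right_le_imp_le)
  have "(\<Sum>n. pe r (Suc l) n) * (1 - r) \<le> real (Suc l) * (\<Sum>n. pe r l n)"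
    using suminf_pe_Suc(2)[OF assms, of l] by (simp add: mult.commute)
  also have "\<dots> \<le> real (Suc l) * (fact l * (1 / (1 - r)) ^ Suc l)" by (intro mult_left_mono Suc) auto
  also have "\<dots> = (fact (Suc l) * (1 / (1 - r)) ^ Suc (Suc l)) * (1 - r)" using r by simp
  finally show "(\<Sum>n. pe r (Suc l) n) \<le> fact (Suc l) * (1 / (1 - r)) ^ Suc (Suc l)" using r by (rule mult_right_le_imp_le)
qed

lemma pe_divide_power: "c * pe 1 l n / s ^ n = c * pe (1 / s) l n"
  by (simp add: pe_def power_divide)

lemma discount_geometric: "1 < s \<Longrightarrow> 1 / (1 - 1 / s) = s / (s - 1)" for s :: real
  by (simp add: field_simps)

text \<open>The Abelian direction: coefficients of order \<open>n^l\<close> produce at most a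
  singularity of order \<open>l + 1\<close> at \<open>s = 1\<close>. No limit is taken, so the bound
  can be used at every \<open>s > 1\<close>.\<close>

lemma discounted_upper:
  fixes s :: real
  assumes "1 < s" "\<And>n. 0 \<le> a n" "\<And>n. a n \<le> C * pe 1 l n" "0 \<le> C"
  shows "summable (\<lambda>n. a n / s ^ n)" "(\<Sum>n. a n / s ^ n) \<le> C * (fact l * (s / (s - 1)) ^ Suc l)"
proof -
  have s: "0 \<le> 1 / s" "1 / s < 1" using assms by auto
  have le: "a n / s ^ n \<le> C * pe (1 / s) l n" for n
    using divide_right_mono[OF assms(3)[of n], of "s ^ n"] assms(1) by (simp add: pe_divide_power)
  have sm: "summable (\<lambda>n. C * pe (1 / s) l n)" by (intro summable_mult summable_pe s)
  show 1: "summable (\<lambda>n. a n / s ^ n)"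
    by (rule summable_comparison_test'[OF sm]) (use le assms in auto)
  have "(\<Sum>n. a n / s ^ n) \<le> C * (\<Sum>n. pe (1 / s) l n)"
    unfolding suminf_mult[OF summable_pe[OF s], symmetric] by (rule suminf_le[OF le 1 sm])
  also have "\<dots> \<le> C * (fact l * (1 / (1 - 1 / s)) ^ Suc l)"
    by (intro mult_left_mono suminf_pe_bounds s assms)
  finally show "(\<Sum>n. a n / s ^ n) \<le> C * (fact l * (s / (s - 1)) ^ Suc l)"
    unfolding discount_geometric[OF assms(1)] .
qed

lemma discounted_lower:
  fixes s :: real
  assumes "1 < s" "\<And>n. c * pe 1 l n \<le> a n" "0 \<le> c" "summable (\<lambda>n. a n / s ^ n)"
  shows "c * (s / (s - 1)) ^ Suc l \<le> (\<Sum>n. a n / s ^ n)"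
proof -
  have s: "0 \<le> 1 / s" "1 / s < 1" using assms by auto
  have le: "c * pe (1 / s) l n \<le> a n / s ^ n" for n
    using divide_right_mono[OF assms(2)[of n], of "s ^ n"] assms(1) by (simp add: pe_divide_power)
  have sm: "summable (\<lambda>n. c * pe (1 / s) l n)" by (intro summable_mult summable_pe s)
  have "c * (1 / (1 - 1 / s)) ^ Suc l \<le> c * (\<Sum>n. pe (1 / s) l n)"
    by (intro mult_left_mono suminf_pe_bounds s assms)
  also have "\<dots> \<le> (\<Sum>n. a n / s ^ n)"
    unfolding suminf_mult[OF summable_pe[OF s], symmetric] by (rule suminf_le[OF le sm assms(4)])
  finally show ?thesis unfolding discount_geometric[OF assms(1)] .
qed

text \<open>The change from \<open>s'\<close> to \<open>s\<close> is controlled by a derivative,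
  whose coefficients \<open>n * a n\<close> have one degree more. Relative to the series itself,
  which the lower bound on \<open>a\<close> keeps large, it has order
  \<open>1 / (s' - 1)\<close>.\<close>

lemma discounted_variation:
  fixes a :: "nat \<Rightarrow> real"
  assumes c: "0 < c" "\<And>n. c * pe 1 l n \<le> a n" and C: "\<And>n. a n \<le> C * pe 1 l n"
  shows "\<exists>M>0. \<forall>s s'. 1 < s' \<longrightarrow> s' < s \<longrightarrow> s' \<le> 2 \<longrightarrow>
    (\<Sum>n. a n / s' ^ n) * (1 - M * ((s - s') / (s' - 1))) \<le> (\<Sum>n. a n / s ^ n)"
proof -
  have a0: "0 < a n" for n
    using mult_pos_pos[OF c(1) pe_pos[of 1 l n]] c(2)[of n] by simp
  have C0: "0 < C" using less_le_trans[OF a0 C, of 0] by (simp add: pe_def)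
  \<comment> \<open>\<open>C * fact (Suc l)\<close> comes from the upper bound for the derivative,
    \<open>c\<close> from the lower bound for the series, and 2 bounds the leftover factor
    \<open>s'\<close>.\<close>
  define M where "M = 2 * C * fact (Suc l) / c"
  have M: "0 < M" using c C0 by (simp add: M_def)
  show ?thesis
  proof (intro exI[of _ M] conjI allI impI M)
    fix s s' :: real assume s: "1 < s'" "s' < s" "s' \<le> 2"
    have s1: "1 < s" using s by simp
    let ?X = "\<lambda>s. \<Sum>n. a n / s ^ n"
    have sm: "summable (\<lambda>n. a n / s ^ n)" "summable (\<lambda>n. a n / s' ^ n)"
      by (rule discounted_upper(1)[of _ a C l]; use a0 C s s1 C0 in \<open>auto intro: less_imp_le\<close>)+
    have term_le: "a n / s' ^ n - a n / s ^ n \<le> (s - s') * (real n * a n / s' ^ n)" for n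
    proof -
      \<comment> \<open>Bernoulli's inequality replaces the mean value theorem:
        \<open>1 - (s' / s)^n\<close> is at most \<open>n (s - s') / s\<close>.\<close>
      have "1 + real n * (s' / s - 1) \<le> (1 + (s' / s - 1)) ^ n"
        by (rule Bernoulli_inequality) (use s in auto)
      then have "1 - (s' / s) ^ n \<le> real n * ((s - s') / s)" using s s1 by (simp add: field_simps)
      also have "\<dots> \<le> real n * ((s - s') / 1)" using s s1 by (intro mult_left_mono divide_left_mono) auto
      finally have "a n / s' ^ n * (1 - (s' / s) ^ n) \<le> a n / s' ^ n * (real n * (s - s'))"
        using a0[of n] s by (intro mult_left_mono) auto
      moreover have "a n / s' ^ n * (1 - (s' / s) ^ n) = a n / s' ^ n - a n / s ^ n"
        using s by (simp add: power_divide right_diff_distrib)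
      ultimately show ?thesis by (simp add: mult_ac)
    qed
    have na: "real n * a n \<le> C * pe 1 (Suc l) n" for n
    proof -
      have "real n * a n \<le> real (Suc n) * (C * pe 1 l n)"
        using a0[of n] C by (intro mult_mono) (auto intro: less_imp_le)
      then show ?thesis by (simp add: pe_def mult_ac)
    qed
    have na0: "0 \<le> real n * a n" for n using a0[of n] by simp
    note up = discounted_upper[OF s(1) na0 na less_imp_le[OF C0]]
    have "?X s' - ?X s = (\<Sum>n. a n / s' ^ n - a n / s ^ n)" by (rule suminf_diff[OF sm(2,1)])
    also have "\<dots> \<le> (\<Sum>n. (s - s') * (real n * a n / s' ^ n))"
      by (rule suminf_le[OF term_le]) (intro summable_diff sm summable_mult up)+
    also have "\<dots> = (s - s') * (\<Sum>n. real n * a n / s' ^ n)" by (rule suminf_mult[OF up(1)])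
    also have "\<dots> \<le> (s - s') * (C * (fact (Suc l) * (s' / (s' - 1)) ^ Suc (Suc l)))"
      using s by (intro mult_left_mono up) auto
    also have "\<dots> = (s - s') * (C * fact (Suc l) / c * (s' / (s' - 1))) * (c * (s' / (s' - 1)) ^ Suc l)"
      using c by simp
    also have "\<dots> \<le> (s - s') * (C * fact (Suc l) / c * (s' / (s' - 1))) * ?X s'"
      using s c C0 by (intro mult_left_mono discounted_lower[OF s(1) c(2) _ sm(2)]) auto
    also have "\<dots> \<le> (s - s') * (C * fact (Suc l) / c * (2 / (s' - 1))) * ?X s'"
    proof (intro mult_right_mono mult_left_mono)
      show "0 \<le> ?X s'" by (rule suminf_nonneg[OF sm(2)]) (use a0 s in \<open>auto intro: less_imp_le\<close>)
    qed (use s c C0 in \<open>auto intro: divide_right_mono\<close>)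
    also have "\<dots> = ?X s' * (M * ((s - s') / (s' - 1)))" by (simp add: M_def)
    finally show "?X s' * (1 - M * ((s - s') / (s' - 1))) \<le> ?X s" by (simp add: right_diff_distrib)
  qed
qed

subsection \<open>Iterating a minimum of nonnegative linear maps\<close>

definition minop :: "'a set \<Rightarrow> ('a \<Rightarrow> ('a \<Rightarrow> real) set) \<Rightarrow> ('a \<Rightarrow> real) \<Rightarrow> 'a \<Rightarrow> real" where
  "minop T R x i = (MIN a\<in>R i. \<Sum>j\<in>T. a j * x j)"

lemma minop_le: "row_system T R \<Longrightarrow> i \<in> T \<Longrightarrow> a \<in> R i \<Longrightarrow> minop T R x i \<le> (\<Sum>j\<in>T. a j * x j)"
  unfolding minop_def by (rule Min_le) (auto simp: row_system_def)

lemma minop_ge: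
  "row_system T R \<Longrightarrow> i \<in> T \<Longrightarrow> (\<And>a. a \<in> R i \<Longrightarrow> y \<le> (\<Sum>j\<in>T. a j * x j)) \<Longrightarrow> y \<le> minop T R x i"
  unfolding minop_def by (subst Min_ge_iff) (auto simp: row_system_def)

lemma minop_mono:
  assumes "row_system T R" "\<And>j. j \<in> T \<Longrightarrow> x j \<le> y j" "i \<in> T"
  shows "minop T R x i \<le> minop T R y i"
proof (rule minop_ge[OF assms(1,3)])
  fix a assume a: "a \<in> R i"
  have "minop T R x i \<le> (\<Sum>j\<in>T. a j * x j)" by (rule minop_le[OF assms(1,3) a])
  also have "\<dots> \<le> (\<Sum>j\<in>T. a j * y j)"
    by (intro sum_mono mult_left_mono assms(2)) (use assms a in \<open>auto simp: row_system_def\<close>)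
  finally show "minop T R x i \<le> (\<Sum>j\<in>T. a j * y j)" .
qed

lemma minop_cmult_ge:
  assumes "row_system T R" "i \<in> T" "0 \<le> c"
  shows "c * minop T R x i \<le> minop T R (\<lambda>j. c * x j) i"
proof (rule minop_ge[OF assms(1,2)])
  fix a assume "a \<in> R i"
  from mult_left_mono[OF minop_le[OF assms(1,2) this, of x] assms(3)]
  show "c * minop T R x i \<le> (\<Sum>j\<in>T. a j * (c * x j))" by (simp add: sum_distrib_left mult_ac)
qed

lemma minop_iter_le_it:
  assumes rs: "row_system T R" and D: "policy T R D" and x: "\<And>j. j \<in> T \<Longrightarrow> x j \<le> y j" and i: "i \<in> T"
  shows "(minop T R ^^ n) x i \<le> it T D n y i"
  using i
proof (induction n arbitrary: i)
  case 0
  then show ?case using x by simp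
next
  case (Suc n)
  have "(minop T R ^^ Suc n) x i \<le> (\<Sum>j\<in>T. D i j * (minop T R ^^ n) x j)"
    using minop_le[OF rs Suc.prems, of "D i"] D Suc.prems by (simp add: policy_def)
  also have "\<dots> \<le> it T D (Suc n) y i" unfolding it_Suc
    by (intro sum_mono mult_left_mono Suc.IH nonneg_onD[OF policy_nonneg_on[OF rs D]]) (use Suc.prems in auto)
  finally show ?case .
qed

text \<open>The positive start dominates a multiple of \<open>u n0\<close>, and monotonicity carries
  the domination along. The inequality for \<open>u\<close> is needed only from \<open>n0\<close>
  on, at the price of an index shift.\<close>

lemma minop_iter_ge_sub:
  assumes rs: "row_system T R" and x: "\<And>j. j \<in> T \<Longrightarrow> 0 < x j"
    and u: "\<And>n i. n \<ge> n0 \<Longrightarrow> i \<in> T \<Longrightarrow> u (Suc n) i \<le> minop T R (u n) i"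
  shows "\<exists>c>0. \<forall>n. \<forall>i\<in>T. c * u (n0 + n) i \<le> (minop T R ^^ n) x i"
proof -
  have fin: "finite T" using rs by (simp add: row_system_def)
  obtain K where K: "K > 0" "\<forall>i\<in>T. u n0 i / x i \<le> K" using finite_upper[OF fin, of "\<lambda>i. u n0 i / x i"] by blast
  have "1 / K * u (n0 + n) i \<le> (minop T R ^^ n) x i" if "i \<in> T" for n i
    using that
  proof (induction n arbitrary: i)
    case 0
    then have "u n0 i \<le> K * x i" using K x[OF 0] by (auto simp: pos_divide_le_eq)
    then show ?case using K by (simp add: pos_divide_le_eq mult.commute)
  next
    case (Suc n)
    have "1 / K * u (n0 + Suc n) i \<le> 1 / K * minop T R (u (n0 + n)) i"
      using K u[of "n0 + n" i] Suc.prems by (intro mult_left_mono) auto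
    also have "\<dots> \<le> minop T R (\<lambda>j. 1 / K * u (n0 + n) j) i"
      by (rule minop_cmult_ge[OF rs Suc.prems]) (use K in auto)
    also have "\<dots> \<le> minop T R ((minop T R ^^ n) x) i" by (rule minop_mono[OF rs Suc.IH Suc.prems])
    finally show ?case by simp
  qed
  then show ?thesis using K by (intro exI[of _ "1 / K"]) auto
qed

text \<open>The vector is a limit of \<open>(s - 1) x(s)\<close>, where \<open>x(s)\<close> is the optimal value of the problem
  discounted by \<open>1 / s\<close>, as \<open>s\<close> decreases to 1.\<close>

lemma subinvariant_vector:
  assumes rs: "row_system T R"
    and low: "\<And>D i. policy T R D \<Longrightarrow> i \<in> T \<Longrightarrow> growth_le (pe 1 0) (\<lambda>n. it T D n (\<lambda>_. 1) i)"
    and B: "policy T R B" "\<And>i. i \<in> T \<Longrightarrow> growth_le (\<lambda>n. it T B n (\<lambda>_. 1) i) (pe 1 0)"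
  shows "\<exists>w. (\<forall>i\<in>T. 0 < w i) \<and> (\<forall>i\<in>T. \<forall>a\<in>R i. w i \<le> (\<Sum>j\<in>T. a j * w j))"
proof -
  have fin: "finite T" using rs by (simp add: row_system_def)
  \<comment> \<open>The optimal policy will change with the discount, so the lower constant has to
    be uniform over the finitely many policies.\<close>
  have "\<exists>c>0. \<forall>D\<in>PiE T R. \<forall>n. \<forall>i\<in>T. c * pe 1 0 n \<le> it T D n (\<lambda>_. 1) i"
  proof (rule finite_uniform_small[OF finite_policies[OF rs]])
    fix D assume D: "D \<in> PiE T R"
    have "\<exists>c>0. \<forall>n. c * pe 1 0 n \<le> it T D n (\<lambda>_. 1) i" if "i \<in> T" for i
      by (rule it_lower_of_growth[OF fin policy_nonneg_on[OF rs policy_PiE[OF D]] _ that low[OF policy_PiE[OF D] that]]) auto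
    then have "\<exists>c>0. \<forall>i\<in>T. \<forall>n. c * pe 1 0 n \<le> it T D n (\<lambda>_. 1) i"
      by (intro finite_uniform_small[OF fin]) (auto simp: pe_def intro: order_trans)
    then show "\<exists>c>0. \<forall>n. \<forall>i\<in>T. c * pe 1 0 n \<le> it T D n (\<lambda>_. 1) i" by blast
  qed (auto simp: pe_def intro: order_trans)
  then obtain c where c: "c > 0" "\<And>D n i. D \<in> PiE T R \<Longrightarrow> i \<in> T \<Longrightarrow> c * pe 1 0 n \<le> it T D n (\<lambda>_. 1) i"
    by blast
  have low': "c * pe 1 0 n \<le> it T D n (\<lambda>_. 1) i" if "policy T R D" "i \<in> T" for D n i
    using c(2)[where D = "restrict D T" and i = i and n = n] that policy_restrict[of T R D] by (simp add: it_restrict)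
  have "\<exists>q>0. \<forall>n. it T B n (\<lambda>_. 1) i \<le> q * pe 1 0 n" if "i \<in> T" for i
    by (rule growth_le_all[OF B(2)[OF that]]) (simp add: pe_def)
  then have "\<exists>C>0. \<forall>i\<in>T. \<forall>n. it T B n (\<lambda>_. 1) i \<le> C * pe 1 0 n"
    by (intro finite_uniform[OF fin]) (auto simp: pe_def intro: order_trans)
  then obtain C where C: "C > 0" "\<And>i n. i \<in> T \<Longrightarrow> it T B n (\<lambda>_. 1) i \<le> C * pe 1 0 n" by blast
  have nn: "0 \<le> it T D n (\<lambda>_. 1) i" if "policy T R D" "i \<in> T" for D n i
    by (rule it_nonneg[OF policy_nonneg_on[OF rs that(1)] _ that(2)]) auto
  define s where "s n = 1 + 1 / real (Suc n)" for n
  have s: "1 < s n" "s n \<le> 2" for n by (auto simp: s_def)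
  have smB: "dsummable T B (\<lambda>_. 1) (s n)" for n
    unfolding dsummable_def using discounted_upper(1)[OF s(1) nn C(2)] B(1) C(1) by auto
  have "\<exists>A. optimal T R (\<lambda>_. 1) (s n) A" for n
    by (rule optimal_policy[OF rs _ _ B(1) smB]) (use s[of n] in auto)
  then obtain A where opt: "\<And>n. optimal T R (\<lambda>_. 1) (s n) (A n)" by metis
  have A: "policy T R (A n)" "dsummable T (A n) (\<lambda>_. 1) (s n)"
    "i \<in> T \<Longrightarrow> a \<in> R i \<Longrightarrow> dsum T (A n) (\<lambda>_. 1) (s n) i \<le> 1 + (\<Sum>j\<in>T. a j * dsum T (A n) (\<lambda>_. 1) (s n) j) / s n"
    "i \<in> T \<Longrightarrow> dsum T (A n) (\<lambda>_. 1) (s n) i \<le> dsum T B (\<lambda>_. 1) (s n) i" for n i a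
    using opt[of n] B(1) smB unfolding optimal_def by simp_all
  \<comment> \<open>The factor \<open>s - 1\<close> normalizes a singularity of order one. The
    constant \<open>c\<close> bounds \<open>y\<close> from below whichever policy is optimal, and
    comparison with the value of \<open>B\<close> bounds it from above.\<close>
  define y where "y n i = (s n - 1) * dsum T (A n) (\<lambda>_. 1) (s n) i" for n i
  have ylow: "c \<le> y n i" if i: "i \<in> T" for n i
  proof -
    have "c * (s n / (s n - 1)) ^ Suc 0 \<le> dsum T (A n) (\<lambda>_. 1) (s n) i"
      unfolding dsum_def
      by (rule discounted_lower[OF s(1) low'[OF A(1) i]]) (use c(1) A(2) i in \<open>auto simp: dsummable_def\<close>)
    then have "(s n - 1) * (c * (s n / (s n - 1)) ^ Suc 0) \<le> y n i"
      unfolding y_def using s(1)[of n] by (intro mult_left_mono) auto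
    then have "c * s n \<le> y n i" using s(1)[of n] by simp
    moreover have "c * 1 \<le> c * s n" using c(1) s(1)[of n] by (intro mult_left_mono) auto
    ultimately show ?thesis by simp
  qed
  have yup: "y n i \<le> 2 * C" if i: "i \<in> T" for n i
  proof -
    have "dsum T B (\<lambda>_. 1) (s n) i \<le> C * (fact 0 * (s n / (s n - 1)) ^ Suc 0)"
      unfolding dsum_def by (rule discounted_upper(2)[OF s(1) nn[OF B(1) i] C(2)[OF i]]) (use C in auto)
    then have "y n i \<le> (s n - 1) * (C * (fact 0 * (s n / (s n - 1)) ^ Suc 0))"
      unfolding y_def using s(1)[of n] A(4)[OF i, of n] by (intro mult_left_mono) auto
    also have "\<dots> = C * s n" using s(1)[of n] by simp
    also have "\<dots> \<le> C * 2" using C(1) s(2)[of n] by (intro mult_left_mono) auto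
    finally show ?thesis by simp
  qed
  have "\<exists>b. \<forall>n. \<bar>y n i\<bar> \<le> b" if "i \<in> T" for i
  proof (intro exI[of _ "2 * C"] allI)
    fix n show "\<bar>y n i\<bar> \<le> 2 * C" using ylow[OF that, of n] yup[OF that, of n] c(1) by linarith
  qed
  then obtain r w where r: "strict_mono r" "\<And>i. i \<in> T \<Longrightarrow> (\<lambda>n. y (r n) i) \<longlonglongrightarrow> w i"
    using finite_convergent_subsequence[OF fin, of y] by blast
  have "(\<lambda>n. 1 / real (Suc n)) \<longlonglongrightarrow> 0" by (rule LIMSEQ_inverse_real_of_nat[unfolded inverse_eq_divide])
  from LIMSEQ_subseq_LIMSEQ[OF this r(1)] have z: "(\<lambda>n. 1 / real (Suc (r n))) \<longlonglongrightarrow> 0" by (simp add: o_def)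
  have slim: "(\<lambda>n. s (r n)) \<longlonglongrightarrow> 1" unfolding s_def using tendsto_add[OF tendsto_const[of 1] z] by simp
  show ?thesis
  proof (intro exI[of _ w] conjI ballI)
    fix i assume i: "i \<in> T"
    have "c \<le> w i" by (rule LIMSEQ_le_const[OF r(2)[OF i]]) (use ylow[OF i] in blast)
    then show "0 < w i" using c(1) by simp
  next
    fix i a assume i: "i \<in> T" and a: "a \<in> R i"
    \<comment> \<open>The literal limit of the Bellman inequality multiplied by
      \<open>s - 1\<close>: the running cost 1 becomes \<open>s - 1\<close> and disappears.\<close>
    have "w i \<le> (1 - 1) + (\<Sum>j\<in>T. a j * w j) / 1"
    proof (rule LIMSEQ_le[OF r(2)[OF i]])
      show "(\<lambda>n. (s (r n) - 1) + (\<Sum>j\<in>T. a j * y (r n) j) / s (r n)) \<longlonglongrightarrow> (1 - 1) + (\<Sum>j\<in>T. a j * w j) / 1"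
        by (intro tendsto_intros slim r) auto
      show "\<exists>N. \<forall>n\<ge>N. y (r n) i \<le> (s (r n) - 1) + (\<Sum>j\<in>T. a j * y (r n) j) / s (r n)"
      proof (intro exI allI impI)
        fix n
        have "y (r n) i \<le> (s (r n) - 1) * (1 + (\<Sum>j\<in>T. a j * dsum T (A (r n)) (\<lambda>_. 1) (s (r n)) j) / s (r n))"
          unfolding y_def using s(1)[of "r n"] A(3)[OF i a, of "r n"] by (intro mult_left_mono) auto
        also have "\<dots> = (s (r n) - 1) + (\<Sum>j\<in>T. a j * y (r n) j) / s (r n)"
          unfolding y_def by (simp add: distrib_left sum_distrib_left mult_ac)
        finally show "y (r n) i \<le> (s (r n) - 1) + (\<Sum>j\<in>T. a j * y (r n) j) / s (r n)" .
      qed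
    qed
    then show "w i \<le> (\<Sum>j\<in>T. a j * w j)" by simp
  qed
qed

lemma dsummable_upper:
  assumes "nonneg_on T D" "\<And>j. j \<in> T \<Longrightarrow> 0 < z j" "1 < s" "i \<in> T"
    and "growth_le (\<lambda>n. it T D n z i) (pe 1 l)"
  shows "summable (\<lambda>m. it T D m z i / s ^ m)"
proof -
  obtain C where C: "C > 0" "\<forall>n. it T D n z i \<le> C * pe 1 l n"
    using growth_le_all[OF assms(5)] pe_pos by auto
  show ?thesis
    by (rule discounted_upper(1)[OF assms(3), of _ C l])
      (use C it_nonneg[OF assms(1) _ assms(4), of z] assms(2) in \<open>auto intro: less_imp_le\<close>)
qed

text \<open>By \<open>low\<close> all rates are at least 1. If some rate exceeds 1, the series
  diverges for \<open>s\<close> close to 1 and a large \<open>M\<close> makes the claim vacuous. If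
  all rates equal 1, \<open>discounted_variation\<close> applies with the actual degrees of
  \<open>D\<close>, which may exceed \<open>l\<close>.\<close>

lemma policy_variation:
  assumes fin: "finite T" and nn: "nonneg_on T D" and z: "\<And>j. j \<in> T \<Longrightarrow> 0 < z j"
    and low: "\<And>i. i \<in> T \<Longrightarrow> growth_le (pe 1 (l i)) (\<lambda>n. it T D n z i)"
  shows "\<exists>M>0. \<forall>s s'. 1 < s' \<longrightarrow> s' < s \<longrightarrow> s < 1 + 1 / M \<longrightarrow> dsummable T D z s \<longrightarrow>
     dsummable T D z s' \<and> (\<forall>i\<in>T. dsum T D z s' i * (1 - M * ((s - s') / (s' - 1))) \<le> dsum T D z s i)"
proof -
  have "\<exists>t. 0 \<le> fst t \<and> growth_eq (\<lambda>n. it T D n z i) (pt t)" if "i \<in> T" for i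
    by (rule growth_type_exists[OF fin nn z that])
  then obtain ty where ty: "\<And>i. i \<in> T \<Longrightarrow> 0 \<le> fst (ty i)" "\<And>i. i \<in> T \<Longrightarrow> growth_eq (\<lambda>n. it T D n z i) (pt (ty i))"
    by metis
  have ge1: "1 \<le> fst (ty i)" if "i \<in> T" for i
  proof -
    have "growth_le (pe 1 (l i)) (pt (ty i))"
      using low[OF that] ty(2)[OF that] unfolding growth_eq_def by (blast intro: growth_le_trans)
    then have "1 < fst (ty i) \<or> 1 = fst (ty i) \<and> l i \<le> snd (ty i)"
      by (rule pe_dom_strict) (use ty(1)[OF that] in auto)
    then show ?thesis by linarith
  qed
  have lower: "\<exists>c>0. \<forall>n. c * pt (ty i) n \<le> it T D n z i" if "i \<in> T" for i
    by (rule it_lower_of_growth[OF fin nn z that])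
      (use ty(2)[OF that] ge1[OF that] in \<open>auto simp: growth_eq_def\<close>)
  show ?thesis
  proof (cases "\<forall>i\<in>T. fst (ty i) = 1")
    case False
    then obtain i where i: "i \<in> T" "1 < fst (ty i)" using ge1 by force
    obtain c where c: "c > 0" "\<forall>n. c * pt (ty i) n \<le> it T D n z i" using lower[OF i(1)] by blast
    have no: "\<not> dsummable T D z s" if "1 < s" "s < fst (ty i)" for s
    proof
      assume "dsummable T D z s"
      then have "(\<lambda>m. it T D m z i / s ^ m) \<longlonglongrightarrow> 0" using i(1) summable_LIMSEQ_zero by (auto simp: dsummable_def)
      moreover have "c \<le> it T D m z i / s ^ m" for m
      proof -
        have "c * (1 * s ^ m) \<le> c * pt (ty i) m" unfolding pe_def using c(1) that
          by (intro mult_left_mono mult_mono power_mono one_le_power) auto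
        also have "\<dots> \<le> it T D m z i" using c(2) by blast
        finally show ?thesis using that by (simp add: pos_le_divide_eq)
      qed
      ultimately have "c \<le> 0" by (intro LIMSEQ_le_const) auto
      then show False using c(1) by simp
    qed
    \<comment> \<open>With this \<open>M\<close>, the bound \<open>1 + 1 / M\<close> is exactly the
      rate of state \<open>i\<close>, below which the series diverges.\<close>
    show ?thesis
      by (rule exI[of _ "1 / (fst (ty i) - 1)"]) (use no i(2) in auto)
  next
    case True
    have ex: "\<exists>M>0. \<forall>s s'. 1 < s' \<longrightarrow> s' < s \<longrightarrow> s' \<le> 2 \<longrightarrow>
        dsum T D z s' i * (1 - M * ((s - s') / (s' - 1))) \<le> dsum T D z s i" if i: "i \<in> T" for i
    proof -
      obtain c where c: "c > 0" "\<forall>n. c * pe 1 (snd (ty i)) n \<le> it T D n z i" using lower[OF i] True i by auto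
      obtain C where C: "C > 0" "\<forall>n. it T D n z i \<le> C * pe 1 (snd (ty i)) n"
        using growth_le_all[of "\<lambda>n. it T D n z i" "pt (ty i)"] ty(2)[OF i] True i pe_pos[of 1]
        by (auto simp: growth_eq_def)
      show ?thesis unfolding dsum_def
        by (rule discounted_variation[of c "snd (ty i)" _ C]) (use c C in auto)
    qed
    have "\<exists>M>0. \<forall>i\<in>T. \<forall>s s'. 1 < s' \<longrightarrow> s' < s \<longrightarrow> s' \<le> 2 \<longrightarrow>
        dsum T D z s' i * (1 - M * ((s - s') / (s' - 1))) \<le> dsum T D z s i"
    proof (rule finite_uniform[OF fin ex], assumption, intro allI impI)
      fix i M M' s s'
      assume i: "i \<in> T" and le: "M \<le> M'" and s: "1 < (s' :: real)" "s' < s" "s' \<le> 2"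
        and *: "\<forall>s s'. 1 < s' \<longrightarrow> s' < s \<longrightarrow> s' \<le> 2 \<longrightarrow>
          dsum T D z s' i * (1 - M * ((s - s') / (s' - 1))) \<le> dsum T D z s i"
      have "0 \<le> dsum T D z s' i" unfolding dsum_def
      proof (rule suminf_nonneg)
        show "summable (\<lambda>m. it T D m z i / s' ^ m)"
          by (rule dsummable_upper[OF nn z s(1) i, where l = "snd (ty i)"])
            (use ty(2)[OF i] True i in \<open>auto simp: growth_eq_def\<close>)
        show "0 \<le> it T D n z i / s' ^ n" for n
          using it_nonneg[OF nn less_imp_le[OF z] i, where n = n] s by simp
      qed
      then have "dsum T D z s' i * (1 - M' * ((s - s') / (s' - 1))) \<le> dsum T D z s' i * (1 - M * ((s - s') / (s' - 1)))"
        using s le by (intro mult_left_mono diff_left_mono mult_right_mono) auto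
      also have "\<dots> \<le> dsum T D z s i" using * s by blast
      finally show "dsum T D z s' i * (1 - M' * ((s - s') / (s' - 1))) \<le> dsum T D z s i" .
    qed
    then obtain M where M: "M > 0" "\<forall>i\<in>T. \<forall>s s'. 1 < s' \<longrightarrow> s' < s \<longrightarrow> s' \<le> 2 \<longrightarrow>
        dsum T D z s' i * (1 - M * ((s - s') / (s' - 1))) \<le> dsum T D z s i" by blast
    have sm: "dsummable T D z s'" if "1 < s'" for s'
      unfolding dsummable_def
    proof
      fix i assume i: "i \<in> T"
      show "summable (\<lambda>m. it T D m z i / s' ^ m)"
        by (rule dsummable_upper[OF nn z that i, where l = "snd (ty i)"])
          (use ty(2)[OF i] True i in \<open>auto simp: growth_eq_def\<close>)
    qed
    \<comment> \<open>The maximum with 1 keeps \<open>s\<close> below 2, as the range of validity of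
      \<open>M\<close> demands.\<close>
    have mono: "dsum T D z s' i * (1 - max 1 M * ((s - s') / (s' - 1))) \<le> dsum T D z s i"
      if "i \<in> T" "1 < s'" "s' < s" "s < 1 + 1 / max 1 M" for i s s'
    proof -
      have "0 \<le> dsum T D z s' i" unfolding dsum_def
      proof (rule suminf_nonneg)
        show "summable (\<lambda>m. it T D m z i / s' ^ m)" using sm[OF that(2)] that(1) by (simp add: dsummable_def)
        show "0 \<le> it T D n z i / s' ^ n" for n
          using it_nonneg[OF nn less_imp_le[OF z] that(1), where n = n] that(2) by simp
      qed
      then have "dsum T D z s' i * (1 - max 1 M * ((s - s') / (s' - 1))) \<le> dsum T D z s' i * (1 - M * ((s - s') / (s' - 1)))"
        using that by (intro mult_left_mono diff_left_mono mult_right_mono) auto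
      also have "\<dots> \<le> dsum T D z s i"
      proof -
        have "1 / max 1 M \<le> 1" by simp
        then have "s' \<le> 2" using that by linarith
        then show ?thesis using M that by blast
      qed
      finally show ?thesis .
    qed
    show ?thesis
      by (rule exI[of _ "max 1 M"]) (use sm mono in auto)
  qed
qed

text \<open>In \<open>(n + 1 + q) (n - q) = n^2 + n - (q + q^2)\<close> the terms \<open>q n\<close>
  cancel, because the same \<open>q\<close> is the parameter of the discount and the variation
  constant of \<open>x\<close>. The surplus \<open>n\<close> then outweighs the relative loss
  \<open>H / n^2\<close> once \<open>n\<close> is large.\<close>

lemma key_inequality:
  fixes n q H x x' :: real
  assumes q: "0 < q" and H: "0 \<le> H" and n: "1 \<le> n" "q + q^2 + 2 * H \<le> n"
    and x: "0 \<le> x" and x': "x' * (1 - q / n) \<le> x"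
  shows "q / (n + 1 + q) * x' \<le> q / n * ((1 - H / n^2) * x)"
proof -
  have nq: "0 < n - q" using n(2) q H by (smt (verit) zero_less_power)
  have "x' * ((n - q) / n) \<le> x" using x' n by (simp add: diff_divide_distrib)
  then have "x' \<le> x * (n / (n - q))" using nq n by (simp add: field_simps)
  then have "q / (n + 1 + q) * x' \<le> q / (n + 1 + q) * (x * (n / (n - q)))" using q n by (intro mult_left_mono) auto
  also have "\<dots> = q * x * (n / ((n + 1 + q) * (n - q)))" by simp
  also have "\<dots> \<le> q * x * ((n^2 - H) / n^3)"
  proof (rule mult_left_mono)
    have "n * n^3 \<le> (n^2 - H) * ((n + 1 + q) * (n - q))"
    proof -
      have "(n^2 - H) * ((n + 1 + q) * (n - q)) - n * n^3 = n^2 * (n - (q + q^2) - H) - H * n + H * (q + q^2)"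
        by (simp add: algebra_simps power2_eq_square power3_eq_cube)
      moreover have "n^2 * H \<le> n^2 * (n - (q + q^2) - H)" using n by (intro mult_left_mono) auto
      moreover have "n * H \<le> n^2 * H" using n H by (intro mult_right_mono) (auto simp: power2_eq_square)
      moreover have "0 \<le> H * (q + q^2)" using H q by simp
      ultimately show ?thesis by (simp add: mult.commute)
    qed
    then show "n / ((n + 1 + q) * (n - q)) \<le> (n^2 - H) / n^3"
    proof -
      assume le: "n * n^3 \<le> (n^2 - H) * ((n + 1 + q) * (n - q))"
      have P: "0 < (n + 1 + q) * (n - q)" using n q nq by simp
      have "n * n^3 / n^3 \<le> (n^2 - H) * ((n + 1 + q) * (n - q)) / n^3"
        using le n by (intro divide_right_mono) auto
      then have "n \<le> (n^2 - H) / n^3 * ((n + 1 + q) * (n - q))" using n by simp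
      then show ?thesis using P by (simp only: pos_divide_le_eq)
    qed
  qed (use q x in auto)
  also have "\<dots> = q / n * ((1 - H / n^2) * x)" using n by (simp add: field_simps power2_eq_square power3_eq_cube)
  finally show ?thesis .
qed

text \<open>The sequence is \<open>u n = (s n - 1) / s n * x (s n)\<close> with \<open>s n = 1 + q / n\<close>, where \<open>x s\<close> is the
  optimal value of the problem discounted by \<open>1 / s\<close>. It satisfies \<open>f (u n) \<ge> u (Suc n)\<close> because
  \<open>f (x s) = s (x s - z)\<close> and \<open>x\<close> varies slowly enough once \<open>q\<close> is large.\<close>

lemma subsolution_above_first_level:
  assumes rs: "row_system T R" and z: "\<And>j. j \<in> T \<Longrightarrow> 0 < z j"
    and id: "\<And>i. i \<in> T \<Longrightarrow> l i = 0 \<Longrightarrow> R i = {\<lambda>j. if j = i then 1 else 0}"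
    and low: "\<And>D i. policy T R D \<Longrightarrow> i \<in> T \<Longrightarrow> growth_le (pe 1 (l i)) (\<lambda>n. it T D n z i)"
    and B: "policy T R B" "\<And>i. i \<in> T \<Longrightarrow> growth_le (\<lambda>n. it T B n z i) (pe 1 (l i))"
  shows "\<exists>u c n0. 0 < c \<and> (\<forall>n\<ge>n0. \<forall>i\<in>T. c * pe 1 (l i) n \<le> u n i) \<and>
    (\<forall>n\<ge>n0. \<forall>i\<in>T. l i = 0 \<longrightarrow> u n i = z i) \<and>
    (\<forall>n\<ge>n0. \<forall>i\<in>T. l i \<noteq> 0 \<longrightarrow> (\<forall>a\<in>R i. u (Suc n) i \<le> (\<Sum>j\<in>T. a j * u n j)))"
proof -
  have fin: "finite T" using rs by (simp add: row_system_def)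
  have "\<exists>c>0. \<forall>D\<in>PiE T R. \<forall>i\<in>T. \<forall>n. c * pe 1 (l i) n \<le> it T D n z i"
  proof (rule finite_uniform_small[OF finite_policies[OF rs]])
    fix D assume D: "D \<in> PiE T R"
    have "\<exists>c>0. \<forall>n. c * pe 1 (l i) n \<le> it T D n z i" if "i \<in> T" for i
      by (rule it_lower_of_growth[OF fin policy_nonneg_on[OF rs policy_PiE[OF D]] z that low[OF policy_PiE[OF D] that]]) auto
    then show "\<exists>c>0. \<forall>i\<in>T. \<forall>n. c * pe 1 (l i) n \<le> it T D n z i"
    proof (intro finite_uniform_small[OF fin])
      fix i q q' assume "\<forall>n. q * pe 1 (l i) n \<le> it T D n z i" "q' \<le> (q :: real)"
      then show "\<forall>n. q' * pe 1 (l i) n \<le> it T D n z i"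
        by (meson mult_right_mono order_trans pe_nonneg zero_le_one)
    qed
  next
    fix D and q q' :: real assume "\<forall>i\<in>T. \<forall>n. q * pe 1 (l i) n \<le> it T D n z i" "q' \<le> q"
    then show "\<forall>i\<in>T. \<forall>n. q' * pe 1 (l i) n \<le> it T D n z i"
      by (meson mult_right_mono order_trans pe_nonneg zero_le_one)
  qed
  then obtain c where c: "c > 0" "\<And>D i n. D \<in> PiE T R \<Longrightarrow> i \<in> T \<Longrightarrow> c * pe 1 (l i) n \<le> it T D n z i"
    by blast
  have low': "c * pe 1 (l i) n \<le> it T D n z i" if "policy T R D" "i \<in> T" for D n i
    using c(2)[where D = "restrict D T" and i = i and n = n] that policy_restrict[of T R D] by (simp add: it_restrict)
  have dlow: "c * (s / (s - 1)) ^ Suc (l i) \<le> dsum T D z s i"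
    if "policy T R D" "i \<in> T" "1 < s" "dsummable T D z s" for D i s
    unfolding dsum_def
    by (rule discounted_lower[OF that(3) low'[OF that(1,2)]]) (use c(1) that in \<open>auto simp: dsummable_def\<close>)
  let ?V = "\<lambda>D M. \<forall>s s'. 1 < s' \<longrightarrow> s' < s \<longrightarrow> s < 1 + 1 / M \<longrightarrow> dsummable T D z s \<longrightarrow>
     dsummable T D z s' \<and> (\<forall>i\<in>T. dsum T D z s' i * (1 - M * ((s - s') / (s' - 1))) \<le> dsum T D z s i)"
  have "\<exists>M>0. \<forall>D\<in>PiE T R. 0 < M \<and> ?V D M"
  proof (rule finite_uniform[OF finite_policies[OF rs]])
    fix D assume D: "D \<in> PiE T R"
    have "\<exists>M>0. ?V D M"
      by (rule policy_variation[OF fin policy_nonneg_on[OF rs policy_PiE[OF D]] z low[OF policy_PiE[OF D]]])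
    then show "\<exists>M>0. 0 < M \<and> ?V D M" by blast
  next
    fix D and q q' :: real assume D: "D \<in> PiE T R" and q: "0 < q \<and> ?V D q" "q \<le> q'"
    have "dsummable T D z s' \<and> (\<forall>i\<in>T. dsum T D z s' i * (1 - q' * ((s - s') / (s' - 1))) \<le> dsum T D z s i)"
      if s: "1 < s'" "s' < s" "s < 1 + 1 / q'" "dsummable T D z s" for s s'
    proof -
      have "1 / q' \<le> 1 / q" using q by (intro divide_left_mono) auto
      then have s2: "s < 1 + 1 / q" using s by linarith
      then have V: "dsummable T D z s'" "\<forall>i\<in>T. dsum T D z s' i * (1 - q * ((s - s') / (s' - 1))) \<le> dsum T D z s i"
        using q(1) s by blast+
      show ?thesis
      proof (intro conjI ballI V)
        fix i assume i: "i \<in> T"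
        have "0 \<le> c * (s' / (s' - 1)) ^ Suc (l i)" using c(1) s by simp
        then have "0 \<le> dsum T D z s' i" using dlow[OF policy_PiE[OF D] i s(1) V(1)] by linarith
        then have "dsum T D z s' i * (1 - q' * ((s - s') / (s' - 1))) \<le> dsum T D z s' i * (1 - q * ((s - s') / (s' - 1)))"
          using s q by (intro mult_left_mono diff_left_mono mult_right_mono) auto
        also have "\<dots> \<le> dsum T D z s i" using V(2) i by blast
        finally show "dsum T D z s' i * (1 - q' * ((s - s') / (s' - 1))) \<le> dsum T D z s i" .
      qed
    qed
    then show "0 < q' \<and> ?V D q'" using q by auto
  qed
  \<comment> \<open>One variation constant for all policies. The same \<open>q\<close> becomes the
    parameter of \<open>s n\<close>; the range condition \<open>s n < 1 + 1 / q\<close> then holds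
    as soon as \<open>n > q^2\<close>.\<close>
  then obtain q where q: "q > 0" "\<And>D. D \<in> PiE T R \<Longrightarrow> ?V D q" by blast
  have var: "dsummable T D z s' \<and> (\<forall>i\<in>T. dsum T D z s' i * (1 - q * ((s - s') / (s' - 1))) \<le> dsum T D z s i)"
    if "policy T R D" "1 < s'" "s' < s" "s < 1 + 1 / q" "dsummable T D z s" for D s s'
    using q(2)[of "restrict D T"] that policy_restrict[of T R D] by (simp add: dsummable_restrict dsum_restrict)
  have smB: "dsummable T B z s" if "1 < s" for s
    unfolding dsummable_def using dsummable_upper[OF policy_nonneg_on[OF rs B(1)] z that _ B(2)] by blast
  define s where "s n = 1 + q / real n" for n
  have s: "1 < s n" if "1 \<le> n" for n using that q by (simp add: s_def)
  have "\<exists>A. 1 \<le> n \<longrightarrow> optimal T R z (s n) A" for n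
    using optimal_policy[OF rs _ z B(1) smB[OF s[of n]]] s[of n] by (cases "1 \<le> n") auto
  then obtain A where opt: "\<And>n. 1 \<le> n \<Longrightarrow> optimal T R z (s n) (A n)" by metis
  define x where "x n i = dsum T (A n) z (s n) i" for n i
  define u where "u n i = (s n - 1) / s n * x n i" for n i
  have A: "policy T R (A n)" "dsummable T (A n) z (s n)"
    "i \<in> T \<Longrightarrow> a \<in> R i \<Longrightarrow> x n i \<le> z i + (\<Sum>j\<in>T. a j * x n j) / s n" if "1 \<le> n" for n i a
    using opt[OF that] unfolding optimal_def x_def by simp_all
  have xlow: "c * (s n / (s n - 1)) ^ Suc (l i) \<le> x n i" if "1 \<le> n" "i \<in> T" for n i
    unfolding x_def by (rule dlow[OF A(1)[OF that(1)] that(2) s[OF that(1)] A(2)[OF that(1)]])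
  have sq: "s n / (s n - 1) = (real n + q) / q" if "1 \<le> n" for n using that q by (simp add: s_def field_simps)
  have xpos: "0 < x n i" if "1 \<le> n" "i \<in> T" for n i
  proof -
    have "0 < c * (s n / (s n - 1)) ^ Suc (l i)" using c(1) s[OF that(1)] by simp
    then show ?thesis using xlow[OF that] by linarith
  qed
  obtain n1 where n1: "q * q < real n1" using reals_Archimedean2 by blast
  have xvar: "x (Suc n) i * (1 - q / real n) \<le> x n i" if n: "1 \<le> n" "n1 \<le> n" and i: "i \<in> T" for n i
  proof -
    have nn: "0 < real n" using n by simp
    have s': "1 < s (Suc n)" "s (Suc n) < s n" using q n by (auto simp: s_def field_simps)
    have "real n1 \<le> real n" using n by simp
    then have "q * q < real n" using n1 by linarith
    then have "s n < 1 + 1 / q" using q nn by (simp add: s_def field_simps)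
    note v = var[OF A(1)[OF n(1)] s' this A(2)[OF n(1)]]
    \<comment> \<open>The policy that is optimal at \<open>n\<close> is only a competitor at
      \<open>n + 1\<close>, so the variation of a single policy bounds the variation of the optimal
      value.\<close>
    have "x (Suc n) i \<le> dsum T (A n) z (s (Suc n)) i"
      using opt[of "Suc n"] A(1)[OF n(1)] v i unfolding optimal_def x_def by simp
    \<comment> \<open>\<open>q\<close> cancels in this ratio, which is why the variation constant
      could be fixed before the discounts were chosen.\<close>
    moreover have ratio: "(s n - s (Suc n)) / (s (Suc n) - 1) = 1 / real n"
    proof -
      have "q / real n - q / (real n + 1) = q / (real n * (real n + 1))" using nn by (simp add: field_simps)
      then have "s n - s (Suc n) = q / (real n * (real n + 1))" by (simp add: s_def add.commute)
      moreover have "s (Suc n) - 1 = q / (real n + 1)" by (simp add: s_def add.commute)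
      ultimately show ?thesis using q(1) nn by simp
    qed
    moreover have "dsum T (A n) z (s (Suc n)) i * (1 - q / real n) \<le> x n i"
      using v i unfolding ratio x_def by simp
    ultimately show ?thesis
    proof (cases "0 \<le> 1 - q / real n")
      case True
      have "x (Suc n) i * (1 - q / real n) \<le> dsum T (A n) z (s (Suc n)) i * (1 - q / real n)"
        using \<open>x (Suc n) i \<le> _\<close> True by (rule mult_right_mono)
      then show ?thesis using \<open>dsum T (A n) z (s (Suc n)) i * (1 - q / real n) \<le> x n i\<close> by linarith
    next
      case False
      then have "x (Suc n) i * (1 - q / real n) \<le> 0" using xpos[of "Suc n" i] i by (simp add: mult_le_0_iff)
      then show ?thesis using xpos[OF n(1) i] by linarith
    qed
  qed
  obtain K where K: "K > 0" "\<forall>i\<in>T. z i \<le> K" using finite_upper[OF fin, of z] by blast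
  \<comment> \<open>\<open>z i \<le> K\<close> and \<open>x n i \<ge> c (n / q)^2\<close> give
    \<open>z i \<le> (H / n^2) * x n i\<close>. The exponent 2 is available because
    \<open>l i \<noteq> 0\<close>.\<close>
  define H where "H = K * q^2 / c"
  have H: "0 \<le> H" using K q c by (simp add: H_def)
  obtain n2 where n2: "q + q^2 + 2 * H \<le> real n2" using real_arch_simple by blast
  have step: "u (Suc n) i \<le> (\<Sum>j\<in>T. a j * u n j)"
    if n: "1 \<le> n" "n1 \<le> n" "n2 \<le> n" and i: "i \<in> T" "l i \<noteq> 0" and a: "a \<in> R i" for n i a
  proof -
    have nn: "0 < real n" "1 \<le> real n" "q + q^2 + 2 * H \<le> real n" using n n2 by auto
    have "c * ((real n + q) / q) ^ 2 \<le> c * ((real n + q) / q) ^ Suc (l i)"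
      using c q nn i by (intro mult_left_mono power_increasing) auto
    also have "\<dots> \<le> x n i" using xlow[OF n(1) i(1)] unfolding sq[OF n(1)] .
    finally have x2: "c * ((real n + q) / q) ^ 2 \<le> x n i" .
    have "c * (real n / q) ^ 2 \<le> c * ((real n + q) / q) ^ 2"
      using c q nn by (intro mult_left_mono power_mono divide_right_mono) auto
    then have "c * (real n / q) ^ 2 \<le> x n i" using x2 by linarith
    then have "H / real n ^ 2 * (c * (real n / q) ^ 2) \<le> H / real n ^ 2 * x n i" using H by (intro mult_left_mono) auto
    moreover have "H / real n ^ 2 * (c * (real n / q) ^ 2) = K"
      using c q nn unfolding H_def by (simp add: power_divide)
    ultimately have zK: "z i \<le> H / real n ^ 2 * x n i" using K i by force
    have "s (Suc n) = (real n + 1 + q) / (real n + 1)" "s (Suc n) - 1 = q / (real n + 1)"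
      using nn by (simp_all add: s_def add_divide_distrib add.commute)
    then have "(s (Suc n) - 1) / s (Suc n) = q / (real n + 1 + q)" using nn by simp
    then have "u (Suc n) i = q / (real n + 1 + q) * x (Suc n) i" by (simp add: u_def)
    also have "\<dots> \<le> q / real n * ((1 - H / real n ^ 2) * x n i)"
      by (rule key_inequality[OF q(1) H nn(2,3)]) (use xpos[OF n(1) i(1)] xvar[OF n(1,2) i(1)] in auto)
    also have "\<dots> \<le> q / real n * (x n i - z i)"
      using zK q nn by (intro mult_left_mono) (auto simp: left_diff_distrib)
    also have "\<dots> = (s n - 1) * (x n i - z i)" by (simp add: s_def)
    also have "\<dots> \<le> (s n - 1) * ((\<Sum>j\<in>T. a j * x n j) / s n)"
      using A(3)[OF n(1) i(1) a] s[OF n(1)] by (intro mult_left_mono) auto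
    also have "\<dots> = (\<Sum>j\<in>T. a j * u n j)"
      unfolding u_def by (simp add: sum_distrib_left mult_ac sum_divide_distrib)
    finally show ?thesis .
  qed
  \<comment> \<open>An identity row gives \<open>x = z + x / s\<close>, that is
    \<open>x = s z / (s - 1)\<close>, which the factor \<open>(s - 1) / s\<close> in
    \<open>u\<close> turns into exactly \<open>z\<close>.\<close>
  have first: "u n i = z i" if n: "1 \<le> n" and i: "i \<in> T" "l i = 0" for n i
  proof -
    have "A n i = (\<lambda>j. if j = i then 1 else 0)" using A(1)[OF n] id[OF i] i by (auto simp: policy_def)
    then have "ap T (A n) (x n) i = x n i" using fin i by (simp add: ap_def if_distrib[of "\<lambda>t. t * _"] cong: if_cong)
    then have "x n i = z i + x n i / s n"
      using dsum_fixed_point[OF fin _ A(2)[OF n] i(1)] s[OF n] unfolding x_def by simp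
    then show ?thesis using s[OF n] by (simp add: u_def field_simps)
  qed
  \<comment> \<open>The factor \<open>(s - 1) / s\<close> lowers the order \<open>l i + 1\<close> of
    \<open>x\<close> to \<open>l i\<close>.\<close>
  have lower: "c / (2 * q) ^ l i * pe 1 (l i) n \<le> u n i" if n: "1 \<le> n" and i: "i \<in> T" for n i
  proof -
    have "c * ((real n + q) / q) ^ l i = (s n - 1) / s n * (c * (s n / (s n - 1)) ^ Suc (l i))"
      using s[OF n] unfolding sq[OF n, symmetric] by simp
    also have "\<dots> \<le> u n i" unfolding u_def using s[OF n] xlow[OF n i] by (intro mult_left_mono) auto
    finally have 1: "c * ((real n + q) / q) ^ l i \<le> u n i" .
    have "real (Suc n) / (2 * q) \<le> 2 * (real n + q) / (2 * q)" using n q by (intro divide_right_mono) auto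
    then have "real (Suc n) / (2 * q) \<le> (real n + q) / q" by (simp only: mult_divide_mult_cancel_left[of 2, simplified])
    then have "c * (real (Suc n) / (2 * q)) ^ l i \<le> c * ((real n + q) / q) ^ l i"
      using c q by (intro mult_left_mono power_mono) auto
    moreover have "c * (real (Suc n) / (2 * q)) ^ l i = c / (2 * q) ^ l i * pe 1 (l i) n"
      by (simp add: pe_def power_divide)
    ultimately show ?thesis using 1 by linarith
  qed
  obtain c' where c': "c' > 0" "\<forall>i\<in>T. c' \<le> c / (2 * q) ^ l i"
    using finite_lower[OF fin, of "\<lambda>i. c / (2 * q) ^ l i"] c q by auto
  have lower': "c' * pe 1 (l i) n \<le> u n i" if "1 \<le> n" "i \<in> T" for n i
  proof -
    have "c' * pe 1 (l i) n \<le> c / (2 * q) ^ l i * pe 1 (l i) n"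
      using c' that pe_nonneg[of 1 "l i" n] by (intro mult_right_mono) auto
    then show ?thesis using lower[OF that] by linarith
  qed
  show ?thesis
    by (rule exI[of _ u], rule exI[of _ c'], rule exI[of _ "max 1 (max n1 n2)"])
      (use c'(1) lower' first step in auto)
qed

section \<open>Gluing the states of one common rate\<close>

lemma edge_growth:
  assumes "finite S" "nonneg_on S A" "\<And>k. k \<in> S \<Longrightarrow> 0 \<le> x k" "i \<in> S" "j \<in> S" "0 < A i j"
  shows "growth_le (\<lambda>n. it S A n x j) (\<lambda>n. it S A (n + 1) x i)"
proof (rule growth_leI[of "1 / A i j" 0])
  fix n
  have "A i j * it S A n x j \<le> ap S A (it S A n x) i"
    by (rule member_le_ap[OF assms(1,2) _ assms(4,5)]) (rule it_nonneg[OF assms(2,3)])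
  then show "it S A n x j \<le> 1 / A i j * it S A (n + 1) x i"
    using assms(6) by (simp add: pos_le_divide_eq mult.commute)
qed (use assms in auto)

text \<open>An edge lets \<open>i\<close> inherit the growth of \<open>j\<close> one step later, and
  a shift in time does not change a type; so types do not increase along edges.\<close>

lemma edge_type_le:
  assumes S: "finite S" "nonneg_on S A" "\<And>k. k \<in> S \<Longrightarrow> 0 \<le> x k" "i \<in> S" "j \<in> S" "0 < A i j"
    and s: "growth_le (pe r l) (\<lambda>n. it S A n x j)" "0 < r"
    and t: "growth_le (\<lambda>n. it S A n x i) (pe r' l')" "0 \<le> r'"
  shows "r < r' \<or> r = r' \<and> l \<le> l'"
proof -
  note s(1)
  also note edge_growth[OF S]
  also have "growth_le (\<lambda>n. it S A (n + 1) x i) (\<lambda>n. pe r' l' (n + 1))" by (rule growth_le_shift[OF t(1)])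
  also have "growth_le (\<lambda>n. pe r' l' (n + 1)) (pe r' l')" using pe_shift[OF t(2)] unfolding growth_eq_def by blast
  finally (growth_le_trans) show ?thesis by (rule pe_dom_strict[OF _ s(2) t(2)])
qed

text \<open>\<open>subinvariant_vector\<close> settles the states with \<open>l = 0\<close>, which
  are then frozen so that \<open>subsolution_above_first_level\<close> applies. What has to be
  checked is that freezing preserves both growth hypotheses, and that the resulting \<open>u\<close>
  is eventually a subsolution for the original rows.\<close>

lemma critical_growth:
  assumes rs: "row_system T R"
    and low: "\<And>D i. policy T R D \<Longrightarrow> i \<in> T \<Longrightarrow> growth_le (pe 1 (l i)) (\<lambda>n. it T D n (\<lambda>_. 1) i)"
    and B: "policy T R B" "\<And>i. i \<in> T \<Longrightarrow> growth_le (\<lambda>n. it T B n (\<lambda>_. 1) i) (pe 1 (l i))"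
    and i: "i \<in> T"
  shows "growth_le (pe 1 (l i)) (\<lambda>n. (minop T R ^^ n) (\<lambda>_. 1) i)"
proof -
  have fin: "finite T" using rs by (simp add: row_system_def)
  have nnB: "nonneg_on T B" by (rule policy_nonneg_on[OF rs B(1)])
  define T1 where "T1 = {i \<in> T. l i = 0}"
  have T1: "T1 \<subseteq> T" by (auto simp: T1_def)
  \<comment> \<open>Rows that do not leave \<open>T1\<close>. By \<open>edge_type_le\<close> the
    rows of \<open>B\<close> are among them, so no state of \<open>T1\<close> loses all its
    rows.\<close>
  define R1 where "R1 i = {a \<in> R i. \<forall>j\<in>T - T1. a j = 0}" for i
  have BR1: "B i \<in> R1 i" if i: "i \<in> T1" for i
  proof -
    have "B i j = 0" if j: "j \<in> T - T1" for j
    proof (rule ccontr)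
      assume "B i j \<noteq> 0"
      then have "0 < B i j" using nonneg_onD[OF nnB, of i j] i j T1 by force
      then have "1 < (1::real) \<or> (1::real) = 1 \<and> l j \<le> l i"
        using edge_type_le[OF fin nnB _ _ _ _ low[OF B(1)] _ B(2)] i j T1 by fastforce
      then show False using i j by (simp add: T1_def)
    qed
    then show ?thesis using B(1) i T1 by (auto simp: R1_def policy_def)
  qed
  have rs1: "row_system T1 R1"
    unfolding row_system_def
  proof (intro conjI ballI)
    show "finite T1" using fin T1 finite_subset by blast
    fix i assume i: "i \<in> T1"
    then have iT: "i \<in> T" using T1 by blast
    then show "finite (R1 i)" using rs by (simp add: R1_def row_system_def)
    show "R1 i \<noteq> {}" using BR1[OF i] by blast
    fix a j assume "a \<in> R1 i" "j \<in> T1"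
    then show "0 \<le> a j" using rs iT subsetD[OF T1, of j] by (simp add: R1_def row_system_def)
  qed
  have T1_eq: "it T D n (\<lambda>_. 1) i = it T1 D n (\<lambda>_. 1) i" if "policy T1 R1 D" "i \<in> T1" for D n i
    by (rule it_closed[OF fin T1 _ that(2)]) (use that in \<open>auto simp: policy_def R1_def\<close>)
  have pB1: "policy T1 R1 B" using BR1 by (simp add: policy_def)
  have "\<exists>w. (\<forall>i\<in>T1. 0 < w i) \<and> (\<forall>i\<in>T1. \<forall>a\<in>R1 i. w i \<le> (\<Sum>j\<in>T1. a j * w j))"
  proof (rule subinvariant_vector[OF rs1])
    fix D i assume D: "policy T1 R1 D" and i: "i \<in> T1"
    \<comment> \<open>\<open>low\<close> speaks of policies on all of \<open>T\<close>, so
      \<open>D\<close> is completed by rows of \<open>B\<close>; inside \<open>T1\<close> the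
      iterates do not notice, as \<open>T1\<close> is never left.\<close>
    define D' where "D' = (\<lambda>i. if i \<in> T1 then D i else B i)"
    have "policy T R D'" using D B(1) by (auto simp: policy_def D'_def R1_def)
    moreover have "policy T1 R1 D'" using D by (auto simp: policy_def D'_def)
    moreover have "it T1 D' n (\<lambda>_. 1) i = it T1 D n (\<lambda>_. 1) i" for n
      by (rule it_cong[OF _ _ i]) (auto simp: D'_def)
    ultimately show "growth_le (pe 1 0) (\<lambda>n. it T1 D n (\<lambda>_. 1) i)"
      using low[of D' i] T1_eq[of D' i] i by (simp add: T1_def)
  next
    fix i assume i: "i \<in> T1"
    show "growth_le (\<lambda>n. it T1 B n (\<lambda>_. 1) i) (pe 1 0)"
      using B(2)[of i] T1_eq[OF pB1 i] i by (simp add: T1_def)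
  qed (rule pB1)
  then obtain w where w: "\<And>i. i \<in> T1 \<Longrightarrow> 0 < w i" "\<And>i a. i \<in> T1 \<Longrightarrow> a \<in> R1 i \<Longrightarrow> w i \<le> (\<Sum>j\<in>T1. a j * w j)"
    by blast
  define R2 where "R2 i = (if i \<in> T1 then {\<lambda>j. if j = i then 1 else 0} else R i)" for i
  define z where "z i = (if i \<in> T1 then w i else 1)" for i
  have z: "0 < z i" for i using w by (simp add: z_def)
  have rs2: "row_system T R2" using rs by (auto simp: row_system_def R2_def)
  have fin1: "finite T1" using fin T1 finite_subset by blast
  have fixed: "it T D n z i = z i" if "policy T R2 D" "i \<in> T1" for D n i
  proof (induction n)
    case (Suc n)
    have "D i \<in> R2 i" using that subsetD[OF T1 that(2)] unfolding policy_def by blast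
    then have "D i = (\<lambda>j. if j = i then 1 else 0)" using that(2) by (simp add: R2_def)
    then have "it T D (Suc n) z i = it T D n z i"
      unfolding it_Suc using fin that T1 by (auto simp: if_distrib[of "\<lambda>t. t * _"] cong: if_cong)
    then show ?case using Suc by simp
  qed simp
  \<comment> \<open>Outside \<open>T1\<close> both policies use the same rows, so a domination that
    holds on \<open>T1\<close> at all times propagates to the other states.\<close>
  have compare: "it T D n x i \<le> C * it T E n y i"
    if DE: "\<And>i. i \<in> T - T1 \<Longrightarrow> D i = E i" and nn: "nonneg_on T D"
      and init: "\<And>i. i \<in> T - T1 \<Longrightarrow> x i \<le> C * y i"
      and T1: "\<And>i n. i \<in> T1 \<Longrightarrow> it T D n x i \<le> C * it T E n y i" and i: "i \<in> T" for D E x y C n i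
    using i
  proof (induction n arbitrary: i)
    case 0
    then show ?case using init T1[of i 0] by (cases "i \<in> T1") auto
  next
    case (Suc n)
    show ?case
    proof (cases "i \<in> T1")
      case False
      have "it T D (Suc n) x i \<le> (\<Sum>j\<in>T. D i j * (C * it T E n y j))" unfolding it_Suc
        by (intro sum_mono mult_left_mono Suc.IH nonneg_onD[OF nn]) (use Suc.prems in auto)
      also have "\<dots> = C * it T E (Suc n) y i" unfolding it_Suc
        using DE[of i] False Suc.prems by (simp add: sum_distrib_left mult_ac)
      finally show ?thesis .
    qed (rule T1)
  qed
  have upB1: "\<exists>C>0. \<forall>n. it T B n (\<lambda>_. 1) i \<le> C * pe 1 0 n" if "i \<in> T1" for i
    using growth_le_all[OF B(2)[of i]] that pe_pos by (simp add: T1_def)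
  have "\<exists>C>0. \<forall>i\<in>T1. \<forall>n. it T B n (\<lambda>_. 1) i \<le> C"
    by (intro finite_uniform[OF fin1]) (use upB1 in \<open>auto simp: pe_def intro: order_trans\<close>)
  then obtain C0 where C0: "C0 > 0" "\<And>i n. i \<in> T1 \<Longrightarrow> it T B n (\<lambda>_. 1) i \<le> C0" by blast
  have lowB1: "\<exists>c>0. \<forall>n. c * pe 1 0 n \<le> it T B n (\<lambda>_. 1) i" if "i \<in> T1" for i
  proof -
    have "i \<in> T" "growth_le (pe 1 0) (\<lambda>n. it T B n (\<lambda>_. 1) i)"
      using low[OF B(1), of i] that by (simp_all add: T1_def)
    then show ?thesis by (intro it_lower_of_growth[OF fin nnB]) auto
  qed
  have "\<exists>c>0. \<forall>i\<in>T1. \<forall>n. c \<le> it T B n (\<lambda>_. 1) i"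
    by (intro finite_uniform_small[OF fin1]) (use lowB1 in \<open>auto simp: pe_def intro: order_trans\<close>)
  then obtain c0 where c0: "c0 > 0" "\<And>i n. i \<in> T1 \<Longrightarrow> c0 \<le> it T B n (\<lambda>_. 1) i" by blast
  obtain wl where wl: "wl > 0" "\<forall>i\<in>T1. wl \<le> w i" using finite_lower[OF fin1, of w] w by blast
  obtain wu where wu: "wu > 0" "\<forall>i\<in>T1. w i \<le> wu" using finite_upper[OF fin1, of w] by blast
  have low2: "growth_le (pe 1 (l i)) (\<lambda>n. it T E n z i)" if E: "policy T R2 E" and i: "i \<in> T" for E i
  proof -
    define D where "D = (\<lambda>i. if i \<in> T1 then B i else E i)"
    have pD: "policy T R D" using E B(1) by (auto simp: policy_def D_def R2_def)
    have pD1: "policy T1 R1 D" using BR1 by (auto simp: policy_def D_def)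
    define C where "C = max 1 (C0 / wl)"
    have "it T D n (\<lambda>_. 1) i \<le> C * it T E n z i" for n
    proof (rule compare[OF _ policy_nonneg_on[OF rs pD] _ _ i])
      fix i n assume i: "i \<in> T1"
      have "it T D n (\<lambda>_. 1) i = it T1 D n (\<lambda>_. 1) i" by (rule T1_eq[OF pD1 i])
      also have "\<dots> = it T1 B n (\<lambda>_. 1) i" by (rule it_cong[OF _ _ i]) (auto simp: D_def)
      also have "\<dots> = it T B n (\<lambda>_. 1) i" by (rule T1_eq[OF pB1 i, symmetric])
      also have "\<dots> \<le> C0 / wl * wl" using C0 i wl by simp
      also have "\<dots> \<le> C * w i" using wl i C0 unfolding C_def by (intro mult_mono) auto
      also have "\<dots> = C * it T E n z i" using fixed[OF E i] i by (simp add: z_def)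
      finally show "it T D n (\<lambda>_. 1) i \<le> C * it T E n z i" .
    next
      fix i assume "i \<in> T - T1"
      then show "D i = E i" "1 \<le> C * z i" by (auto simp: D_def z_def C_def)
    qed
    moreover have "0 < C" by (simp add: C_def)
    ultimately have "growth_le (\<lambda>n. it T D n (\<lambda>_. 1) i) (\<lambda>n. it T E n z i)" by (intro growth_leI[of C 0])
    then show ?thesis using low[OF pD i] growth_le_trans by blast
  qed
  define B2 where "B2 = (\<lambda>i. if i \<in> T1 then (\<lambda>j. if j = i then 1 else 0) else B i)"
  have pB2: "policy T R2 B2" using B(1) by (auto simp: policy_def B2_def R2_def)
  have up2: "growth_le (\<lambda>n. it T B2 n z i) (pe 1 (l i))" if i: "i \<in> T" for i
  proof -
    define C where "C = max 1 (wu / c0)"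
    have "it T B2 n z i \<le> C * it T B n (\<lambda>_. 1) i" for n
    proof (rule compare[OF _ policy_nonneg_on[OF rs2 pB2] _ _ i])
      fix i n assume i: "i \<in> T1"
      have "it T B2 n z i \<le> wu" using fixed[OF pB2 i] wu i by (simp add: z_def)
      also have "\<dots> = wu / c0 * c0" using c0 by simp
      also have "\<dots> \<le> C * it T B n (\<lambda>_. 1) i" using c0 i wu unfolding C_def by (intro mult_mono) auto
      finally show "it T B2 n z i \<le> C * it T B n (\<lambda>_. 1) i" .
    next
      fix i assume "i \<in> T - T1"
      then show "B2 i = B i" "z i \<le> C * 1" by (auto simp: B2_def z_def C_def)
    qed
    moreover have "0 < C" by (simp add: C_def)
    ultimately have "growth_le (\<lambda>n. it T B2 n z i) (\<lambda>n. it T B n (\<lambda>_. 1) i)" by (intro growth_leI[of C 0])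
    then show ?thesis using B(2)[OF i] growth_le_trans by blast
  qed
  have "\<exists>u c n0. 0 < c \<and> (\<forall>n\<ge>n0. \<forall>i\<in>T. c * pe 1 (l i) n \<le> u n i) \<and>
    (\<forall>n\<ge>n0. \<forall>i\<in>T. l i = 0 \<longrightarrow> u n i = z i) \<and>
    (\<forall>n\<ge>n0. \<forall>i\<in>T. l i \<noteq> 0 \<longrightarrow> (\<forall>a\<in>R2 i. u (Suc n) i \<le> (\<Sum>j\<in>T. a j * u n j)))"
    by (rule subsolution_above_first_level[OF rs2 z _ low2 pB2 up2]) (auto simp: R2_def T1_def)
  then obtain u c n0 where u0: "0 < c" "\<forall>n\<ge>n0. \<forall>i\<in>T. c * pe 1 (l i) n \<le> u n i"
    "\<forall>n\<ge>n0. \<forall>i\<in>T. l i = 0 \<longrightarrow> u n i = z i"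
    "\<forall>n\<ge>n0. \<forall>i\<in>T. l i \<noteq> 0 \<longrightarrow> (\<forall>a\<in>R2 i. u (Suc n) i \<le> (\<Sum>j\<in>T. a j * u n j))"
    by blast
  have u: "0 < c" "\<And>n i. n \<ge> n0 \<Longrightarrow> i \<in> T \<Longrightarrow> c * pe 1 (l i) n \<le> u n i"
    "\<And>n i. n \<ge> n0 \<Longrightarrow> i \<in> T1 \<Longrightarrow> u n i = w i"
    "\<And>n i a. n \<ge> n0 \<Longrightarrow> i \<in> T - T1 \<Longrightarrow> a \<in> R i \<Longrightarrow> u (Suc n) i \<le> (\<Sum>j\<in>T. a j * u n j)"
    using u0 by (simp_all add: T1_def R2_def z_def)
  have upos: "0 \<le> u n i" if "n \<ge> n0" "i \<in> T" for n i
    using u(2)[OF that] u(1) pe_pos[of 1 "l i" n] by (smt (verit) mult_pos_pos)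
  have ev: "\<forall>\<^sub>F n in sequentially. u (Suc n) i \<le> (\<Sum>j\<in>T. a j * u n j)" if i: "i \<in> T" and a: "a \<in> R i" for i a
  proof -
    have a0: "0 \<le> a j" if "j \<in> T" for j using rs i a that by (auto simp: row_system_def)
    consider "i \<in> T - T1" | "i \<in> T1" "a \<in> R1 i" | j where "i \<in> T1" "j \<in> T - T1" "a j \<noteq> 0"
      using i a by (auto simp: R1_def)
    then show ?thesis
    proof cases
      case 1
      then show ?thesis using u(4)[OF _ _ a] unfolding eventually_sequentially by blast
    next
      case 2
      have "u (Suc n) i \<le> (\<Sum>j\<in>T. a j * u n j)" if n: "n \<ge> n0" for n
      proof -
        have "u (Suc n) i = w i" using u(3)[of "Suc n" i] n 2 by simp
        also have "\<dots> \<le> (\<Sum>j\<in>T1. a j * w j)" by (rule w(2)[OF 2])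
        also have "\<dots> = (\<Sum>j\<in>T1. a j * u n j)" using u(3)[OF n] by simp
        also have "\<dots> \<le> (\<Sum>j\<in>T. a j * u n j)"
          by (rule sum_mono2[OF fin T1]) (use a0 upos n in auto)
        finally show ?thesis .
      qed
      then show ?thesis unfolding eventually_sequentially by blast
    next
      \<comment> \<open>A row that leaves \<open>T1\<close> meets a state where \<open>u\<close>
        grows at least linearly, which eventually exceeds the constant \<open>w i\<close>.\<close>
      case 3
      have aj: "0 < a j" using a0[of j] 3 by force
      have lj: "1 \<le> l j" using 3 by (auto simp: T1_def)
      obtain n1 where n1: "w i / (a j * c) \<le> real n1" using real_arch_simple by blast
      have "u (Suc n) i \<le> (\<Sum>j\<in>T. a j * u n j)" if n: "n \<ge> max n0 n1" for n
      proof -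
        have "w i / (a j * c) \<le> real (Suc n)" using n1 n by linarith
        also have "\<dots> \<le> real (Suc n) ^ l j" using lj self_le_power[of "real (Suc n)" "l j"] by simp
        finally have "w i \<le> a j * (c * real (Suc n) ^ l j)"
          using aj u(1) by (simp add: pos_divide_le_eq mult_ac del: of_nat_Suc)
        also have "\<dots> = a j * (c * pe 1 (l j) n)" by (simp add: pe_def)
        also have "\<dots> \<le> a j * u n j" using aj u(2)[of n j] n 3 by (intro mult_left_mono) auto
        also have "\<dots> \<le> (\<Sum>j\<in>T. a j * u n j)"
          by (rule member_le_sum) (use 3 a0 upos n fin in auto)
        finally show ?thesis using u(3)[of "Suc n" i] n 3 by simp
      qed
      then show ?thesis unfolding eventually_sequentially by blast
    qed
  qed
  have "\<forall>\<^sub>F n in sequentially. \<forall>i\<in>T. \<forall>a\<in>R i. u (Suc n) i \<le> (\<Sum>j\<in>T. a j * u n j)"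
    by (intro eventually_ball_finite ballI fin ev) (use rs in \<open>auto simp: row_system_def\<close>)
  then obtain n1 where n1: "\<And>n i a. n \<ge> n1 \<Longrightarrow> i \<in> T \<Longrightarrow> a \<in> R i \<Longrightarrow> u (Suc n) i \<le> (\<Sum>j\<in>T. a j * u n j)"
    unfolding eventually_sequentially by blast
  define m where "m = max n0 n1"
  have "\<exists>c>0. \<forall>n. \<forall>i\<in>T. c * u (m + n) i \<le> (minop T R ^^ n) (\<lambda>_. 1) i"
  proof (rule minop_iter_ge_sub[OF rs])
    fix n i assume "n \<ge> m" "i \<in> T"
    then show "u (Suc n) i \<le> minop T R (u n) i" by (intro minop_ge[OF rs] n1) (auto simp: m_def)
  qed simp
  then obtain c' where c': "c' > 0" "\<And>n i. i \<in> T \<Longrightarrow> c' * u (m + n) i \<le> (minop T R ^^ n) (\<lambda>_. 1) i" by blast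
  have "growth_le (pe 1 (l i)) (\<lambda>n. pe 1 (l i) (n + m))"
    using pe_shift[of 1 "l i" m] unfolding growth_eq_def by simp
  also have "growth_le (\<lambda>n. pe 1 (l i) (n + m)) (\<lambda>n. (minop T R ^^ n) (\<lambda>_. 1) i)"
  proof (rule growth_leI[of "1 / (c' * c)" 0])
    fix n
    have "c' * (c * pe 1 (l i) (n + m)) \<le> c' * u (m + n) i"
      using u(2)[of "m + n" i] i c'(1) by (intro mult_left_mono) (auto simp: m_def add.commute)
    also have "\<dots> \<le> (minop T R ^^ n) (\<lambda>_. 1) i" by (rule c'(2)[OF i])
    finally show "pe 1 (l i) (n + m) \<le> 1 / (c' * c) * (minop T R ^^ n) (\<lambda>_. 1) i"
      using u(1) c'(1) by (simp add: pos_le_divide_eq mult_ac)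
  qed (use u(1) c'(1) in auto)
  finally (growth_le_trans) show ?thesis .
qed

text \<open>Dividing every row by \<open>\<rho>\<close> divides the iterates at time
  \<open>n\<close> by \<open>\<rho>^n\<close>, which brings the rate to 1.\<close>

lemma critical_growth_scaled:
  assumes rs: "row_system T R" and \<rho>: "0 < \<rho>"
    and low: "\<And>D i. policy T R D \<Longrightarrow> i \<in> T \<Longrightarrow> growth_le (pe \<rho> (l i)) (\<lambda>n. it T D n (\<lambda>_. 1) i)"
    and B: "policy T R B" "\<And>i. i \<in> T \<Longrightarrow> growth_le (\<lambda>n. it T B n (\<lambda>_. 1) i) (pe \<rho> (l i))"
    and i: "i \<in> T"
  shows "growth_le (pe \<rho> (l i)) (\<lambda>n. (minop T R ^^ n) (\<lambda>_. 1) i)"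
proof -
  define R' where "R' i = (\<lambda>a j. a j / \<rho>) ` R i" for i
  have rs': "row_system T R'" using rs \<rho> by (auto simp: row_system_def R'_def)
  have pe: "pe \<rho> l n = \<rho> ^ n * pe 1 l n" for l n by (simp add: pe_def)
  have low': "growth_le (pe 1 (l i)) (\<lambda>n. it T D n (\<lambda>_. 1) i)" if D: "policy T R' D" and i: "i \<in> T" for D i
  proof -
    have "policy T R (\<lambda>i j. \<rho> * D i j)" unfolding policy_def
    proof
      fix i assume "i \<in> T"
      then obtain a where "a \<in> R i" "D i = (\<lambda>j. a j / \<rho>)" using D by (auto simp: policy_def R'_def)
      then show "(\<lambda>j. \<rho> * D i j) \<in> R i" using \<rho> by simp
    qed
    from growth_leE[OF low[OF this i]] obtain q n0
      where q: "0 < q" "\<And>n. n0 \<le> n \<Longrightarrow> pe \<rho> (l i) n \<le> q * it T (\<lambda>i j. \<rho> * D i j) n (\<lambda>_. 1) i" by blast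
    show ?thesis
    proof (rule growth_leI[OF q(1), of n0])
      fix n assume "n0 \<le> n"
      from q(2)[OF this] have "\<rho> ^ n * pe 1 (l i) n \<le> \<rho> ^ n * (q * it T D n (\<lambda>_. 1) i)"
        unfolding it_scale pe by (simp add: mult_ac)
      then show "pe 1 (l i) n \<le> q * it T D n (\<lambda>_. 1) i" using \<rho> by simp
    qed
  qed
  define B' where "B' = (\<lambda>i j. (1 / \<rho>) * B i j)"
  have pB': "policy T R' B'" using B(1) by (auto simp: policy_def R'_def B'_def)
  have up': "growth_le (\<lambda>n. it T B' n (\<lambda>_. 1) i) (pe 1 (l i))" if i: "i \<in> T" for i
  proof -
    obtain q n0 where q: "0 < q" "\<And>n. n0 \<le> n \<Longrightarrow> it T B n (\<lambda>_. 1) i \<le> q * pe \<rho> (l i) n"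
      using growth_leE[OF B(2)[OF i]] by blast
    show ?thesis
    proof (rule growth_leI[OF q(1), of n0])
      fix n assume "n0 \<le> n"
      from mult_left_mono[OF q(2)[OF this], of "(1 / \<rho>) ^ n"] \<rho>
      show "it T B' n (\<lambda>_. 1) i \<le> q * pe 1 (l i) n"
        unfolding B'_def it_scale pe by (simp add: power_divide)
    qed
  qed
  have scale: "\<rho> ^ n * (minop T R' ^^ n) (\<lambda>_. 1) i \<le> (minop T R ^^ n) (\<lambda>_. 1) i" if "i \<in> T" for n i
    using that
  proof (induction n arbitrary: i)
    case 0
    then show ?case by simp
  next
    case (Suc n)
    let ?x = "(minop T R ^^ n) (\<lambda>_. 1)" and ?y = "(minop T R' ^^ n) (\<lambda>_. 1)"
    have "\<rho> ^ Suc n * minop T R' ?y i \<le> minop T R ?x i"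
    proof (rule minop_ge[OF rs Suc.prems])
      fix a assume a: "a \<in> R i"
      then have "(\<lambda>j. a j / \<rho>) \<in> R' i" by (simp add: R'_def)
      from minop_le[OF rs' Suc.prems this, of ?y]
      have "\<rho> ^ Suc n * minop T R' ?y i \<le> \<rho> ^ Suc n * (\<Sum>j\<in>T. a j / \<rho> * ?y j)"
        by (rule mult_left_mono) (use \<rho> in simp)
      also have "\<dots> = (\<Sum>j\<in>T. a j * (\<rho> ^ n * ?y j))" using \<rho> by (simp add: sum_distrib_left mult_ac)
      also have "\<dots> \<le> (\<Sum>j\<in>T. a j * ?x j)"
        by (intro sum_mono mult_left_mono Suc.IH) (use rs a Suc.prems in \<open>auto simp: row_system_def\<close>)
      finally show "\<rho> ^ Suc n * minop T R' ?y i \<le> (\<Sum>j\<in>T. a j * ?x j)" .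
    qed
    then show ?case by simp
  qed
  obtain q n0 where q: "0 < q" "\<And>n. n0 \<le> n \<Longrightarrow> pe 1 (l i) n \<le> q * (minop T R' ^^ n) (\<lambda>_. 1) i"
    using growth_leE[OF critical_growth[OF rs' low' pB' up' i]] by blast
  show ?thesis
  proof (rule growth_leI[OF q(1), of n0])
    fix n assume "n0 \<le> n"
    from mult_left_mono[OF q(2)[OF this], of "\<rho> ^ n"] \<rho>
    have "pe \<rho> (l i) n \<le> q * (\<rho> ^ n * (minop T R' ^^ n) (\<lambda>_. 1) i)" unfolding pe by (simp add: mult_ac)
    also have "\<dots> \<le> q * (minop T R ^^ n) (\<lambda>_. 1) i" using scale[OF i, of n] q(1) by (intro mult_left_mono) auto
    finally show "pe \<rho> (l i) n \<le> q * (minop T R ^^ n) (\<lambda>_. 1) i" .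
  qed
qed

section \<open>Separating and recombining different rates\<close>

lemma pe_negligible:
  assumes "0 \<le> r" "r < r'" "0 < e"
  shows "\<forall>\<^sub>F n in sequentially. pe r l n \<le> e * pe r' l' n"
proof -
  define s where "s = (r + r') / 2"
  have s: "r < s" "s < r'" "0 < s" using assms by (auto simp: s_def)
  obtain q where q: "q > 0" "\<forall>n. pe r l n \<le> q * pe s 0 n"
    using growth_le_all[OF pe_dom[of r s l 0]] assms s pe_pos by blast
  have "(\<lambda>n. (s / r') ^ n) \<longlonglongrightarrow> 0" by (rule LIMSEQ_realpow_zero) (use s in auto)
  then have "\<forall>\<^sub>F n in sequentially. (s / r') ^ n < e / q" by (rule order_tendstoD) (use q assms in simp)
  then show ?thesis
  proof (rule eventually_mono)
    fix n assume n: "(s / r') ^ n < e / q"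
    have "pe r l n \<le> q * s ^ n" using q(2) by (simp add: pe_def)
    also have "\<dots> \<le> e * (1 * r' ^ n)" using n q s by (simp add: power_divide field_simps)
    also have "\<dots> \<le> e * pe r' l' n" unfolding pe_def using s assms
      by (intro mult_left_mono mult_right_mono one_le_power) auto
    finally show "pe r l n \<le> e * pe r' l' n" .
  qed
qed

lemma it_subset_le:
  assumes fin: "finite S" and nn: "nonneg_on S A" and T: "T \<subseteq> S" and x: "\<And>j. j \<in> S \<Longrightarrow> 0 \<le> x j" and i: "i \<in> T"
  shows "it T A n x i \<le> it S A n x i"
  using i
proof (induction n arbitrary: i)
  case 0
  then show ?case by simp
next
  case (Suc n)
  have "it T A (Suc n) x i \<le> (\<Sum>j\<in>T. A i j * it S A n x j)" unfolding it_Suc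
    by (intro sum_mono mult_left_mono Suc.IH nonneg_onD[OF nn]) (use Suc.prems T in auto)
  also have "\<dots> \<le> it S A (Suc n) x i" unfolding it_Suc
    by (rule sum_mono2[OF fin T])
      (use Suc.prems T it_nonneg[OF nn x] nonneg_onD[OF nn] in \<open>auto intro: mult_nonneg_nonneg\<close>)
  finally show ?case .
qed

text \<open>Since \<open>s^(n - m) t^m = t^n (s / t)^(n - m)\<close>, the convolution is governed by
  a geometric sum of ratio \<open>s / t < 1\<close> and keeps the type of the faster
  sequence.\<close>

lemma convolution_pe:
  assumes s: "0 < s" "s < t" and a: "\<And>m. a m \<le> C * pe t l m" and C: "0 \<le> C"
  shows "(\<Sum>m\<le>n. s ^ (n - m) * a m) \<le> C / (1 - s / t) * pe t l n"
proof -
  have t: "0 < t" using s by simp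
  have "(\<Sum>m\<le>n. s ^ (n - m) * a m) \<le> (\<Sum>m\<le>n. C * pe t l n * (s / t) ^ (n - m))"
  proof (rule sum_mono)
    fix m assume m: "m \<in> {..n}"
    have "pe t l m \<le> real (Suc n) ^ l * t ^ m" unfolding pe_def
      using m t by (intro mult_right_mono power_mono) auto
    also have "\<dots> = pe t l n / t ^ (n - m)"
      using m t power_add[of t m "n - m"] by (simp add: pe_def)
    finally have "C * pe t l m \<le> C * (pe t l n / t ^ (n - m))" using C by (rule mult_left_mono)
    then have "a m \<le> C * (pe t l n / t ^ (n - m))" using a[of m] by linarith
    then have "s ^ (n - m) * a m \<le> s ^ (n - m) * (C * (pe t l n / t ^ (n - m)))" using s by (intro mult_left_mono) auto
    then show "s ^ (n - m) * a m \<le> C * pe t l n * (s / t) ^ (n - m)" by (simp add: power_divide mult_ac)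
  qed
  also have "\<dots> = C * pe t l n * (\<Sum>m\<le>n. (s / t) ^ (n - m))" by (simp add: sum_distrib_left)
  also have "\<dots> \<le> C * pe t l n * (1 / (1 - s / t))"
  proof (intro mult_left_mono)
    have "(\<Sum>m\<le>n. (s / t) ^ (n - m)) = (\<Sum>m\<le>n. (s / t) ^ m)"
      by (rule sum.reindex_bij_witness[of _ "\<lambda>m. n - m" "\<lambda>m. n - m"]) auto
    also have "\<dots> \<le> (\<Sum>m. (s / t) ^ m)" by (rule sum_le_suminf) (use s t in auto)
    also have "\<dots> = 1 / (1 - s / t)" by (rule suminf_geometric) (use s t in simp)
    finally show "(\<Sum>m\<le>n. (s / t) ^ (n - m)) \<le> 1 / (1 - s / t)" .
  qed (use C t pe_nonneg[of t l n] in auto)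
  finally show ?thesis by simp
qed

text \<open>The states of rate below \<open>\<rho>\<close> contribute at most a convolution with \<open>s ^ n\<close> for some \<open>s < \<rho>\<close>,
  which leaves a growth of rate \<open>\<rho>\<close> unchanged.\<close>

lemma restricted_growth:
  assumes rs: "row_system S R" and B: "policy S R B"
    and min: "\<And>D i. policy S R D \<Longrightarrow> i \<in> S \<Longrightarrow> growth_le (\<lambda>n. it S B n (\<lambda>_. 1) i) (\<lambda>n. it S D n (\<lambda>_. 1) i)"
    and ty: "\<And>i. i \<in> S \<Longrightarrow> 0 \<le> r i" "\<And>i. i \<in> S \<Longrightarrow> growth_eq (\<lambda>n. it S B n (\<lambda>_. 1) i) (pe (r i) (l i))"
    and BR: "\<And>i j. i \<in> S \<Longrightarrow> j \<in> S \<Longrightarrow> B i j \<noteq> 0 \<Longrightarrow> r j \<le> r i"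
    and \<rho>: "0 < \<rho>" and T: "T = {i \<in> S. r i = \<rho>}"
    and D: "\<And>i. i \<in> T \<Longrightarrow> D i \<in> R i" "\<And>i j. i \<in> T \<Longrightarrow> j \<in> S \<Longrightarrow> D i j \<noteq> 0 \<Longrightarrow> r j \<le> \<rho>"
    and i: "i \<in> T"
  shows "growth_le (pe \<rho> (l i)) (\<lambda>n. it T D n (\<lambda>_. 1) i)"
proof -
  have fin: "finite S" using rs by (simp add: row_system_def)
  have TS: "T \<subseteq> S" using T by auto
  have finT: "finite T" using fin TS finite_subset by blast
  define L where "L = {i \<in> S. r i < \<rho>}"
  have L: "L \<subseteq> S" "finite L" "T \<inter> L = {}" using fin T by (auto simp: L_def)
  define D' where "D' = (\<lambda>i. if i \<in> T then D i else B i)"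
  have pD': "policy S R D'" using D(1) B by (auto simp: policy_def D'_def)
  have nnB: "nonneg_on S B" by (rule policy_nonneg_on[OF rs B])
  have nnD': "nonneg_on S D'" by (rule policy_nonneg_on[OF rs pD'])
  have nnD: "nonneg_on T D" using nonneg_on_subset[OF nnD' TS] by (auto simp: nonneg_on_def D'_def)
  have one: "\<And>j. 0 < (1::real)" "\<And>j. 0 \<le> (1::real)" by auto
  \<comment> \<open>The largest rate that occurs below \<open>\<rho>\<close>; inserting 0 covers an
    empty \<open>L\<close>.\<close>
  define m where "m = Max (insert 0 (r ` L))"
  have "m \<in> insert 0 (r ` L)" unfolding m_def by (rule Max_in) (use L in auto)
  then have m: "m < \<rho>" "0 \<le> m" using \<rho> ty(1) L by (auto simp: L_def)
  have mL: "r j \<le> m" if "j \<in> L" for j unfolding m_def using that L by auto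
  define s where "s = (m + \<rho>) / 2"
  have s: "0 < s" "m < s" "s < \<rho>" using m \<rho> by (auto simp: s_def)
  \<comment> \<open>\<open>B\<close> never moves to a state of larger rate, so \<open>L\<close> is
    closed under \<open>B\<close>, and there \<open>D'\<close> uses the rows of
    \<open>B\<close>.\<close>
  have LB: "it S D' n (\<lambda>_. 1) j = it S B n (\<lambda>_. 1) j" if j: "j \<in> L" for j n
  proof -
    have cl: "B i k = 0" if "i \<in> L" "k \<in> S - L" for i k using BR[of i k] that by (force simp: L_def)
    have "it S D' n (\<lambda>_. 1) j = it L D' n (\<lambda>_. 1) j"
      by (rule it_closed[OF fin L(1) _ j]) (use cl L in \<open>auto simp: D'_def\<close>)
    also have "\<dots> = it L B n (\<lambda>_. 1) j" by (rule it_cong[OF _ _ j]) (use L in \<open>auto simp: D'_def\<close>)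
    also have "\<dots> = it S B n (\<lambda>_. 1) j" by (rule it_closed[OF fin L(1) cl j, symmetric])
    finally show ?thesis .
  qed
  have "\<exists>C>0. \<forall>n. it S B n (\<lambda>_. 1) j \<le> C * pe s 0 n" if j: "j \<in> L" for j
  proof -
    have "growth_le (\<lambda>n. it S B n (\<lambda>_. 1) j) (pe (r j) (l j))"
      using ty(2)[of j] j L unfolding growth_eq_def by blast
    also have "growth_le (pe (r j) (l j)) (pe s 0)" by (rule pe_dom) (use ty(1)[of j] mL[OF j] j L s in auto)
    finally (growth_le_trans) show ?thesis by (rule growth_le_all) (rule pe_pos[OF s(1)])
  qed
  then have "\<exists>C>0. \<forall>j\<in>L. \<forall>n. it S B n (\<lambda>_. 1) j \<le> C * pe s 0 n"
  proof (intro finite_uniform[OF L(2)])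
    fix j q q' assume "\<forall>n. it S B n (\<lambda>_. 1) j \<le> q * pe s 0 n" "q \<le> (q' :: real)"
    then show "\<forall>n. it S B n (\<lambda>_. 1) j \<le> q' * pe s 0 n"
      using pe_nonneg[OF less_imp_le[OF s(1)]] by (meson mult_right_mono order_trans)
  qed
  then obtain C where C: "C > 0" "\<And>j n. j \<in> L \<Longrightarrow> it S B n (\<lambda>_. 1) j \<le> C * s ^ n" by (auto simp: pe_def)
  obtain E where E: "E > 0" "\<forall>i\<in>T. (\<Sum>j\<in>L. D i j * C) \<le> E"
    using finite_upper[OF finT, of "\<lambda>i. \<Sum>j\<in>L. D i j * C"] by blast
  define K where "K = max 1 (E / s)"
  have K: "1 \<le> K" "E \<le> K * s" using s E by (auto simp: K_def max_mult_distrib_right)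
  \<comment> \<open>The response of \<open>D\<close> on \<open>T\<close> to the input
    \<open>s^n\<close> at every state and time: \<open>y (n + 1) = s^(n + 1) + D y n\<close>. Up to
    the factor \<open>K\<close> it majorizes \<open>D'\<close> on \<open>T\<close>, since the input
    from \<open>L\<close> has order \<open>s^n\<close>.\<close>
  define y where "y n i = (\<Sum>m\<le>n. s ^ (n - m) * it T D m (\<lambda>_. 1) i)" for n i
  have ySuc: "y (Suc n) i = s ^ Suc n + (\<Sum>j\<in>T. D i j * y n j)" for n i
  proof -
    have "y (Suc n) i = s ^ Suc n + (\<Sum>m\<le>n. s ^ (n - m) * it T D (Suc m) (\<lambda>_. 1) i)"
      unfolding y_def by (subst sum.atMost_Suc_shift) simp
    also have "(\<Sum>m\<le>n. s ^ (n - m) * it T D (Suc m) (\<lambda>_. 1) i) = (\<Sum>m\<le>n. \<Sum>j\<in>T. D i j * (s ^ (n - m) * it T D m (\<lambda>_. 1) j))"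
      unfolding it_Suc by (simp add: sum_distrib_left mult_ac)
    also have "\<dots> = (\<Sum>j\<in>T. \<Sum>m\<le>n. D i j * (s ^ (n - m) * it T D m (\<lambda>_. 1) j))" by (rule sum.swap)
    finally show ?thesis unfolding y_def by (simp add: sum_distrib_left)
  qed
  have bound: "it S D' n (\<lambda>_. 1) i \<le> K * y n i" if "i \<in> T" for n i
    using that
  proof (induction n arbitrary: i)
    case 0
    then show ?case using K by (simp add: y_def)
  next
    case (Suc n)
    have "it S D' (Suc n) (\<lambda>_. 1) i = (\<Sum>j\<in>T \<union> L. D' i j * it S D' n (\<lambda>_. 1) j)" unfolding it_Suc
    proof (rule sum.mono_neutral_right[OF fin])
      show "\<forall>j\<in>S - (T \<union> L). D' i j * it S D' n (\<lambda>_. 1) j = 0"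
      proof
        fix j assume j: "j \<in> S - (T \<union> L)"
        then have "\<not> r j \<le> \<rho>" by (auto simp: T L_def)
        then have "D i j = 0" using D(2)[OF Suc.prems, of j] j by blast
        then show "D' i j * it S D' n (\<lambda>_. 1) j = 0" using Suc.prems by (simp add: D'_def)
      qed
    qed (use TS L in auto)
    also have "\<dots> = (\<Sum>j\<in>T. D i j * it S D' n (\<lambda>_. 1) j) + (\<Sum>j\<in>L. D i j * it S B n (\<lambda>_. 1) j)"
    proof -
      have "D' i j = D i j" for j using Suc.prems by (simp add: D'_def)
      then show ?thesis using L finT by (subst sum.union_disjoint) (auto simp: LB)
    qed
    also have "\<dots> \<le> (\<Sum>j\<in>T. D i j * (K * y n j)) + (\<Sum>j\<in>L. D i j * (C * s ^ n))"
    proof (intro add_mono sum_mono mult_left_mono Suc.IH C(2))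
      show "0 \<le> D i j" if "j \<in> T" for j using nonneg_onD[OF nnD Suc.prems that] .
      show "0 \<le> D i j" if "j \<in> L" for j
        using nonneg_onD[OF nnD', of i j] Suc.prems TS that L by (auto simp: D'_def)
    qed
    also have "\<dots> = K * (\<Sum>j\<in>T. D i j * y n j) + (\<Sum>j\<in>L. D i j * C) * s ^ n"
      by (simp add: sum_distrib_left sum_distrib_right mult_ac)
    also have "\<dots> \<le> K * (\<Sum>j\<in>T. D i j * y n j) + K * s * s ^ n"
    proof -
      have "(\<Sum>j\<in>L. D i j * C) \<le> K * s" using E(2) Suc.prems K(2) by force
      then show ?thesis using s by (intro add_left_mono mult_right_mono) auto
    qed
    also have "\<dots> = K * y (Suc n) i" unfolding ySuc by (simp add: distrib_left)
    finally show ?case .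
  qed
  have "growth_le (pe \<rho> (l i)) (\<lambda>n. it S B n (\<lambda>_. 1) i)" using ty(2)[of i] i T by (auto simp: growth_eq_def)
  also have "growth_le (\<lambda>n. it S B n (\<lambda>_. 1) i) (\<lambda>n. it S D' n (\<lambda>_. 1) i)" by (rule min[OF pD']) (use i TS in auto)
  also have "growth_le (\<lambda>n. it S D' n (\<lambda>_. 1) i) (\<lambda>n. y n i)"
    by (rule growth_leI[of K 0]) (use K bound[OF i] in auto)
  finally (growth_le_trans) have gy: "growth_le (pe \<rho> (l i)) (\<lambda>n. y n i)" .
  have y_le: "growth_le (\<lambda>n. y n i) (pe t k)"
    if st: "s < t" and g: "growth_le (\<lambda>n. it T D n (\<lambda>_. 1) i) (pe t k)" for t k
  proof -
    have "0 < t" using st s(1) by simp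
    then obtain C where C: "C > 0" "\<And>n. it T D n (\<lambda>_. 1) i \<le> C * pe t k n"
      using growth_le_all[OF g pe_pos] by blast
    show ?thesis unfolding y_def
    proof (rule growth_leI[of "C / (1 - s / t)" 0])
      show "0 < C / (1 - s / t)" using C(1) st s(1) by simp
      show "(\<Sum>m\<le>n. s ^ (n - m) * it T D m (\<lambda>_. 1) i) \<le> C / (1 - s / t) * pe t k n" for n
        by (rule convolution_pe[OF s(1) st C(2) less_imp_le[OF C(1)]])
    qed
  qed
  obtain t where t: "0 \<le> fst t" "growth_eq (\<lambda>n. it T D n (\<lambda>_. 1) i) (pt t)"
    using growth_type_exists[OF finT nnD one(1) i] by blast
  show ?thesis
  proof (cases "s < fst t")
    case True
    then have "growth_le (pe \<rho> (l i)) (pt t)"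
      using growth_le_trans[OF gy y_le] t(2) unfolding growth_eq_def by blast
    then show ?thesis using t(2) growth_le_trans unfolding growth_eq_def by blast
  next
    case False
    \<comment> \<open>If \<open>D\<close> on \<open>T\<close> had a rate of at most
      \<open>s\<close>, the convolution would be bounded by a multiple of \<open>s2^n\<close> with
      \<open>s2 < \<rho>\<close>, against \<open>gy\<close>.\<close>
    define s2 where "s2 = (s + \<rho>) / 2"
    have s2: "s < s2" "s2 < \<rho>" using s by (auto simp: s2_def)
    have "growth_le (pt t) (pe s2 0)" by (rule pe_dom) (use False s2 t in auto)
    then have "growth_le (\<lambda>n. it T D n (\<lambda>_. 1) i) (pe s2 0)"
      using t(2) growth_le_trans unfolding growth_eq_def by blast
    from growth_le_trans[OF gy y_le[OF s2(1) this]] have False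
      using pe_dom_strict[of \<rho> "l i" s2 0] \<rho> s2 s(1) by auto
    then show ?thesis ..
  qed
qed

text \<open>For each positive rate \<open>restricted_growth\<close> supplies the hypotheses of
  \<open>critical_growth_scaled\<close>. The minimal iterates \<open>v \<rho>\<close> of these
  separate problems are pasted into one \<open>u\<close>; their exact growth, bounded from both
  sides, is what lets an entry at a larger rate dominate.\<close>

theorem minimal_policy_growth:
  assumes rs: "row_system S R" and B: "policy S R B"
    and min: "\<And>D i. policy S R D \<Longrightarrow> i \<in> S \<Longrightarrow> growth_le (\<lambda>n. it S B n (\<lambda>_. 1) i) (\<lambda>n. it S D n (\<lambda>_. 1) i)"
    and i: "i \<in> S"
  shows "growth_le (\<lambda>n. it S B n (\<lambda>_. 1) i) (\<lambda>n. (minop S R ^^ n) (\<lambda>_. 1) i)"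
proof -
  have fin: "finite S" using rs by (simp add: row_system_def)
  have nnB: "nonneg_on S B" by (rule policy_nonneg_on[OF rs B])
  have "\<exists>t. 0 \<le> fst t \<and> growth_eq (\<lambda>n. it S B n (\<lambda>_. 1) i) (pt t)" if "i \<in> S" for i
    by (rule growth_type_exists[OF fin nnB _ that]) simp
  then obtain ty where ty: "\<And>i. i \<in> S \<Longrightarrow> 0 \<le> fst (ty i)" "\<And>i. i \<in> S \<Longrightarrow> growth_eq (\<lambda>n. it S B n (\<lambda>_. 1) i) (pt (ty i))"
    by metis
  define r where "r i = fst (ty i)" for i
  define l where "l i = snd (ty i)" for i
  note ty = ty[folded r_def l_def]
  have tyl: "growth_le (pe (r i) (l i)) (\<lambda>n. it S B n (\<lambda>_. 1) i)" and tyu: "growth_le (\<lambda>n. it S B n (\<lambda>_. 1) i) (pe (r i) (l i))"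
    if "i \<in> S" for i using ty(2)[OF that] by (auto simp: growth_eq_def)
  have BR: "r j \<le> r i" if "i \<in> S" "j \<in> S" "B i j \<noteq> 0" for i j
  proof (cases "r j = 0")
    case False
    then have "0 < r j" "0 < B i j" using ty(1)[of j] that nonneg_onD[OF nnB, of i j] by force+
    then have "r j < r i \<or> r j = r i \<and> l j \<le> l i"
      using edge_type_le[OF fin nnB _ that(1,2) _ tyl[OF that(2)] _ tyu[OF that(1)] ty(1)[OF that(1)]] by simp
    then show ?thesis by linarith
  qed (use ty(1)[of i] that in simp)
  define R' where "R' i = {a \<in> R i. \<forall>j\<in>S. a j \<noteq> 0 \<longrightarrow> r j \<le> r i}" for i
  have BR': "B i \<in> R' i" if "i \<in> S" for i using B BR that by (auto simp: R'_def policy_def)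
  define T where "T \<rho> = {i \<in> S. r i = \<rho>}" for \<rho>
  have TS: "T \<rho> \<subseteq> S" for \<rho> by (auto simp: T_def)
  have rsT: "row_system (T \<rho>) R'" for \<rho>
  proof -
    have "finite (T \<rho>)" using fin TS finite_subset by blast
    moreover have "finite (R' i)" "R' i \<noteq> {}" if "i \<in> T \<rho>" for i
      using BR'[of i] that rs by (auto simp: T_def R'_def row_system_def)
    moreover have "0 \<le> a j" if "i \<in> T \<rho>" "a \<in> R' i" "j \<in> T \<rho>" for a i j
      using that rs by (auto simp: T_def R'_def row_system_def)
    ultimately show ?thesis unfolding row_system_def by blast
  qed
  have pBT: "policy (T \<rho>) R' B" for \<rho> using BR' by (auto simp: policy_def T_def)
  define v where "v \<rho> n i = (minop (T \<rho>) R' ^^ n) (\<lambda>_. 1) i" for \<rho> n i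
  have upT: "growth_le (\<lambda>n. it (T \<rho>) B n (\<lambda>_. 1) i) (pe \<rho> (l i))" if i: "i \<in> T \<rho>" for \<rho> i
  proof -
    have "growth_le (\<lambda>n. it (T \<rho>) B n (\<lambda>_. 1) i) (\<lambda>n. it S B n (\<lambda>_. 1) i)"
      by (rule growth_le_mono) (rule it_subset_le[OF fin nnB TS _ i], simp)
    then show ?thesis using tyu[of i] i growth_le_trans by (auto simp: T_def)
  qed
  have vlow: "growth_le (pe \<rho> (l i)) (\<lambda>n. v \<rho> n i)" if \<rho>: "0 < \<rho>" and i: "i \<in> T \<rho>" for \<rho> i
    unfolding v_def
  proof (rule critical_growth_scaled[OF rsT \<rho> _ pBT upT i])
    fix D i assume D: "policy (T \<rho>) R' D" and i: "i \<in> T \<rho>"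
    show "growth_le (pe \<rho> (l i)) (\<lambda>n. it (T \<rho>) D n (\<lambda>_. 1) i)"
      by (rule restricted_growth[OF rs B min ty BR \<rho> T_def _ _ i])
        (use D in \<open>auto simp: policy_def R'_def T_def\<close>)
  qed
  have vup: "growth_le (\<lambda>n. v \<rho> n i) (pe \<rho> (l i))" if "i \<in> T \<rho>" for \<rho> i
  proof -
    have "growth_le (\<lambda>n. v \<rho> n i) (\<lambda>n. it (T \<rho>) B n (\<lambda>_. 1) i)" unfolding v_def
      by (rule growth_le_mono) (rule minop_iter_le_it[OF rsT pBT _ that], simp)
    then show ?thesis using upT[OF that] growth_le_trans by blast
  qed
  have v0: "0 \<le> v \<rho> n i" if "i \<in> T \<rho>" for \<rho> n i
    using that
  proof (induction n arbitrary: i)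
    case 0
    then show ?case by (simp add: v_def)
  next
    case (Suc n)
    have "0 \<le> minop (T \<rho>) R' (v \<rho> n) i"
    proof (rule minop_ge[OF rsT Suc.prems])
      fix a assume a: "a \<in> R' i"
      show "0 \<le> (\<Sum>j\<in>T \<rho>. a j * v \<rho> n j)"
        by (intro sum_nonneg mult_nonneg_nonneg Suc.IH) (use rsT a Suc.prems in \<open>auto simp: row_system_def\<close>)
    qed
    then show ?case by (simp add: v_def[abs_def])
  qed
  \<comment> \<open>The value 0 suffices at states of rate 0: there \<open>B\<close> itself is
    eventually zero, and only nonnegativity of the minimal iterates is needed.\<close>
  define u where "u n i = (if r i = 0 then 0 else v (r i) n i)" for n i
  have inT: "i \<in> T (r i)" if "i \<in> S" for i using that by (simp add: T_def)
  have u0: "0 \<le> u n i" if "i \<in> S" for n i using v0[OF inT[OF that]] by (simp add: u_def)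
  have ev: "\<forall>\<^sub>F n in sequentially. u (Suc n) i \<le> (\<Sum>j\<in>S. a j * u n j)" if i: "i \<in> S" and a: "a \<in> R i" for i a
  proof -
    have a0: "0 \<le> a j" if "j \<in> S" for j using rs i a that by (auto simp: row_system_def)
    have sum0: "0 \<le> (\<Sum>j\<in>S. a j * u n j)" for n by (intro sum_nonneg mult_nonneg_nonneg a0 u0)
    consider "r i = 0" | "r i \<noteq> 0" "a \<in> R' i" | j where "r i \<noteq> 0" "j \<in> S" "a j \<noteq> 0" "r i < r j"
      using i a by (force simp: R'_def)
    then show ?thesis
    proof cases
      case 1
      then have "u (Suc n) i = 0" for n by (simp add: u_def)
      then show ?thesis using sum0 by simp
    next
      case 2
      have "u (Suc n) i \<le> (\<Sum>j\<in>S. a j * u n j)" for n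
      proof -
        have "u (Suc n) i = minop (T (r i)) R' (v (r i) n) i" using 2 by (simp add: u_def v_def[abs_def])
        also have "\<dots> \<le> (\<Sum>j\<in>T (r i). a j * v (r i) n j)" by (rule minop_le[OF rsT inT[OF i] 2(2)])
        also have "\<dots> = (\<Sum>j\<in>T (r i). a j * u n j)" using 2 by (intro sum.cong) (auto simp: u_def T_def)
        also have "\<dots> \<le> (\<Sum>j\<in>S. a j * u n j)" by (rule sum_mono2[OF fin TS]) (use a0 u0 in auto)
        finally show ?thesis .
      qed
      then show ?thesis by simp
    next
      case 3
      have ri: "0 < r i" "0 < r j" using 3 ty(1)[OF i] by auto
      have aj: "0 < a j" using a0[OF 3(2)] 3(3) by simp
      obtain q n1 where q: "0 < q" "\<And>n. n1 \<le> n \<Longrightarrow> pe (r j) (l j) n \<le> q * v (r j) n j"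
        using growth_leE[OF vlow[OF ri(2) inT[OF 3(2)]]] by blast
      obtain q' where q': "q' > 0" "\<forall>n. v (r i) n i \<le> q' * pe (r i) (l i) n"
        using growth_le_all[OF vup[OF inT[OF i]]] pe_pos[OF ri(1)] by blast
      have "growth_le (\<lambda>n. pe (r i) (l i) (n + 1)) (pe (r i) (l i))"
        using pe_shift[of "r i" "l i" 1] ri(1) unfolding growth_eq_def by simp
      then obtain q'' where q'': "q'' > 0" "\<forall>n. pe (r i) (l i) (n + 1) \<le> q'' * pe (r i) (l i) n"
        using growth_le_all pe_pos[OF ri(1)] by blast
      \<comment> \<open>Chosen so that the constants of the chain below multiply up to the entry:
        \<open>q' q'' e q = a j\<close>.\<close>
      define e where "e = a j / (q * q' * q'')"
      have e: "0 < e" using aj q q' q'' by (simp add: e_def)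
      have "\<forall>\<^sub>F n in sequentially. pe (r i) (l i) n \<le> e * pe (r j) (l j) n"
        by (rule pe_negligible) (use ri 3 e in auto)
      moreover have "\<forall>\<^sub>F n in sequentially. n1 \<le> n" by (rule eventually_ge_at_top)
      ultimately show ?thesis
      proof eventually_elim
        case (elim n)
        have "u (Suc n) i \<le> q' * pe (r i) (l i) (n + 1)" using q'(2) 3(1) by (simp add: u_def)
        also have "\<dots> \<le> q' * (q'' * pe (r i) (l i) n)" using q' q'' by (intro mult_left_mono) auto
        also have "\<dots> \<le> q' * (q'' * (e * pe (r j) (l j) n))" using q' q'' elim by (intro mult_left_mono) auto
        also have "\<dots> \<le> q' * (q'' * (e * (q * v (r j) n j)))"
          using q' q'' e q(2)[of n] elim by (intro mult_left_mono) auto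
        also have "\<dots> = a j * u n j" using q q' q'' ri by (simp add: e_def u_def)
        also have "\<dots> \<le> (\<Sum>j\<in>S. a j * u n j)" by (rule member_le_sum) (use 3 a0 u0 fin in auto)
        finally show ?case .
      qed
    qed
  qed
  have "\<forall>\<^sub>F n in sequentially. \<forall>i\<in>S. \<forall>a\<in>R i. u (Suc n) i \<le> (\<Sum>j\<in>S. a j * u n j)"
    by (intro eventually_ball_finite ballI fin ev) (use rs in \<open>auto simp: row_system_def\<close>)
  then obtain m where m: "\<And>n i a. n \<ge> m \<Longrightarrow> i \<in> S \<Longrightarrow> a \<in> R i \<Longrightarrow> u (Suc n) i \<le> (\<Sum>j\<in>S. a j * u n j)"
    unfolding eventually_sequentially by blast
  have "\<exists>c>0. \<forall>n. \<forall>i\<in>S. c * u (m + n) i \<le> (minop S R ^^ n) (\<lambda>_. 1) i"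
  proof (rule minop_iter_ge_sub[OF rs])
    fix n i assume "n \<ge> m" "i \<in> S"
    then show "u (Suc n) i \<le> minop S R (u n) i" by (intro minop_ge[OF rs] m) auto
  qed simp
  then obtain c where c: "c > 0" "\<And>n i. i \<in> S \<Longrightarrow> c * u (m + n) i \<le> (minop S R ^^ n) (\<lambda>_. 1) i" by blast
  have f0: "0 \<le> (minop S R ^^ n) (\<lambda>_. 1) i" for n using c u0[OF i, of "m + n"] i by (meson less_imp_le mult_nonneg_nonneg order_trans)
  show ?thesis
  proof (cases "r i = 0")
    case True
    obtain q n1 where q: "0 < q" "\<And>n. n1 \<le> n \<Longrightarrow> it S B n (\<lambda>_. 1) i \<le> q * pe (r i) (l i) n"
      using growth_leE[OF tyu[OF i]] by blast
    show ?thesis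
    proof (rule growth_leI[of 1 "max 1 n1"])
      fix n assume n: "max 1 n1 \<le> n"
      then have "it S B n (\<lambda>_. 1) i \<le> 0" using q(2)[of n] True by (simp add: pe_def power_0_left)
      then show "it S B n (\<lambda>_. 1) i \<le> 1 * (minop S R ^^ n) (\<lambda>_. 1) i" using f0[of n] by simp
    qed simp
  next
    case False
    then have ri: "0 < r i" using ty(1)[OF i] by simp
    note tyu[OF i]
    also have "growth_le (pe (r i) (l i)) (\<lambda>n. pe (r i) (l i) (n + m))"
      using pe_shift[of "r i"] ri unfolding growth_eq_def by simp
    also have "growth_le (\<lambda>n. pe (r i) (l i) (n + m)) (\<lambda>n. v (r i) (n + m) i)"
      by (rule growth_le_shift[OF vlow[OF ri inT[OF i]]])
    also have "growth_le (\<lambda>n. v (r i) (n + m) i) (\<lambda>n. (minop S R ^^ n) (\<lambda>_. 1) i)"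
      by (rule growth_leI[of "1 / c" 0])
        (use c(1) c(2)[OF i] False in \<open>auto simp: u_def pos_le_divide_eq add.commute mult.commute\<close>)
    finally (growth_le_trans) show ?thesis .
  qed
qed

subsection \<open>Translation to matrices\<close>

lemma minop_cong: "(\<And>j. j \<in> T \<Longrightarrow> x j = y j) \<Longrightarrow> minop T R x i = minop T R y i"
  by (simp add: minop_def)

lemma minop_iter_mono:
  assumes "row_system T R" "\<And>j. j \<in> T \<Longrightarrow> x j \<le> y j" "i \<in> T"
  shows "(minop T R ^^ n) x i \<le> (minop T R ^^ n) y i"
  using assms(3)
proof (induction n arbitrary: i)
  case 0
  then show ?case using assms by simp
next
  case (Suc n)
  show ?case using minop_mono[OF assms(1) Suc.IH Suc.prems] by simp
qed

lemma minop_iter_cmult_ge: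
  assumes "row_system T R" "i \<in> T" "0 \<le> c"
  shows "c * (minop T R ^^ n) x i \<le> (minop T R ^^ n) (\<lambda>j. c * x j) i"
  using assms(2)
proof (induction n arbitrary: i)
  case 0
  then show ?case by simp
next
  case (Suc n)
  have "c * minop T R ((minop T R ^^ n) x) i \<le> minop T R (\<lambda>j. c * (minop T R ^^ n) x j) i"
    by (rule minop_cmult_ge[OF assms(1) Suc.prems assms(3)])
  also have "\<dots> \<le> minop T R ((minop T R ^^ n) (\<lambda>j. c * x j)) i"
    by (rule minop_mono[OF assms(1) Suc.IH Suc.prems])
  finally show ?case by simp
qed

lemma positive_vectors_comparable:
  fixes x y :: "'a \<Rightarrow> real"
  assumes "finite T" "\<And>j. j \<in> T \<Longrightarrow> 0 < y j"
  shows "\<exists>c>0. \<forall>j\<in>T. c * x j \<le> y j"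
proof -
  obtain K where K: "K > 0" "\<forall>j\<in>T. x j / y j \<le> K" using finite_upper[OF assms(1), of "\<lambda>j. x j / y j"] by blast
  show ?thesis
  proof (intro exI[of _ "1 / K"] conjI ballI)
    fix j assume j: "j \<in> T"
    then have "x j \<le> K * y j" using K assms(2)[OF j] by (auto simp: pos_divide_le_eq)
    then show "1 / K * x j \<le> y j" using K by (simp add: pos_divide_le_eq mult.commute)
  qed (use K in simp)
qed

text \<open>Any start lies below a multiple of a positive one, and monotonicity with scaling
  preserves this. So results for the constant vector 1 carry over to every positive vector.\<close>

lemma minop_iter_growth_cong:
  assumes rs: "row_system T R" and y: "\<And>j. j \<in> T \<Longrightarrow> 0 < y j" and i: "i \<in> T"
  shows "growth_le (\<lambda>n. (minop T R ^^ n) x i) (\<lambda>n. (minop T R ^^ n) y i)"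
proof -
  have "finite T" using rs by (simp add: row_system_def)
  then obtain c where c: "c > 0" "\<forall>j\<in>T. c * x j \<le> y j" using positive_vectors_comparable y by blast
  show ?thesis
  proof (rule growth_leI[of "1 / c" 0])
    fix n
    have "c * (minop T R ^^ n) x i \<le> (minop T R ^^ n) (\<lambda>j. c * x j) i"
      by (rule minop_iter_cmult_ge[OF rs i]) (use c in simp)
    also have "\<dots> \<le> (minop T R ^^ n) y i" by (rule minop_iter_mono[OF rs _ i]) (use c in simp)
    finally show "(minop T R ^^ n) x i \<le> 1 / c * (minop T R ^^ n) y i"
      using c by (simp add: pos_le_divide_eq mult.commute)
  qed (use c in simp)
qed

lemma it_growth_cong:
  assumes fin: "finite T" and nn: "nonneg_on T A" and y: "\<And>j. j \<in> T \<Longrightarrow> 0 < y j" and i: "i \<in> T"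
  shows "growth_le (\<lambda>n. it T A n x i) (\<lambda>n. it T A n y i)"
proof -
  obtain c where c: "c > 0" "\<forall>j\<in>T. c * x j \<le> y j" using positive_vectors_comparable[OF fin] y by blast
  show ?thesis
  proof (rule growth_leI[of "1 / c" 0])
    fix n
    have "it T A n (\<lambda>j. c * x j) i \<le> it T A n y i" by (rule it_mono[OF nn _ i]) (use c in simp)
    then show "it T A n x i \<le> 1 / c * it T A n y i"
      using c by (simp add: it_cmult pos_le_divide_eq mult.commute)
  qed (use c in simp)
qed

abbreviation fn :: "real mat \<Rightarrow> nat \<Rightarrow> nat \<Rightarrow> real" where
  "fn A \<equiv> \<lambda>i j. A $$ (i, j)"

lemma mult_mat_vec_eq_ap:
  assumes "A \<in> carrier_mat N N" "v \<in> carrier_vec N" "i < N"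
  shows "(A *\<^sub>v v) $ i = ap {0..<N} (fn A) (\<lambda>j. v $ j) i"
  using assms by (auto simp: ap_def scalar_prod_def intro!: sum.cong)

lemma pow_mat_vec_eq_it:
  assumes A: "A \<in> carrier_mat N N" and v: "v \<in> carrier_vec N" and i: "i < N"
  shows "((A ^\<^sub>m n) *\<^sub>v v) $ i = it {0..<N} (fn A) n (\<lambda>j. v $ j) i"
  using v i
proof (induction n arbitrary: v i)
  case 0
  then show ?case using A by simp
next
  case (Suc n)
  have Av: "A *\<^sub>v v \<in> carrier_vec N" using A Suc.prems by simp
  have "(A ^\<^sub>m Suc n) *\<^sub>v v = (A ^\<^sub>m n) *\<^sub>v (A *\<^sub>v v)"
    using A Suc.prems by (simp add: assoc_mult_mat_vec[of _ N N _ N])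
  then have "((A ^\<^sub>m Suc n) *\<^sub>v v) $ i = it {0..<N} (fn A) n (\<lambda>j. (A *\<^sub>v v) $ j) i"
    using Suc.IH[OF Av Suc.prems(2)] by simp
  also have "\<dots> = it {0..<N} (fn A) n (ap {0..<N} (fn A) (\<lambda>j. v $ j)) i"
    by (rule it_cong) (use Suc.prems mult_mat_vec_eq_ap[OF A Suc.prems(1)] in auto)
  finally show ?case unfolding it_Suc_inner .
qed

lemma nonneg_mat_nonneg_on:
  assumes "nonneg_mat A" "A \<in> carrier_mat N N"
  shows "nonneg_on {0..<N} (fn A)"
  using assms by (auto simp: nonneg_mat_def nonneg_on_def less_eq_mat_def)

definition row_choices :: "real mat set \<Rightarrow> nat \<Rightarrow> (nat \<Rightarrow> real) set" where
  "row_choices K i = (\<lambda>A. fn A i) ` K"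

lemma row_system_row_choices:
  assumes "finite K" "K \<noteq> {}" "K \<subseteq> carrier_mat N N" "\<And>A. A \<in> K \<Longrightarrow> nonneg_mat A"
  shows "row_system {0..<N} (row_choices K)"
  unfolding row_system_def row_choices_def
proof (intro conjI ballI)
  fix i a j assume i: "i \<in> {0..<N}" and a: "a \<in> (\<lambda>A. fn A i) ` K" and j: "j \<in> {0..<N}"
  from a obtain A where A: "A \<in> K" "a = fn A i" by blast
  have "nonneg_on {0..<N} (fn A)" by (rule nonneg_mat_nonneg_on) (use A assms(3,4) in auto)
  from nonneg_onD[OF this i j] show "0 \<le> a j" using A(2) by simp
qed (use assms in auto)

text \<open>Rows are exchanged one at a time: the product property with \<open>V = {m}\<close>
  inserts row \<open>m\<close>. Agreement is claimed for indices below \<open>N\<close> only,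
  because a policy is a function on all natural numbers.\<close>

lemma policy_in_product:
  assumes pp: "product_property N K" and K: "K \<noteq> {}"
    and D: "policy {0..<N} (row_choices K) D"
  shows "\<exists>A\<in>K. \<forall>i<N. \<forall>j<N. A $$ (i, j) = D i j"
proof -
  have "m \<le> N \<Longrightarrow> \<exists>A\<in>K. \<forall>i<m. \<forall>j<N. A $$ (i, j) = D i j" for m
  proof (induction m)
    case 0
    then show ?case using K by auto
  next
    case (Suc m)
    then obtain A where A: "A \<in> K" "\<forall>i<m. \<forall>j<N. A $$ (i, j) = D i j" by auto
    have "D m \<in> row_choices K m" using D Suc.prems by (simp add: policy_def)
    then obtain A' where A': "A' \<in> K" "D m = fn A' m" unfolding row_choices_def by blast
    let ?M = "mat N N (\<lambda>(i, j). if i \<in> {m} then A' $$ (i, j) else A $$ (i, j))"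
    have "{m} \<subseteq> {0..<N}" using Suc.prems by simp
    then have "?M \<in> K" using pp A(1) A'(1) unfolding product_property_def by blast
    moreover have "\<forall>i<Suc m. \<forall>j<N. ?M $$ (i, j) = D i j"
      using A(2) A'(2) Suc.prems by (auto simp: less_Suc_eq)
    ultimately show ?case by blast
  qed
  then show ?thesis by blast
qed

lemma min_map_eq_minop:
  assumes "K \<subseteq> carrier_mat N N" "v \<in> carrier_vec N" "i < N"
  shows "min_map K v $ i = minop {0..<N} (row_choices K) (\<lambda>j. v $ j) i"
proof -
  have "(\<lambda>A. (A *\<^sub>v v) $ i) ` K = (\<lambda>A. \<Sum>j\<in>{0..<N}. A $$ (i, j) * v $ j) ` K"
    by (rule image_cong[OF refl]) (use mult_mat_vec_eq_ap[OF _ assms(2,3)] assms(1) in \<open>auto simp: ap_def\<close>)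
  then show ?thesis using assms(2,3) by (simp add: min_map_def minop_def row_choices_def image_image)
qed

lemma min_map_iter:
  assumes K: "K \<subseteq> carrier_mat N N" and v: "v \<in> carrier_vec N"
  shows "(min_map K ^^ n) v \<in> carrier_vec N \<and>
    (\<forall>i<N. (min_map K ^^ n) v $ i = (minop {0..<N} (row_choices K) ^^ n) (\<lambda>j. v $ j) i)"
proof (induction n)
  case 0
  then show ?case using v by simp
next
  case (Suc n)
  let ?v = "(min_map K ^^ n) v"
  have vN: "?v \<in> carrier_vec N" and IH: "\<And>i. i < N \<Longrightarrow> ?v $ i = (minop {0..<N} (row_choices K) ^^ n) (\<lambda>j. v $ j) i"
    using Suc by blast+
  have "min_map K ?v \<in> carrier_vec N" using carrier_vecD[OF vN] by (intro carrier_vecI) (simp add: min_map_def)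
  moreover have "min_map K ?v $ i = minop {0..<N} (row_choices K) ((minop {0..<N} (row_choices K) ^^ n) (\<lambda>j. v $ j)) i"
    if "i < N" for i
  proof -
    have "min_map K ?v $ i = minop {0..<N} (row_choices K) (\<lambda>j. ?v $ j) i"
      by (rule min_map_eq_minop[OF K vN that])
    also have "\<dots> = minop {0..<N} (row_choices K) ((minop {0..<N} (row_choices K) ^^ n) (\<lambda>j. v $ j)) i"
      by (rule minop_cong) (use IH in simp)
    finally show ?thesis .
  qed
  ultimately show ?case by simp
qed

text \<open>Minimality is tested against matrices of \<open>K\<close>, and
  \<open>policy_in_product\<close> realizes every policy by one of them.\<close>

lemma growth_minimal_policy:
  assumes K: "K \<noteq> {}" "K \<subseteq> carrier_mat N N" and pp: "product_property N K"
    and B: "growth_minimal N K B" and D: "policy {0..<N} (row_choices K) D" and i: "i < N"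
  shows "growth_le (\<lambda>n. it {0..<N} (fn B) n (\<lambda>_. 1) i) (\<lambda>n. it {0..<N} D n (\<lambda>_. 1) i)"
proof -
  obtain A where A: "A \<in> K" "\<forall>i<N. \<forall>j<N. A $$ (i, j) = D i j" using policy_in_product[OF pp K(1) D] by blast
  define v where "v = vec N (\<lambda>_. 1 :: real)"
  have v: "v \<in> carrier_vec N" "pos_vec v" by (auto simp: v_def pos_vec_def)
  have BK: "B \<in> K" using B by (simp add: growth_minimal_def)
  have "vec_growth_le (\<lambda>n. (B ^\<^sub>m n) *\<^sub>v v) (\<lambda>n. (A ^\<^sub>m n) *\<^sub>v v)"
    using B A(1) v unfolding growth_minimal_def by blast
  then obtain q n0 where q: "0 < q" "\<And>n. n0 \<le> n \<Longrightarrow> (B ^\<^sub>m n) *\<^sub>v v \<le> q \<cdot>\<^sub>v ((A ^\<^sub>m n) *\<^sub>v v)"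
    unfolding vec_growth_le_def eventually_sequentially by blast
  have one: "it {0..<N} M n (\<lambda>j. v $ j) i = it {0..<N} M n (\<lambda>_. 1) i" for M n
    by (rule it_cong) (use i in \<open>auto simp: v_def\<close>)
  have AD: "it {0..<N} (fn A) n (\<lambda>_. 1) i = it {0..<N} D n (\<lambda>_. 1) i" for n
    by (rule it_cong) (use A(2) i in auto)
  show ?thesis
  proof (rule growth_leI[OF q(1), of n0])
    fix n assume "n0 \<le> n"
    have Ac: "A \<in> carrier_mat N N" and Bc: "B \<in> carrier_mat N N" using A(1) BK K(2) by auto
    have "((B ^\<^sub>m n) *\<^sub>v v) $ i \<le> (q \<cdot>\<^sub>v ((A ^\<^sub>m n) *\<^sub>v v)) $ i"
      using q(2)[OF \<open>n0 \<le> n\<close>] i Ac pow_carrier_mat[OF Ac, of n] by (auto simp: less_eq_vec_def)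
    also have "\<dots> = q * ((A ^\<^sub>m n) *\<^sub>v v) $ i"
      using i pow_carrier_mat[OF Ac, of n] by (intro index_smult_vec) auto
    finally show "it {0..<N} (fn B) n (\<lambda>_. 1) i \<le> q * it {0..<N} D n (\<lambda>_. 1) i"
      unfolding pow_mat_vec_eq_it[OF Ac v(1) i] pow_mat_vec_eq_it[OF Bc v(1) i] one AD .
  qed
qed

subsection \<open>Classes, spectral radii and depth\<close>

text \<open>A positive eigenvector \<open>w\<close> controls every other eigenvector
  \<open>v\<close>: at an index where the ratio of the modulus of \<open>v\<close> to
  \<open>w\<close> is largest, the triangle inequality bounds the modulus of the eigenvalue of
  \<open>v\<close> by \<open>\<rho>\<close>.\<close>

lemma spr_perron:
  assumes M: "M \<in> carrier_mat n n" and nn: "nonneg_on {0..<n} (fn M)" and n: "0 < n"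
    and w: "\<And>i. i < n \<Longrightarrow> 0 < w i" and \<rho>: "0 \<le> \<rho>"
    and Mw: "\<And>i. i < n \<Longrightarrow> ap {0..<n} (fn M) w i = \<rho> * w i"
  shows "spr M = \<rho>"
proof -
  let ?c = complex_of_real
  let ?M = "map_mat ?c M"
  have cM: "?M \<in> carrier_mat n n" using M by simp
  note max = spectral_radius_mem_max[OF cM n]
  have "\<rho> \<le> spectral_radius ?M"
  proof -
    let ?w = "vec n (\<lambda>i. ?c (w i))"
    have "?M *\<^sub>v ?w = ?c \<rho> \<cdot>\<^sub>v ?w"
    proof (rule eq_vecI)
      fix i assume "i < dim_vec (?c \<rho> \<cdot>\<^sub>v ?w)"
      then have i: "i < n" by simp
      have "(?M *\<^sub>v ?w) $ i = (\<Sum>j\<in>{0..<n}. ?c (M $$ (i, j)) * ?c (w j))"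
        using i M by (auto simp: scalar_prod_def intro!: sum.cong)
      also have "\<dots> = ?c (ap {0..<n} (fn M) w i)" by (simp add: ap_def)
      finally show "(?M *\<^sub>v ?w) $ i = (?c \<rho> \<cdot>\<^sub>v ?w) $ i" using i Mw[OF i] by simp
    qed (use M in simp)
    moreover have "?w \<noteq> 0\<^sub>v n"
    proof
      assume "?w = 0\<^sub>v n"
      then have "?w $ 0 = 0" using n by simp
      then show False using w[OF n] n by simp
    qed
    ultimately have "eigenvector ?M ?w (?c \<rho>)" using M unfolding eigenvector_def by simp
    then have "?c \<rho> \<in> spectrum ?M" unfolding spectrum_def eigenvalue_def by blast
    then have "norm (?c \<rho>) \<le> spectral_radius ?M" by (intro max(2)) blast
    then show ?thesis using \<rho> by simp
  qed
  moreover have "spectral_radius ?M \<le> \<rho>"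
  proof -
    obtain k where k: "k \<in> spectrum ?M" "spectral_radius ?M = norm k" using max(1) by blast
    then obtain v where v: "v \<in> carrier_vec n" "v \<noteq> 0\<^sub>v n" "?M *\<^sub>v v = k \<cdot>\<^sub>v v"
      using M unfolding spectrum_def eigenvalue_def eigenvector_def by auto
    define q where "q j = norm (v $ j) / w j" for j
    define t where "t = Max (q ` {0..<n})"
    have "t \<in> q ` {0..<n}" unfolding t_def by (rule Max_in) (use n in auto)
    then obtain i where i: "i < n" "t = q i" by auto
    have qt: "norm (v $ j) \<le> t * w j" if "j < n" for j
    proof -
      have "q j \<le> t" unfolding t_def using that by simp
      then show ?thesis using w[OF that] by (simp add: q_def pos_divide_le_eq)
    qed
    have tpos: "0 < t"
    proof -
      obtain j where j: "j < n" "v $ j \<noteq> 0" using v(1,2) by (metis eq_vecI carrier_vecD index_zero_vec)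
      then have "0 < t * w j" using qt[OF j(1)] by (smt (verit) zero_less_norm_iff)
      then show ?thesis using w[OF j(1)] by (simp add: zero_less_mult_iff)
    qed
    have "norm k * (t * w i) = norm ((k \<cdot>\<^sub>v v) $ i)" using i w[OF i(1)] v(1) by (simp add: q_def norm_mult)
    also have "(k \<cdot>\<^sub>v v) $ i = (\<Sum>j\<in>{0..<n}. ?c (M $$ (i, j)) * v $ j)"
      unfolding v(3)[symmetric] using i M v(1) by (auto simp: scalar_prod_def intro!: sum.cong)
    also have "norm \<dots> \<le> (\<Sum>j\<in>{0..<n}. norm (?c (M $$ (i, j)) * v $ j))" by (rule norm_sum)
    also have "\<dots> \<le> (\<Sum>j\<in>{0..<n}. M $$ (i, j) * (t * w j))"
    proof (rule sum_mono)
      fix j assume j: "j \<in> {0..<n}"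
      have "0 \<le> M $$ (i, j)" using nonneg_onD[OF nn, of i j] i j by simp
      then show "norm (?c (M $$ (i, j)) * v $ j) \<le> M $$ (i, j) * (t * w j)"
        using qt[of j] j by (simp add: norm_mult mult_left_mono)
    qed
    also have "\<dots> = t * ap {0..<n} (fn M) w i" by (simp add: ap_def sum_distrib_left mult_ac)
    also have "\<dots> = \<rho> * (t * w i)" using Mw[OF i(1)] by simp
    finally show ?thesis using tpos w[OF i(1)] k(2) by simp
  qed
  ultimately show ?thesis unfolding spr_def by simp
qed

text \<open>\<open>A / s\<close> has spectral radius below 1, hence bounded powers by its Jordan
  normal form. The bound is crude but suffices to exclude classes with a Perron root above
  \<open>spr A\<close>.\<close>

lemma growth_le_above_spr:
  assumes A: "A \<in> carrier_mat N N" and n: "0 < N" and nn: "nonneg_on {0..<N} (fn A)"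
    and s: "spr A < s" "0 < s" and i: "i < N"
  shows "growth_le (\<lambda>n. it {0..<N} (fn A) n (\<lambda>_. 1) i) (pe s 0)"
proof -
  let ?c = complex_of_real
  define M where "M = mat N N (\<lambda>(i, j). 1 / s * A $$ (i, j))"
  have M: "M \<in> carrier_mat N N" by (simp add: M_def)
  let ?M = "map_mat ?c M" and ?A = "map_mat ?c A"
  have cM: "?M \<in> carrier_mat N N" and cA: "?A \<in> carrier_mat N N" using M A by auto
  have "spectral_radius ?M < 1"
  proof -
    obtain k where k: "k \<in> spectrum ?M" "spectral_radius ?M = norm k" using spectral_radius_mem_max(1)[OF cM n] by blast
    then obtain v where v: "v \<in> carrier_vec N" "v \<noteq> 0\<^sub>v N" "?M *\<^sub>v v = k \<cdot>\<^sub>v v"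
      using M unfolding spectrum_def eigenvalue_def eigenvector_def by auto
    have "?A *\<^sub>v v = (?c s * k) \<cdot>\<^sub>v v"
    proof (rule eq_vecI)
      fix i assume "i < dim_vec ((?c s * k) \<cdot>\<^sub>v v)"
      then have i: "i < N" using v(1) by simp
      have "(?A *\<^sub>v v) $ i = (\<Sum>j\<in>{0..<N}. ?c s * (?c (M $$ (i, j)) * v $ j))"
        using i A v(1) s by (auto simp: scalar_prod_def M_def intro!: sum.cong)
      also have "\<dots> = ?c s * (?M *\<^sub>v v) $ i"
        using i M v(1) by (auto simp: scalar_prod_def sum_distrib_left intro!: sum.cong)
      finally show "(?A *\<^sub>v v) $ i = ((?c s * k) \<cdot>\<^sub>v v) $ i" using i v by simp
    qed (use A v(1) in simp)
    then have "?c s * k \<in> spectrum ?A" using v A unfolding spectrum_def eigenvalue_def eigenvector_def by auto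
    then have "norm (?c s * k) \<le> spr A"
      unfolding spr_def by (intro spectral_radius_mem_max(2)[OF cA n]) blast
    then have "s * norm k \<le> spr A" using s by (simp add: norm_mult)
    then have "s * norm k < s * 1" using s by linarith
    then have "norm k < 1" using s(2) by (simp only: mult_less_cancel_left_pos)
    then show ?thesis using k by simp
  qed
  then obtain c where c: "\<And>k. norm_bound (?M ^\<^sub>m k) c"
    using spectral_radius_jnf_norm_bound_less_1_upper_triangular[OF cM] by blast
  have entry: "(M ^\<^sub>m k) $$ (i, j) \<le> c" if "j < N" for j k
  proof -
    have "?M ^\<^sub>m k = map_mat ?c (M ^\<^sub>m k)" by (rule of_real_hom.mat_hom_pow[OF M, symmetric])
    then have "norm ((map_mat ?c (M ^\<^sub>m k)) $$ (i, j)) \<le> c"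
      using c[of k] i that cM pow_carrier_mat[OF cM, of k] unfolding norm_bound_def by auto
    then have "norm (?c ((M ^\<^sub>m k) $$ (i, j))) \<le> c"
      using i that carrier_matD[OF pow_carrier_mat[OF M, of k]] by simp
    then show ?thesis by simp
  qed
  define v where "v = vec N (\<lambda>_. 1 :: real)"
  have v: "v \<in> carrier_vec N" by (simp add: v_def)
  have "it {0..<N} (fn A) k (\<lambda>_. 1) i \<le> (real N * c) * pe s 0 k" for k
  proof -
    have "it {0..<N} (\<lambda>i j. 1 / s * fn A i j) k (\<lambda>_. 1) i = it {0..<N} (fn M) k (\<lambda>j. v $ j) i"
      by (rule it_cong) (use i in \<open>auto simp: M_def v_def\<close>)
    also have "\<dots> = ((M ^\<^sub>m k) *\<^sub>v v) $ i" by (rule pow_mat_vec_eq_it[OF M v i, symmetric])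
    also have "\<dots> = (\<Sum>j\<in>{0..<N}. (M ^\<^sub>m k) $$ (i, j))"
      using i carrier_matD[OF pow_carrier_mat[OF M, of k]] by (simp add: scalar_prod_def v_def)
    also have "\<dots> \<le> (\<Sum>j\<in>{0..<N}. c)" by (rule sum_mono) (use entry in auto)
    also have "\<dots> = real N * c" by simp
    finally have "(1 / s) ^ k * it {0..<N} (fn A) k (\<lambda>_. 1) i \<le> real N * c" unfolding it_scale .
    then show ?thesis using s by (simp add: pe_def power_divide pos_divide_le_eq)
  qed
  then have "growth_le (\<lambda>n. it {0..<N} (fn A) n (\<lambda>_. 1) i) (\<lambda>k. max 1 (real N * c) * pe s 0 k)"
    by (intro growth_le_mono order_trans[OF _ mult_right_mono[OF max.cobounded2]]) (auto simp: pe_nonneg s less_imp_le)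
  also have "growth_le (\<lambda>k. max 1 (real N * c) * pe s 0 k) (pe s 0)" by (rule growth_le_cmult) simp
  finally (growth_le_trans) show ?thesis .
qed

text \<open>The entry \<open>(i, j)\<close> of a power is the iterate on the unit vector of
  \<open>j\<close>, evaluated at \<open>i\<close>. The power 0 in \<open>has_access\<close> matches
  the reflexive closure.\<close>

lemma pow_entry_pos_iff:
  assumes A: "A \<in> carrier_mat N N" and nn: "nonneg_on {0..<N} (fn A)" and ij: "i < N" "j < N"
  shows "has_access A i j \<longleftrightarrow> (i, j) \<in> (edges {0..<N} (fn A))\<^sup>*"
proof -
  have entry: "(A ^\<^sub>m n) $$ (i, j) = it {0..<N} (fn A) n (\<lambda>k. if k = j then 1 else 0) i" if "i < N" "j < N" for i j n
  proof -
    have "(A ^\<^sub>m n) $$ (i, j) = ((A ^\<^sub>m n) *\<^sub>v unit_vec N j) $ i"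
    proof -
      have "(A ^\<^sub>m n) \<in> carrier_mat N N" by (rule pow_carrier_mat[OF A])
      then have d: "dim_row (A ^\<^sub>m n) = N" "dim_col (A ^\<^sub>m n) = N" by auto
      then have "((A ^\<^sub>m n) *\<^sub>v unit_vec N j) $ i = row (A ^\<^sub>m n) i \<bullet> unit_vec N j" using that by simp
      also have "\<dots> = row (A ^\<^sub>m n) i $ j" by (rule scalar_prod_right_unit[OF that(2)])
      finally show ?thesis using d that by simp
    qed
    also have "\<dots> = it {0..<N} (fn A) n (\<lambda>k. unit_vec N j $ k) i" by (rule pow_mat_vec_eq_it[OF A _ that(1)]) simp
    also have "\<dots> = it {0..<N} (fn A) n (\<lambda>k. if k = j then 1 else 0) i"
      by (rule it_cong) (use that in \<open>auto simp: unit_vec_def\<close>)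
    finally show ?thesis .
  qed
  show ?thesis
  proof
    assume "has_access A i j"
    then obtain n where n: "0 < it {0..<N} (fn A) n (\<lambda>k. if k = j then 1 else 0) i"
      using entry[OF ij] unfolding has_access_def by auto
    then show "(i, j) \<in> (edges {0..<N} (fn A))\<^sup>*" using ij(1)
    proof (induction n arbitrary: i)
      case 0
      then show ?case by (simp split: if_splits)
    next
      case (Suc n)
      let ?x = "it {0..<N} (fn A) n (\<lambda>k. if k = j then 1 else 0)"
      have "\<exists>k\<in>{0..<N}. 0 < A $$ (i, k) * ?x k"
      proof (rule ccontr)
        assume "\<not> ?thesis"
        then have "(\<Sum>k\<in>{0..<N}. A $$ (i, k) * ?x k) \<le> 0" by (intro sum_nonpos) force
        then show False using Suc.prems(1) unfolding it_Suc by simp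
      qed
      then obtain k where k: "k < N" "0 < A $$ (i, k) * ?x k" by auto
      have "0 \<le> A $$ (i, k)" using nonneg_onD[OF nn, of i k] Suc.prems k by simp
      then have "0 < A $$ (i, k)" "0 < ?x k" using k(2) by (auto simp: zero_less_mult_iff)
      then show ?case using Suc.IH[of k] k(1) Suc.prems(2)
        by (intro converse_rtrancl_into_rtrancl[of i k]) (auto simp: edges_def)
    qed
  next
    assume p: "(i, j) \<in> (edges {0..<N} (fn A))\<^sup>*"
    have "\<exists>n. 0 < it {0..<N} (fn A) n (\<lambda>k. if k = j then 1 else 0) i"
      by (rule path_it_pos[OF _ nn _ _ p]) auto
    then show "has_access A i j" unfolding has_access_def using entry[OF ij] by auto
  qed
qed

lemma pick_bij:
  assumes "finite C"
  shows "bij_betw (pick C) {0..<card C} C"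
proof (rule bij_betw_byWitness[of _ "\<lambda>i. card {a \<in> C. a < i}"])
  show "\<forall>i\<in>{0..<card C}. card {a \<in> C. a < pick C i} = i" by (simp add: card_pick_le)
  show "\<forall>i\<in>C. pick C (card {a \<in> C. a < i}) = i" by (simp add: pick_card_in_set)
  show "pick C ` {0..<card C} \<subseteq> C" using pick_in_set_le by auto
  show "(\<lambda>i. card {a \<in> C. a < i}) ` C \<subseteq> {0..<card C}"
    using assms by (auto intro!: psubset_card_mono)
qed

lemma submatrix_fn:
  assumes A: "A \<in> carrier_mat N N" and C: "C \<subseteq> {0..<N}"
  shows "submatrix A C C \<in> carrier_mat (card C) (card C)"
    and "p < card C \<Longrightarrow> q < card C \<Longrightarrow> submatrix A C C $$ (p, q) = A $$ (pick C p, pick C q)"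
proof -
  have eq: "{i. i < N \<and> i \<in> C} = C" using C by auto
  show "submatrix A C C \<in> carrier_mat (card C) (card C)"
    by (rule carrier_matI) (use A eq in \<open>auto simp: dim_submatrix\<close>)
  show "p < card C \<Longrightarrow> q < card C \<Longrightarrow> submatrix A C C $$ (p, q) = A $$ (pick C p, pick C q)"
    by (rule submatrix_index) (use A eq in auto)
qed

text \<open>\<open>pick C\<close> is a bijection that carries edges to edges, so paths of the
  re-indexed submatrix correspond to paths inside \<open>C\<close>.\<close>

lemma irreducible_submatrix_iff:
  assumes A: "A \<in> carrier_mat N N" and nn: "nonneg_on {0..<N} (fn A)" and C: "C \<subseteq> {0..<N}"
  shows "irreducible_nonneg (submatrix A C C) \<longleftrightarrow> (\<forall>i\<in>C. \<forall>j\<in>C. (i, j) \<in> (edges C (fn A))\<^sup>*)"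
proof -
  let ?M = "submatrix A C C" and ?n = "card C"
  have fin: "finite C" using C finite_subset by blast
  have bij: "bij_betw (pick C) {0..<?n} C" by (rule pick_bij[OF fin])
  have inC: "pick C p \<in> C" if "p < ?n" for p using bij_betwE[OF bij] that by simp
  note M = submatrix_fn[OF A C]
  have nnM: "nonneg_on {0..<?n} (fn ?M)"
    unfolding nonneg_on_def using nonneg_onD[OF nn] inC C by (auto simp: M(2)) (metis atLeastLessThan_iff subsetD)
  have edge: "(p, q) \<in> edges {0..<?n} (fn ?M) \<longleftrightarrow> (pick C p, pick C q) \<in> edges C (fn A)"
    if "p < ?n" "q < ?n" for p q using that inC by (auto simp: edges_def M(2))
  have fwd: "(pick C p, pick C q) \<in> (edges C (fn A))\<^sup>*" if "(p, q) \<in> (edges {0..<?n} (fn ?M))\<^sup>*" for p q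
    using that
  proof (induction rule: rtrancl_induct)
    case (step q q')
    then have "q < ?n" "q' < ?n" by (auto simp: edges_def)
    then have "(pick C q, pick C q') \<in> edges C (fn A)" using edge step(2) by blast
    with step(3) show ?case by (rule rtrancl_into_rtrancl)
  qed simp
  have bwd: "(p, q) \<in> (edges {0..<?n} (fn ?M))\<^sup>*"
    if "(pick C p, j) \<in> (edges C (fn A))\<^sup>*" "p < ?n" "q < ?n" "j = pick C q" for p q j
    using that(1,3,4)
  proof (induction arbitrary: q rule: rtrancl_induct)
    case base
    then have "p = q" using bij that(2) unfolding bij_betw_def inj_on_def by simp
    then show ?case by simp
  next
    case (step j j')
    have "j \<in> C" using step(2) by (simp add: edges_def)
    then have "j \<in> pick C ` {0..<?n}" using bij unfolding bij_betw_def by blast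
    then obtain q' where q': "q' < ?n" "j = pick C q'" by auto
    have "(p, q') \<in> (edges {0..<?n} (fn ?M))\<^sup>*" by (rule step.IH[OF q'])
    moreover have "(q', q) \<in> edges {0..<?n} (fn ?M)" using edge[OF q'(1) step.prems(1)] step(2) q'(2) step.prems(2) by simp
    ultimately show ?case by (rule rtrancl_into_rtrancl)
  qed
  have "irreducible_nonneg ?M \<longleftrightarrow> (\<forall>p<?n. \<forall>q<?n. (p, q) \<in> (edges {0..<?n} (fn ?M))\<^sup>*)"
    unfolding irreducible_nonneg_def using pow_entry_pos_iff[OF M(1) nnM] M(1) by auto
  also have "\<dots> \<longleftrightarrow> (\<forall>p<?n. \<forall>q<?n. (pick C p, pick C q) \<in> (edges C (fn A))\<^sup>*)"
    using fwd bwd by blast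
  also have "\<dots> \<longleftrightarrow> (\<forall>i\<in>C. \<forall>j\<in>C. (i, j) \<in> (edges C (fn A))\<^sup>*)"
  proof -
    have img: "C = pick C ` {0..<?n}" using bij unfolding bij_betw_def by simp
    show ?thesis by (subst (2 3) img) auto
  qed
  finally show ?thesis .
qed

lemma spr_submatrix:
  assumes A: "A \<in> carrier_mat N N" and nn: "nonneg_on {0..<N} (fn A)" and C: "C \<subseteq> {0..<N}" "C \<noteq> {}"
    and w: "\<And>i. i \<in> C \<Longrightarrow> 0 < w i" and \<rho>: "0 \<le> \<rho>" and Aw: "\<And>i. i \<in> C \<Longrightarrow> ap C (fn A) w i = \<rho> * w i"
  shows "spr (submatrix A C C) = \<rho>"
proof -
  let ?M = "submatrix A C C" and ?n = "card C"
  have fin: "finite C" using C finite_subset by blast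
  have bij: "bij_betw (pick C) {0..<?n} C" by (rule pick_bij[OF fin])
  have inC: "pick C p \<in> C" if "p < ?n" for p using bij_betwE[OF bij] that by simp
  note M = submatrix_fn[OF A C(1)]
  have nnM: "nonneg_on {0..<?n} (fn ?M)"
    unfolding nonneg_on_def using nonneg_onD[OF nn] inC C(1) by (auto simp: M(2)) (metis atLeastLessThan_iff subsetD)
  show ?thesis
  proof (rule spr_perron[OF M(1) nnM _ _ \<rho>, of "w \<circ> pick C"])
    show "0 < ?n" using fin C(2) by (simp add: card_gt_0_iff)
    fix p assume p: "p < ?n"
    then show "0 < (w \<circ> pick C) p" using w inC by simp
    have "ap {0..<?n} (fn ?M) (w \<circ> pick C) p = (\<Sum>q\<in>{0..<?n}. A $$ (pick C p, pick C q) * w (pick C q))"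
      unfolding ap_def using p by (intro sum.cong) (auto simp: M(2))
    also have "\<dots> = ap C (fn A) w (pick C p)" unfolding ap_def by (rule sum.reindex_bij_betw[OF bij])
    finally show "ap {0..<?n} (fn ?M) (w \<circ> pick C) p = \<rho> * (w \<circ> pick C) p" using Aw[OF inC[OF p]] by simp
  qed
qed

lemma rtrancl_edges_mono: "C \<subseteq> S \<Longrightarrow> (i, j) \<in> (edges C A)\<^sup>* \<Longrightarrow> (i, j) \<in> (edges S A)\<^sup>*"
  by (rule subsetD[OF rtrancl_mono]) (auto simp: edges_def)

text \<open>An irreducible set containing \<open>i\<close> lies in the component of
  \<open>i\<close>, which is irreducible itself; so maximality singles out the components.\<close>

lemma is_class_iff:
  assumes A: "A \<in> carrier_mat N N" and nn: "nonneg_on {0..<N} (fn A)"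
  shows "is_class A C \<longleftrightarrow> (\<exists>i<N. C = scc {0..<N} (fn A) i)"
proof -
  let ?S = "{0..<N}"
  have dim: "dim_row A = N" using A by auto
  note irr = irreducible_submatrix_iff[OF A nn]
  have irr_scc: "irreducible_nonneg (submatrix A (scc ?S (fn A) i) (scc ?S (fn A) i))" for i
    using scc_irreducible[of _ ?S "fn A" i] irr[OF scc_subset] by blast
  have sub_scc: "D \<subseteq> scc ?S (fn A) i" if D: "D \<subseteq> ?S" "irreducible_nonneg (submatrix A D D)" "i \<in> D" for D i
  proof
    fix j assume "j \<in> D"
    then have "(i, j) \<in> (edges D (fn A))\<^sup>*" "(j, i) \<in> (edges D (fn A))\<^sup>*" using irr[OF D(1)] D(2,3) by auto
    then show "j \<in> scc ?S (fn A) i" using rtrancl_edges_mono[OF D(1)] D(1) \<open>j \<in> D\<close> by (auto simp: scc_def)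
  qed
  show ?thesis
  proof
    assume C: "is_class A C"
    then have C: "C \<noteq> {}" "C \<subseteq> ?S" "irreducible_nonneg (submatrix A C C)"
      "\<And>D. D \<subseteq> ?S \<Longrightarrow> C \<subset> D \<Longrightarrow> \<not> irreducible_nonneg (submatrix A D D)"
      unfolding is_class_def dim by auto
    obtain i where i: "i \<in> C" using C(1) by blast
    have "C = scc ?S (fn A) i"
      using sub_scc[OF C(2,3) i] C(4)[OF scc_subset, of "fn A" i] irr_scc[of i] by blast
    then show "\<exists>i<N. C = scc ?S (fn A) i" using i C(2) by (metis atLeastLessThan_iff subsetD)
  next
    assume "\<exists>i<N. C = scc ?S (fn A) i"
    then obtain i where i: "i < N" "C = scc ?S (fn A) i" by blast
    then have iC: "i \<in> C" using self_in_scc[of i ?S] by simp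
    show "is_class A C" unfolding is_class_def dim
    proof (intro conjI allI impI)
      show "C \<noteq> {}" using iC by blast
      show "C \<subseteq> ?S" using i(2) scc_subset by simp
      show "irreducible_nonneg (submatrix A C C)" using irr_scc[of i] i(2) by simp
      fix D assume "D \<subseteq> ?S" "C \<subset> D"
      then show "\<not> irreducible_nonneg (submatrix A D D)" using sub_scc[of D i] iC i(2) by blast
    qed
  qed
qed

lemma scc_eqI: "k \<in> scc S A i \<Longrightarrow> scc S A k = scc S A i"
  unfolding scc_def using rtrancl_trans[of i k] rtrancl_trans[of k i]
  by (auto intro: rtrancl_trans)

section \<open>Depth of classes and exact growth of matrix powers\<close>

locale nonneg_matrix =
  fixes A :: "real mat" and N :: nat
  assumes A: "A \<in> carrier_mat N N" and nn: "nonneg_on {0..<N} (fn A)"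
begin

abbreviation S :: "nat set" where "S \<equiv> {0..<N}"
abbreviation cl :: "nat \<Rightarrow> nat set" where "cl i \<equiv> scc S (fn A) i"
abbreviation acc :: "nat \<Rightarrow> nat \<Rightarrow> bool" where "acc i j \<equiv> (i, j) \<in> (edges S (fn A))\<^sup>*"

lemma class_iff: "is_class A C \<longleftrightarrow> (\<exists>i<N. C = cl i)"
  by (rule is_class_iff[OF A nn])

lemma class_access_iff:
  assumes "i < N" "j < N"
  shows "class_access A (cl i) (cl j) \<longleftrightarrow> acc i j"
proof
  assume "class_access A (cl i) (cl j)"
  then obtain k m where km: "k \<in> cl i" "m \<in> cl j" "has_access A k m" unfolding class_access_def by blast
  have "k < N" "m < N" using km(1,2) by (auto simp: scc_def)
  then have "acc k m" using km(3) pow_entry_pos_iff[OF A nn] by blast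
  moreover have "acc i k" "acc m j" using km(1,2) by (auto simp: scc_def)
  ultimately show "acc i j" by (meson rtrancl_trans)
next
  assume "acc i j"
  then have "has_access A i j" using pow_entry_pos_iff[OF A nn assms] by blast
  then show "class_access A (cl i) (cl j)"
    using self_in_scc[of i S] self_in_scc[of j S] assms unfolding class_access_def by auto
qed

lemma class_access_antisym:
  assumes "is_class A C" "is_class A D" "class_access A C D" "class_access A D C"
  shows "C = D"
proof -
  obtain i j where i: "i < N" "C = cl i" and j: "j < N" "D = cl j" using assms(1,2) class_iff by auto
  have "acc i j" "acc j i" using assms(3,4) class_access_iff i j by auto
  then have "j \<in> cl i" using j(1) by (simp add: scc_def)
  then show ?thesis using scc_eqI i(2) j(2) by metis
qed

lemma class_access_trans:
  assumes "is_class A C" "is_class A D" "is_class A E" "class_access A C D" "class_access A D E"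
  shows "class_access A C E"
proof -
  obtain i j k where i: "i < N" "C = cl i" and j: "j < N" "D = cl j" and k: "k < N" "E = cl k"
    using assms(1-3) class_iff by auto
  then have "acc i j" "acc j k" using assms(4,5) class_access_iff by auto
  then have "acc i k" by (rule rtrancl_trans)
  then show ?thesis using class_access_iff i k by simp
qed

lemma chain_access:
  assumes "class_chain A Cs" "n < length Cs"
  shows "class_access A (hd Cs) (Cs ! n)"
  using assms(2)
proof (induction n)
  case 0
  have "is_class A (hd Cs)" "hd Cs = Cs ! 0" using assms(1) by (auto simp: class_chain_def hd_conv_nth)
  moreover obtain i where "i < N" "hd Cs = cl i" using calculation(1) class_iff by blast
  ultimately show ?case using class_access_iff[of i i] by simp
next
  case (Suc n)
  have "is_class A (hd Cs)" "is_class A (Cs ! n)" "is_class A (Cs ! Suc n)" "class_access A (Cs ! n) (Cs ! Suc n)"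
    using assms(1) Suc.prems by (auto simp: class_chain_def)
  moreover have "class_access A (hd Cs) (Cs ! n)" using Suc by simp
  ultimately show ?case using class_access_trans[of "hd Cs" "Cs ! n" "Cs ! Suc n"] by blast
qed

text \<open>Chains are distinct lists over the finitely many subsets of the state space. Finiteness
  gives the \<open>Max\<close> in \<open>class_depth\<close> its meaning.\<close>

lemma finite_chains: "finite {chain_length A Cs | Cs. class_chain A Cs \<and> hd Cs = C}"
proof -
  have "{Cs. class_chain A Cs} \<subseteq> {Cs. set Cs \<subseteq> Pow S \<and> distinct Cs}"
    using A by (auto simp: class_chain_def is_class_def)
  then have "finite {Cs. class_chain A Cs}"
    by (rule finite_subset) (rule finite_subset_distinct, simp)
  then have "finite (chain_length A ` {Cs. class_chain A Cs})" by simp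
  then show ?thesis by (rule finite_subset[rotated]) auto
qed

lemma chain_length_le_depth: "class_chain A Cs \<Longrightarrow> hd Cs = C \<Longrightarrow> chain_length A Cs \<le> class_depth A C"
  unfolding class_depth_def by (rule Max_ge[OF finite_chains]) auto

abbreviation bas :: "nat set \<Rightarrow> nat" where "bas C \<equiv> (if basic_class A C then 1 else 0)"

lemma chain_length_Cons: "chain_length A (C # Cs) = bas C + chain_length A Cs"
  by (simp add: chain_length_def)

lemma depth_attained:
  assumes C: "is_class A C"
  shows "\<exists>Cs. class_chain A Cs \<and> hd Cs = C \<and> chain_length A Cs = class_depth A C"
proof -
  have "class_chain A [C]" using C by (simp add: class_chain_def)
  then have "{chain_length A Cs | Cs. class_chain A Cs \<and> hd Cs = C} \<noteq> {}" by force
  from Max_in[OF finite_chains this] show ?thesis unfolding class_depth_def by auto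
qed

text \<open>Prepend \<open>C\<close> to a longest chain that starts with \<open>D\<close>. The class
  \<open>C\<close> cannot occur in it already, for then \<open>C\<close> and \<open>D\<close> would
  have access to each other and coincide.\<close>

lemma depth_ge:
  assumes C: "is_class A C" and D: "is_class A D" and CD: "C \<noteq> D" "class_access A C D"
  shows "bas C + class_depth A D \<le> class_depth A C"
proof -
  obtain Cs where Cs: "class_chain A Cs" "hd Cs = D" "chain_length A Cs = class_depth A D"
    using depth_attained[OF D] by blast
  have ne: "Cs \<noteq> []" using Cs(1) by (simp add: class_chain_def)
  have "C \<notin> set Cs"
  proof
    assume "C \<in> set Cs"
    then obtain n where "n < length Cs" "Cs ! n = C" by (auto simp: in_set_conv_nth)
    then have "class_access A D C" using chain_access[OF Cs(1)] Cs(2) by auto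
    then show False using class_access_antisym[OF C D CD(2)] CD(1) by blast
  qed
  moreover have "class_access A ((C # Cs) ! n) ((C # Cs) ! Suc n)" if "Suc n < length (C # Cs)" for n
    using that Cs(1,2) CD(2) ne by (cases n) (auto simp: class_chain_def hd_conv_nth)
  ultimately have "class_chain A (C # Cs)" using Cs(1) C unfolding class_chain_def by auto
  from chain_length_le_depth[OF this] show ?thesis using Cs(3) by (simp add: chain_length_Cons)
qed

text \<open>Remove the head of a longest chain. With \<open>depth_ge\<close> this gives the
  recursion that depth shares with growth types.\<close>

lemma depth_le:
  assumes C: "is_class A C"
  shows "class_depth A C = bas C \<or>
    (\<exists>D. is_class A D \<and> C \<noteq> D \<and> class_access A C D \<and> class_depth A C \<le> bas C + class_depth A D)"
proof -
  obtain Cs where Cs: "class_chain A Cs" "hd Cs = C" "chain_length A Cs = class_depth A C"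
    using depth_attained[OF C] by blast
  then obtain Ds where Ds: "Cs = C # Ds" by (cases Cs) (auto simp: class_chain_def)
  show ?thesis
  proof (cases "Ds = []")
    case True
    then show ?thesis using Cs Ds by (simp add: chain_length_def split: if_splits)
  next
    case False
    then have hd: "hd Ds = Ds ! 0" "hd Ds \<in> set Ds" by (auto simp: hd_conv_nth)
    have ch: "class_chain A Ds" unfolding class_chain_def
    proof (intro conjI allI impI)
      fix n assume "Suc n < length Ds"
      then show "class_access A (Ds ! n) (Ds ! Suc n)"
        using Cs(1)[unfolded class_chain_def Ds, THEN conjunct2, THEN conjunct2, THEN conjunct2, rule_format, of "Suc n"] by simp
    qed (use Cs(1) Ds False in \<open>auto simp: class_chain_def\<close>)
    have "class_access A C (hd Ds)"
      using Cs(1)[unfolded class_chain_def Ds, THEN conjunct2, THEN conjunct2, THEN conjunct2, rule_format, of 0] False hd(1) by simp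
    moreover have "C \<noteq> hd Ds" "is_class A (hd Ds)" using Cs(1) hd(2) unfolding class_chain_def Ds by auto
    moreover have "class_depth A C \<le> bas C + class_depth A (hd Ds)"
      using Cs(3) chain_length_le_depth[OF ch refl] unfolding Ds chain_length_Cons by linarith
    ultimately show ?thesis by blast
  qed
qed

lemma below_iff: "i < N \<Longrightarrow> k \<in> below S (fn A) i \<longleftrightarrow> k < N \<and> cl i \<noteq> cl k \<and> class_access A (cl i) (cl k)"
  using class_access_iff[of i k] self_in_scc[of k S "fn A"] scc_eqI[of k S "fn A" i] by (auto simp: below_def)

text \<open>A class with root \<open>\<rho>\<close> forces growth \<open>\<rho>^n\<close> by itself,
  which \<open>growth_le_above_spr\<close> forbids for \<open>\<rho>\<close> above the spectral
  radius.\<close>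

lemma spr_class_le:
  assumes pos: "0 < spr A" and i: "i < N"
    and w: "\<And>k. k \<in> cl i \<Longrightarrow> 0 < w k" and \<rho>: "0 \<le> \<rho>" and Aw: "\<And>k. k \<in> cl i \<Longrightarrow> ap (cl i) (fn A) w k = \<rho> * w k"
  shows "\<rho> \<le> spr A"
proof (rule ccontr)
  assume "\<not> ?thesis"
  then have less: "spr A < \<rho>" by simp
  define s where "s = (spr A + \<rho>) / 2"
  have s: "spr A < s" "s < \<rho>" "0 < s" using less pos by (auto simp: s_def)
  have "growth_le (pt (new_type \<rho> 0 0)) (\<lambda>n. it S (fn A) n (\<lambda>_. 1) i)"
    by (rule step_lower[OF _ nn scc_subset w \<rho> Aw]) (use i self_in_scc[of i S] in auto)
  also have "growth_le (\<lambda>n. it S (fn A) n (\<lambda>_. 1) i) (pe s 0)"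
    by (rule growth_le_above_spr[OF A _ nn s(1,3) i]) (use i in simp)
  finally (growth_le_trans) have "growth_le (pe \<rho> 0) (pe s 0)" using s by (simp add: new_type_def)
  then show False using pe_dom_strict[of \<rho> 0 s 0] s by simp
qed

text \<open>As all roots are at most \<open>spr A\<close>, \<open>new_type\<close> raises the degree
  exactly at basic classes, just as the depth counts them. A basic class with no other basic class
  below it has depth 1 but degree 0, hence the shift by one. At depth 0 no basic class is accessible
  and the rate is smaller.\<close>

lemma growth_depth:
  assumes pos: "0 < spr A" and i: "i < N"
  shows "\<exists>t. 0 \<le> fst t \<and> growth_eq (\<lambda>n. it S (fn A) n (\<lambda>_. 1) i) (pt t) \<and>
    (if class_depth A (cl i) = 0 then fst t < spr A else t = (spr A, class_depth A (cl i) - 1))"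
proof (rule scc_induct[where S = S and A = "fn A" and i = i])
  fix i assume iS: "i \<in> S"
    and IH: "\<And>j. j \<in> below S (fn A) i \<Longrightarrow> \<exists>t. 0 \<le> fst t \<and> growth_eq (\<lambda>n. it S (fn A) n (\<lambda>_. 1) j) (pt t) \<and>
      (if class_depth A (cl j) = 0 then fst t < spr A else t = (spr A, class_depth A (cl j) - 1))"
  have i: "i < N" using iS by simp
  let ?d = "\<lambda>k. class_depth A (cl k)"
  obtain ty where ty: "\<And>j. j \<in> below S (fn A) i \<Longrightarrow> 0 \<le> fst (ty j) \<and> growth_eq (\<lambda>n. it S (fn A) n (\<lambda>_. 1) j) (pt (ty j))"
    and tyd: "\<And>j. j \<in> below S (fn A) i \<Longrightarrow> if ?d j = 0 then fst (ty j) < spr A else ty j = (spr A, ?d j - 1)"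
    using IH by metis
  obtain \<rho> w where \<rho>: "0 \<le> \<rho>" and w: "\<And>k. k \<in> cl i \<Longrightarrow> 0 < w k" and Aw: "\<And>k. k \<in> cl i \<Longrightarrow> ap (cl i) (fn A) w k = \<rho> * w k"
    using scc_perron[OF _ nn iS] by auto
  have \<rho>le: "\<rho> \<le> spr A" by (rule spr_class_le[OF pos i w \<rho> Aw])
  have "spr (submatrix A (cl i) (cl i)) = \<rho>"
    by (rule spr_submatrix[OF A nn scc_subset _ w \<rho> Aw]) (use self_in_scc[OF iS] in auto)
  moreover have cli: "is_class A (cl i)" using class_iff i by blast
  ultimately have bas: "bas (cl i) = (if \<rho> = spr A then 1 else 0)" by (simp add: basic_class_def)
  have cases: "?d i = bas (cl i) \<or> (\<exists>k\<in>below S (fn A) i. ?d i \<le> bas (cl i) + ?d k)"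
    using depth_le[OF cli] class_iff below_iff[OF i] by metis
  have ge: "bas (cl i) + ?d k \<le> ?d i" if "k \<in> below S (fn A) i" for k
    using depth_ge[OF cli, of "cl k"] below_iff[OF i] class_iff that by blast
  have "(below S (fn A) i = {} \<and> growth_eq (\<lambda>n. it S (fn A) n (\<lambda>_. 1) i) (pt (new_type \<rho> 0 0))) \<or>
    (\<exists>j\<in>below S (fn A) i. (\<forall>k\<in>below S (fn A) i. type_le (ty k) (ty j)) \<and>
      growth_eq (\<lambda>n. it S (fn A) n (\<lambda>_. 1) i) (pt (new_type \<rho> (fst (ty j)) (snd (ty j)))))"
    by (rule scc_growth[OF _ nn iS _ ty w \<rho> Aw]) auto
  then show "\<exists>t. 0 \<le> fst t \<and> growth_eq (\<lambda>n. it S (fn A) n (\<lambda>_. 1) i) (pt t) \<and>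
    (if ?d i = 0 then fst t < spr A else t = (spr A, ?d i - 1))"
  proof
    assume *: "below S (fn A) i = {} \<and> growth_eq (\<lambda>n. it S (fn A) n (\<lambda>_. 1) i) (pt (new_type \<rho> 0 0))"
    then have "?d i = bas (cl i)" using cases by blast
    then show ?thesis using * bas \<rho>le \<rho> pos
      by (intro exI[of _ "new_type \<rho> 0 0"]) (auto simp: new_type_def)
  next
    assume "\<exists>j\<in>below S (fn A) i. (\<forall>k\<in>below S (fn A) i. type_le (ty k) (ty j)) \<and>
      growth_eq (\<lambda>n. it S (fn A) n (\<lambda>_. 1) i) (pt (new_type \<rho> (fst (ty j)) (snd (ty j))))"
    then obtain j where j: "j \<in> below S (fn A) i" "\<And>k. k \<in> below S (fn A) i \<Longrightarrow> type_le (ty k) (ty j)"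
      and g: "growth_eq (\<lambda>n. it S (fn A) n (\<lambda>_. 1) i) (pt (new_type \<rho> (fst (ty j)) (snd (ty j))))" by blast
    \<comment> \<open>A state of maximal type is also one of maximal depth: all positive depths
      share the rate \<open>spr A\<close>, and depth 0 has a smaller one.\<close>
    have dle: "?d k \<le> ?d j" if k: "k \<in> below S (fn A) i" for k
    proof (cases "?d k = 0")
      case False
      then have tk: "ty k = (spr A, ?d k - 1)" using tyd[OF k] by simp
      then have "spr A \<le> fst (ty j)" using j(2)[OF k] by (auto simp: type_le_def)
      then have "?d j \<noteq> 0" using tyd[OF j(1)] by (auto split: if_splits)
      then have "ty j = (spr A, ?d j - 1)" using tyd[OF j(1)] by simp
      then show ?thesis using j(2)[OF k] tk \<open>?d j \<noteq> 0\<close> by (auto simp: type_le_def)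
    qed simp
    have d: "?d i = bas (cl i) + ?d j" using cases ge[OF j(1)] dle by fastforce
    have "0 \<le> fst (new_type \<rho> (fst (ty j)) (snd (ty j)))" using \<rho> ty[OF j(1)] by (simp add: fst_new_type)
    moreover have "if ?d i = 0 then fst (new_type \<rho> (fst (ty j)) (snd (ty j))) < spr A
      else new_type \<rho> (fst (ty j)) (snd (ty j)) = (spr A, ?d i - 1)"
      using tyd[OF j(1)] \<rho>le unfolding d bas by (auto simp: new_type_def split: if_splits)
    ultimately show ?thesis using g by blast
  qed
qed (use i in auto)

lemma growth_principal_part:
  assumes pos: "0 < spr A" and i: "i \<in> principal_part A k" and k: "1 \<le> k"
  shows "i < N \<and> growth_eq (\<lambda>n. it S (fn A) n (\<lambda>_. 1) i) (\<lambda>n. real n ^ (k - 1) * spr A ^ n)"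
proof -
  obtain C where C: "is_class A C" "class_depth A C = k" "i \<in> C" using i unfolding principal_part_def by blast
  then obtain m where m: "m < N" "C = cl m" using class_iff by blast
  have iN: "i < N" using C(3) m(2) by (auto simp: scc_def)
  have "C = cl i" using scc_eqI[of i S "fn A" m] C(3) m(2) by simp
  then have "growth_eq (\<lambda>n. it S (fn A) n (\<lambda>_. 1) i) (pe (spr A) (k - 1))"
    using growth_depth[OF pos iN] C(2) k by auto
  then show ?thesis using growth_eq_trans growth_eq_pe_power[of "spr A" "k - 1"] pos iN by (meson less_imp_le)
qed

end

theorem corollary11:
  fixes N :: nat and K :: "real mat set" and B\<^sub>0 :: "real mat" and l :: real and \<nu> :: nat
    and S :: "nat \<Rightarrow> nat set"
  assumes "finite K" and "K \<noteq> {}"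
    and "K \<subseteq> carrier_mat N N"
    and "\<And>A. A \<in> K \<Longrightarrow> nonneg_mat A"
    and "product_property N K"
    and "\<And>A. A \<in> K \<Longrightarrow> 0 < spr A"
    and "growth_minimal N K B\<^sub>0"
    and "l = spr B\<^sub>0" and "\<nu> = mat_degree B\<^sub>0"
    and "\<And>k. S k = principal_part B\<^sub>0 k"
  shows "(\<forall>v\<in>carrier_vec N. pos_vec v \<longrightarrow> (\<forall>k\<in>{1..\<nu>}. \<forall>i\<in>S k.
            growth_eq (\<lambda>n. (min_map K ^^ n) v $ i) (\<lambda>n. real n ^ (k - 1) * l ^ n))) \<and>
         (\<forall>B. growth_minimal N K B \<longrightarrow> (\<forall>v\<in>carrier_vec N. pos_vec v \<longrightarrow> (\<forall>i<N.
            growth_eq (\<lambda>n. (min_map K ^^ n) v $ i) (\<lambda>n. ((B ^\<^sub>m n) *\<^sub>v v) $ i))))"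
  proof -
  let ?S = "{0..<N}" and ?R = "row_choices K"
  have rs: "row_system ?S ?R" by (rule row_system_row_choices) (use assms in auto)
  have nn: "nonneg_on ?S (fn B)" and BN: "B \<in> carrier_mat N N" if "B \<in> K" for B
    using that assms(3,4) nonneg_mat_nonneg_on by auto
  have vpos: "0 < v $ j" if "v \<in> carrier_vec N" "pos_vec v" "j \<in> ?S" for v :: "real vec" and j
    using that by (auto simp: pos_vec_def)
  have part2: "growth_eq (\<lambda>n. (min_map K ^^ n) v $ i) (\<lambda>n. ((B ^\<^sub>m n) *\<^sub>v v) $ i)"
    if B: "growth_minimal N K B" and v: "v \<in> carrier_vec N" "pos_vec v" and i: "i < N" for B v i
  proof -
    have BK: "B \<in> K" using B by (simp add: growth_minimal_def)
    have pB: "policy ?S ?R (fn B)" using BK by (auto simp: policy_def row_choices_def)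
    have iS: "i \<in> ?S" using i by simp
    have fin: "finite ?S" by simp
    have f: "(min_map K ^^ n) v $ i = (minop ?S ?R ^^ n) (\<lambda>j. v $ j) i" for n
      using min_map_iter[OF assms(3) v(1)] i by blast
    have b: "((B ^\<^sub>m n) *\<^sub>v v) $ i = it ?S (fn B) n (\<lambda>j. v $ j) i" for n
      by (rule pow_mat_vec_eq_it[OF BN[OF BK] v(1) i])
    have upper: "growth_le (\<lambda>n. (minop ?S ?R ^^ n) (\<lambda>j. v $ j) i) (\<lambda>n. it ?S (fn B) n (\<lambda>j. v $ j) i)"
      by (intro growth_le_mono minop_iter_le_it[OF rs pB _ iS]) simp
    \<comment> \<open>A detour through the constant vector 1, for which the lower bound on the
      minimal iterates was proved.\<close>
    have "growth_le (\<lambda>n. it ?S (fn B) n (\<lambda>j. v $ j) i) (\<lambda>n. it ?S (fn B) n (\<lambda>_. 1) i)"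
      by (rule it_growth_cong[OF fin nn[OF BK] _ iS]) simp
    also have "growth_le (\<lambda>n. it ?S (fn B) n (\<lambda>_. 1) i) (\<lambda>n. (minop ?S ?R ^^ n) (\<lambda>_. 1) i)"
      by (rule minimal_policy_growth[OF rs pB _ iS])
        (use growth_minimal_policy[OF assms(2,3,5) B] in auto)
    also have "growth_le (\<lambda>n. (minop ?S ?R ^^ n) (\<lambda>_. 1) i) (\<lambda>n. (minop ?S ?R ^^ n) (\<lambda>j. v $ j) i)"
      by (rule minop_iter_growth_cong[OF rs vpos[OF v] iS])
    finally (growth_le_trans) show ?thesis unfolding f b growth_eq_def using upper by blast
  qed
  have BK: "B\<^sub>0 \<in> K" using assms(7) by (simp add: growth_minimal_def)
  have nm: "nonneg_matrix B\<^sub>0 N" by (rule nonneg_matrix.intro[OF BN[OF BK] nn[OF BK]])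
  have part1: "growth_eq (\<lambda>n. (min_map K ^^ n) v $ i) (\<lambda>n. real n ^ (k - 1) * l ^ n)"
    if v: "v \<in> carrier_vec N" "pos_vec v" and k: "1 \<le> k" and i: "i \<in> S k" for v k i
  proof -
    have iN: "i < N" and g: "growth_eq (\<lambda>n. it ?S (fn B\<^sub>0) n (\<lambda>_. 1) i) (\<lambda>n. real n ^ (k - 1) * l ^ n)"
      using nonneg_matrix.growth_principal_part[OF nm assms(6)[OF BK] _ k, of i] i unfolding assms(8,10) by auto
    have iS: "i \<in> ?S" and fin: "finite ?S" using iN by auto
    have "growth_eq (\<lambda>n. it ?S (fn B\<^sub>0) n (\<lambda>j. v $ j) i) (\<lambda>n. it ?S (fn B\<^sub>0) n (\<lambda>_. 1) i)"
      unfolding growth_eq_def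
      by (intro conjI it_growth_cong[OF fin nn[OF BK] _ iS] vpos[OF v]) auto
    then have "growth_eq (\<lambda>n. ((B\<^sub>0 ^\<^sub>m n) *\<^sub>v v) $ i) (\<lambda>n. real n ^ (k - 1) * l ^ n)"
      unfolding pow_mat_vec_eq_it[OF BN[OF BK] v(1) iN] using g by (rule growth_eq_trans)
    with part2[OF assms(7) v iN] show ?thesis by (rule growth_eq_trans)
  qed
  show ?thesis using part1 part2 by auto
qed

end
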